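(* Let $M^n$, $n\ge2$, be a compact oriented smooth manifold with boundary $\partial M$, and let $t\mapsto g(t)$ be a smooth variation of a Riemannian metric $g=g(0)$ on $M$. Let $\{\phi_i(t)\}\subset C^\infty(M)$ be a differentiable family of functions and $\lambda(t)$ a differentiable family of real numbers such that $\langle\phi_i(t),\phi_j(t)\rangle_{L^2(M,dv_{g(t)})}=\delta_i^j$ for all $t$ and $$\begin{cases}-\Delta_{g(t)}\phi_i(t)=\lambda(t)\phi_i(t) & \text{in } M,\\ \frac{\partial}{\partial\nu_t}\phi_i(t)=0 & \text{on }\partial M.\end{cases}$$ Then, for all $i,j$, $$\lambda'(0)\,\delta_i^j=\int_M\Big\langle\tfrac14\Delta(\phi_i\phi_j)\,g-d\phi_i\otimes d\phi_j,\,H\Big\rangle\,dv_g ,$$ where $\phi_i=\phi_i(0)$, $\Delta=\Delta_g$ and $H=\frac{d}{dt}\big|_{t=0}g(t)$.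
   Context: $\Delta_g$ is the Laplace-Beltrami operator ($\Delta_g f=\operatorname{div}_g\nabla f$), $dv_g$ the Riemannian volume element of $g$, and $\nu_t$ the exterior unit normal to $\partial M$ with respect to $g(t)$. $H$ is the symmetric $(0,2)$-tensor $H_{ij}=\frac{d}{dt}\big|_{t=0}g_{ij}(t)$. For $(0,2)$-tensors $T,S$, $\langle T,S\rangle=g^{ik}g^{jl}T_{ij}S_{kl}$. The families $\phi_i(t)$ are indexed by a finite set of indices $i$, all sharing the same eigenvalue $\lambda(t)$, and are differentiable in $t$ as curves in $C^\infty(M)$. *)

theory Defs
  imports "HOL-Analysis.Analysis"
begin

section \<open>Smooth maps\<close>

fun Ck_on :: "nat \<Rightarrow> 'e::euclidean_space set \<Rightarrow> ('e \<Rightarrow> 'f::real_normed_vector) \<Rightarrow> bool" where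
  "Ck_on 0 V F \<longleftrightarrow> continuous_on V F"
| "Ck_on (Suc k) V F \<longleftrightarrow>
     (\<forall>q\<in>V. F differentiable (at q)) \<and> (\<forall>v. Ck_on k V (\<lambda>q. frechet_derivative F (at q) v))"

text \<open>Smoothness on an arbitrary subset (relatively open subsets of a half-space, in what follows)
  means that smooth extensions exist locally.\<close>

definition smooth_on :: "'e::euclidean_space set \<Rightarrow> ('e \<Rightarrow> 'f::real_normed_vector) \<Rightarrow> bool" where
  "smooth_on S F \<longleftrightarrow>
     (\<forall>p\<in>S. \<exists>V E. open V \<and> p \<in> V \<and> (\<forall>k. Ck_on k V E) \<and> (\<forall>q\<in>V \<inter> S. E q = F q))"

section \<open>Oriented manifolds with boundary\<close>

text \<open>The model space is a half-space; the coordinate bounding it is an arbitrary but fixed one.\<close>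

definition bdry_ix :: "'n::finite" where
  "bdry_ix = (SOME i. True)"

definition half_space :: "(real^'n::finite) set" where
  "half_space = {q. 0 \<le> q $ bdry_ix}"

text \<open>Derivatives are taken within the half-space, so that they make sense at boundary points;
  a half-space has enough directions for them to be unique.\<close>

definition partial :: "'n \<Rightarrow> (real^'n::finite \<Rightarrow> real) \<Rightarrow> real^'n \<Rightarrow> real" where
  "partial i f q = frechet_derivative f (at q within half_space) (axis i 1)"

definition jacobian :: "(real^'n::finite \<Rightarrow> real^'n) \<Rightarrow> real^'n \<Rightarrow> real^'n^'n" where
  "jacobian F q = matrix (frechet_derivative F (at q within half_space))"

text \<open>The list enumerates the directions of an iterated partial derivative.\<close>

fun iter_partial :: "'n list \<Rightarrow> (real^'n::finite \<Rightarrow> real) \<Rightarrow> real^'n \<Rightarrow> real" where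
  "iter_partial [] f = f"
| "iter_partial (i # is) f = partial i (iter_partial is f)"

text \<open>A chart is a pair of a domain and a coordinate map; only the values of the map on the
  domain matter.\<close>

type_synonym ('a, 'n) chart = "'a set \<times> ('a \<Rightarrow> real^'n)"

definition chart_inv :: "('a, 'n) chart \<Rightarrow> real^'n \<Rightarrow> 'a" where
  "chart_inv c = inv_into (fst c) (snd c)"

definition chart_image :: "('a, 'n) chart \<Rightarrow> (real^'n) set" where
  "chart_image c = snd c ` fst c"

definition is_chart :: "'a::t2_space set \<Rightarrow> ('a, 'n::finite) chart \<Rightarrow> bool" where
  "is_chart M c \<longleftrightarrow>
     openin (top_of_set M) (fst c) \<and>
     openin (top_of_set half_space) (chart_image c) \<and>
     homeomorphism (fst c) (chart_image c) (snd c) (chart_inv c)"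

text \<open>Jacobian matrix at the point \<open>p\<close> of the transition map from \<open>c\<close> to \<open>c'\<close>.\<close>

definition trans_jac :: "('a, 'n::finite) chart \<Rightarrow> ('a, 'n) chart \<Rightarrow> 'a \<Rightarrow> real^'n^'n" where
  "trans_jac c c' p = jacobian (snd c' \<circ> chart_inv c) (snd c p)"

text \<open>An orientation is given by an atlas all of whose transition maps preserve the orientation
  of \<open>\<real>\<^sup>n\<close>; in dimension at least two, every oriented manifold with boundary has
  such an atlas with values in one fixed half-space.\<close>

definition oriented_atlas :: "'a::t2_space set \<Rightarrow> ('a, 'n::finite) chart set \<Rightarrow> bool" where
  "oriented_atlas M A \<longleftrightarrow>
     (\<Union>c\<in>A. fst c) = M \<and>
     (\<forall>c\<in>A. is_chart M c) \<and>
     (\<forall>c\<in>A. \<forall>c'\<in>A.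
        smooth_on (snd c ` (fst c \<inter> fst c')) (snd c' \<circ> chart_inv c) \<and>
        (\<forall>p\<in>fst c \<inter> fst c'. 0 < det (trans_jac c c' p)))"

definition compact_oriented_manifold :: "'a::t2_space set \<Rightarrow> ('a, 'n::finite) chart set \<Rightarrow> bool" where
  "compact_oriented_manifold M A \<longleftrightarrow> compact M \<and> oriented_atlas M A"

definition mfd_boundary :: "('a, 'n::finite) chart set \<Rightarrow> 'a set" where
  "mfd_boundary A = {p. \<exists>c\<in>A. p \<in> fst c \<and> snd c p $ bdry_ix = 0}"

text \<open>Invariantly defined pointwise quantities are evaluated in an arbitrary chart around the
  point.\<close>

definition chart_at :: "('a, 'n) chart set \<Rightarrow> 'a \<Rightarrow> ('a, 'n) chart" where
  "chart_at A p = (SOME c. c \<in> A \<and> p \<in> fst c)"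

section \<open>The space of smooth functions\<close>

definition smooth_fun :: "('a, 'n::finite) chart set \<Rightarrow> ('a \<Rightarrow> real) \<Rightarrow> bool" where
  "smooth_fun A f \<longleftrightarrow> (\<forall>c\<in>A. smooth_on (chart_image c) (f \<circ> chart_inv c))"

text \<open>Convergence in the Frechet space of smooth functions: all partial derivatives converge
  uniformly on compact subsets of the charts.\<close>

definition smooth_limit ::
  "('a, 'n::finite) chart set \<Rightarrow> ('t \<Rightarrow> 'a \<Rightarrow> real) \<Rightarrow> ('a \<Rightarrow> real) \<Rightarrow> 't filter \<Rightarrow> bool" where
  "smooth_limit A F f T \<longleftrightarrow>
     (\<forall>c\<in>A. \<forall>K is. compact K \<and> K \<subseteq> chart_image c \<longrightarrow>
        uniform_limit K (\<lambda>s. iter_partial is (F s \<circ> chart_inv c)) (iter_partial is (f \<circ> chart_inv c)) T)"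

definition differentiable_curve ::
  "('a, 'n::finite) chart set \<Rightarrow> real set \<Rightarrow> (real \<Rightarrow> 'a \<Rightarrow> real) \<Rightarrow> bool" where
  "differentiable_curve A I f \<longleftrightarrow>
     (\<forall>t\<in>I. smooth_fun A (f t)) \<and>
     (\<forall>t\<in>I. \<exists>f'. smooth_fun A f' \<and>
        smooth_limit A (\<lambda>s p. (f s p - f t p) / (s - t)) f' (at t within I))"

section \<open>Tensor fields and Riemannian metrics\<close>

text \<open>Tensor fields are given by their components in each chart. Covectors and vectors at a point
  have components in \<open>real^'n\<close>, and (0,2)-tensors \<open>T\<close> have components
  \<open>T c p $ i $ j\<close>.\<close>

type_synonym ('a, 'n) vec_field = "('a, 'n) chart \<Rightarrow> 'a \<Rightarrow> real^'n"
type_synonym ('a, 'n) tensor2 = "('a, 'n) chart \<Rightarrow> 'a \<Rightarrow> real^'n^'n"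

definition tensor2_field :: "('a, 'n::finite) chart set \<Rightarrow> ('a, 'n) tensor2 \<Rightarrow> bool" where
  "tensor2_field A T \<longleftrightarrow>
     (\<forall>c\<in>A. \<forall>c'\<in>A. \<forall>p\<in>fst c \<inter> fst c'.
        T c p = transpose (trans_jac c c' p) ** T c' p ** trans_jac c c' p) \<and>
     (\<forall>c\<in>A. smooth_on (chart_image c) (T c \<circ> chart_inv c))"

definition riemannian_metric :: "('a, 'n::finite) chart set \<Rightarrow> ('a, 'n) tensor2 \<Rightarrow> bool" where
  "riemannian_metric A g \<longleftrightarrow>
     tensor2_field A g \<and>
     (\<forall>c\<in>A. \<forall>p\<in>fst c. transpose (g c p) = g c p \<and> (\<forall>v. v \<noteq> 0 \<longrightarrow> 0 < v \<bullet> (g c p *v v)))"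

definition smooth_variation ::
  "('a, 'n::finite) chart set \<Rightarrow> real set \<Rightarrow> (real \<Rightarrow> ('a, 'n) tensor2) \<Rightarrow> bool" where
  "smooth_variation A I g \<longleftrightarrow>
     (\<forall>t\<in>I. riemannian_metric A (g t)) \<and>
     (\<forall>c\<in>A. smooth_on (I \<times> chart_image c) (\<lambda>(t, q). g t c (chart_inv c q)))"

definition variation_tensor :: "(real \<Rightarrow> ('a, 'n::finite) tensor2) \<Rightarrow> ('a, 'n) tensor2" where
  "variation_tensor g = (\<lambda>c p. vector_derivative (\<lambda>t. g t c p) (at 0))"

definition differential :: "('a \<Rightarrow> real) \<Rightarrow> ('a, 'n::finite) vec_field" where
  "differential f = (\<lambda>c p. \<chi> i. partial i (f \<circ> chart_inv c) (snd c p))"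

definition tensor_prod ::
  "('a, 'n::finite) vec_field \<Rightarrow> ('a, 'n) vec_field \<Rightarrow> ('a, 'n) tensor2" (infixl "\<otimes>\<^sub>T" 70) where
  "\<alpha> \<otimes>\<^sub>T \<beta> = (\<lambda>c p. \<chi> i j. \<alpha> c p $ i * \<beta> c p $ j)"

definition tensor_inner ::
  "('a, 'n::finite) chart set \<Rightarrow> ('a, 'n) tensor2 \<Rightarrow> ('a, 'n) tensor2 \<Rightarrow> ('a, 'n) tensor2 \<Rightarrow> 'a \<Rightarrow> real"
  where
  "tensor_inner A g T S p =
     (let c = chart_at A p; G = matrix_inv (g c p) in
      \<Sum>i\<in>UNIV. \<Sum>j\<in>UNIV. \<Sum>k\<in>UNIV. \<Sum>l\<in>UNIV.
        G $ i $ k * G $ j $ l * T c p $ i $ j * S c p $ k $ l)"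

definition gradient :: "('a, 'n::finite) tensor2 \<Rightarrow> ('a \<Rightarrow> real) \<Rightarrow> ('a, 'n) vec_field" where
  "gradient g f = (\<lambda>c p. matrix_inv (g c p) *v differential f c p)"

definition divergence ::
  "('a, 'n::finite) chart set \<Rightarrow> ('a, 'n) tensor2 \<Rightarrow> ('a, 'n) vec_field \<Rightarrow> 'a \<Rightarrow> real" where
  "divergence A g X p =
     (let c = chart_at A p in
      (\<Sum>i\<in>UNIV. partial i (\<lambda>q. sqrt (det (g c (chart_inv c q))) * X c (chart_inv c q) $ i) (snd c p))
        / sqrt (det (g c p)))"

definition laplacian ::
  "('a, 'n::finite) chart set \<Rightarrow> ('a, 'n) tensor2 \<Rightarrow> ('a \<Rightarrow> real) \<Rightarrow> 'a \<Rightarrow> real" where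
  "laplacian A g f = divergence A g (gradient g f)"

text \<open>The unit vector that is \<open>g\<close>-orthogonal to the tangent space of the boundary and
  points out of the half-space; only used at boundary points.\<close>

definition outer_normal :: "('a, 'n::finite) tensor2 \<Rightarrow> ('a, 'n) vec_field" where
  "outer_normal g = (\<lambda>c p. THE v.
     v \<bullet> (g c p *v v) = 1 \<and>
     (\<forall>w. w $ bdry_ix = 0 \<longrightarrow> v \<bullet> (g c p *v w) = 0) \<and>
     v $ bdry_ix < 0)"

definition normal_derivative ::
  "('a, 'n::finite) chart set \<Rightarrow> ('a, 'n) tensor2 \<Rightarrow> ('a \<Rightarrow> real) \<Rightarrow> 'a \<Rightarrow> real" where
  "normal_derivative A g f p =
     (let c = chart_at A p in \<Sum>i\<in>UNIV. outer_normal g c p $ i * differential f c p $ i)"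

text \<open>The Riemannian volume is the unique Borel measure on \<open>M\<close> that has density
  \<open>sqrt (det g)\<close> in each chart of the atlas.\<close>

definition is_volume_measure ::
  "'a::t2_space set \<Rightarrow> ('a, 'n::finite) chart set \<Rightarrow> ('a, 'n) tensor2 \<Rightarrow> 'a measure \<Rightarrow> bool" where
  "is_volume_measure M A g \<mu> \<longleftrightarrow>
     space \<mu> = M \<and> sets \<mu> = sets (restrict_space borel M) \<and>
     (\<forall>c\<in>A. \<forall>B\<in>sets \<mu>. B \<subseteq> fst c \<longrightarrow>
        emeasure \<mu> B = (\<integral>\<^sup>+q\<in>snd c ` B. ennreal (sqrt (det (g c (chart_inv c q)))) \<partial>lborel))"

definition volume_measure ::
  "'a::t2_space set \<Rightarrow> ('a, 'n::finite) chart set \<Rightarrow> ('a, 'n) tensor2 \<Rightarrow> 'a measure" where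
  "volume_measure M A g = (THE \<mu>. is_volume_measure M A g \<mu>)"

definition L2_inner ::
  "'a::t2_space set \<Rightarrow> ('a, 'n::finite) chart set \<Rightarrow> ('a, 'n) tensor2 \<Rightarrow> ('a \<Rightarrow> real) \<Rightarrow> ('a \<Rightarrow> real) \<Rightarrow> real"
  where
  "L2_inner M A g u v = (LINT p|volume_measure M A g. u p * v p)"

end

theory Submission
  imports Defs
begin

text \<open>Write \<open>u = \<phi>\<^sub>j(t)\<close> and \<open>v = \<phi>\<^sub>i(0)\<close>. Because of the Neumann condition, the weak form of the equation for
  \<open>u\<close> at time \<open>t\<close> may be tested with \<open>v\<close>, and that for \<open>v\<close> at time \<open>0\<close> with \<open>u\<close>. Subtracting the two
  identities, dividing by \<open>t\<close> and letting \<open>t\<close> tend to \<open>0\<close> gives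
  \<open>\<lambda>'(0) \<integral> \<phi>\<^sub>i\<phi>\<^sub>j + \<lambda>(0) \<integral> \<phi>\<^sub>i\<phi>\<^sub>j tr H / 2 = \<integral> (\<langle>d\<phi>\<^sub>i, d\<phi>\<^sub>j\<rangle> tr H / 2 - H(\<nabla>\<phi>\<^sub>i, \<nabla>\<phi>\<^sub>j))\<close>,
  which is the claim since \<open>\<Delta>(\<phi>\<^sub>i\<phi>\<^sub>j) = 2\<langle>d\<phi>\<^sub>i, d\<phi>\<^sub>j\<rangle> - 2\<lambda>(0)\<phi>\<^sub>i\<phi>\<^sub>j\<close>. In this way no derivative of the
  eigenfunctions with respect to \<open>t\<close> appears, and the limit is one of dominated convergence on the
  fixed measure space of \<open>g(0)\<close>.

  Integration by parts in a chart rests on the translation invariance of Lebesgue measure. Tested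
  against bump functions it also shows that the Laplacian of a Neumann function does not depend
  on the chart.\<close>

section \<open>Locally extendable continuously differentiable functions\<close>

text \<open>\<open>laplacian\<close> evaluates the coordinate formula at each point in the chart
  that \<open>chart_at\<close> happens to pick there, and this choice may jump from point to point.
  So the eigenvalue equation cannot be integrated by parts in one chart before chart independence is
  known. A direct proof would differentiate the transition maps twice; the weak argument gets by
  with the first-order transformation rules for gradient and volume density. It does require the
  Neumann condition in every chart, hence the invariance of the boundary and the shape of the
  transition Jacobians there. The product of two eigenfunctions is treated differently: its
  Laplacian at a point is expanded by the product rule inside the chosen chart. The volume is given
  by a definite description, so existence and uniqueness of the measure have to be established
  before any integral can be computed. Coefficients and test functions are differentiated once only,
  which is why the calculus is set up for C^1 functions that extend locally across the
  boundary.\<close>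

definition C1_extension ::
  "'e::euclidean_space set \<Rightarrow> ('e \<Rightarrow> 'f::real_normed_vector) \<Rightarrow> 'e \<Rightarrow>
    'e set \<Rightarrow> ('e \<Rightarrow> 'f) \<Rightarrow> ('e \<Rightarrow> 'e \<Rightarrow> 'f) \<Rightarrow> bool" where
  "C1_extension S f p V E E' \<longleftrightarrow> open V \<and> p \<in> V \<and> (\<forall>q\<in>V. (E has_derivative E' q) (at q)) \<and>
     (\<forall>v. continuous_on V (\<lambda>q. E' q v)) \<and> (\<forall>q\<in>V \<inter> S. E q = f q)"

text \<open>Continuity of the derivative is asked in each fixed direction, which suffices in finite
  dimension. The extensions live on open sets, so sums, products and compositions can be formed
  there and boundary points need no separate treatment.\<close>

definition C1_on :: "'e::euclidean_space set \<Rightarrow> ('e \<Rightarrow> 'f::real_normed_vector) \<Rightarrow> bool" where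
  "C1_on S f \<longleftrightarrow> (\<forall>p\<in>S. \<exists>V E E'. C1_extension S f p V E E')"

lemma C1_onI:
  assumes "\<And>p. p \<in> S \<Longrightarrow> \<exists>V E E'. C1_extension S f p V E E'"
  shows "C1_on S f"
  unfolding C1_on_def using assms by (rule ballI)

lemma C1_onE:
  assumes "C1_on S f" "p \<in> S"
  obtains V E E' where "C1_extension S f p V E E'"
  using bspec[OF assms(1)[unfolded C1_on_def] assms(2)] by (elim exE)

lemma C1_extensionD:
  assumes "C1_extension S f p V E E'"
  shows "open V" "p \<in> V" "\<forall>q\<in>V. (E has_derivative E' q) (at q)"
    "\<forall>v. continuous_on V (\<lambda>q. E' q v)" "\<forall>q\<in>V \<inter> S. E q = f q" "continuous_on V E"
proof -
  show "\<forall>q\<in>V. (E has_derivative E' q) (at q)" using assms by (simp add: C1_extension_def)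
  then show "continuous_on V E"
    by (intro continuous_at_imp_continuous_on) (auto intro: has_derivative_continuous)
qed (use assms in \<open>simp_all add: C1_extension_def\<close>)

lemma C1_on_subset:
  assumes "C1_on S f" "T \<subseteq> S" shows "C1_on T f"
proof (rule C1_onI)
  fix p assume "p \<in> T"
  then have "p \<in> S" using assms by blast
  from assms(1) this obtain V E E' where "C1_extension S f p V E E'" by (rule C1_onE)
  note ext = C1_extensionD[OF this]
  then show "\<exists>V E E'. C1_extension T f p V E E'"
    unfolding C1_extension_def
    using assms(2) by (intro exI[of _ V] exI[of _ E] exI[of _ E']) auto
qed

lemma C1_on_cong: "C1_on S f \<Longrightarrow> (\<And>q. q \<in> S \<Longrightarrow> f q = h q) \<Longrightarrow> C1_on S h"
  unfolding C1_on_def C1_extension_def by simp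

lemma C1_on_local:
  assumes "\<And>p. p \<in> S \<Longrightarrow> \<exists>W. open W \<and> p \<in> W \<and> C1_on (W \<inter> S) f"
  shows "C1_on S f"
proof (rule C1_onI)
  fix p assume p: "p \<in> S"
  obtain W where W: "open W" "p \<in> W" "C1_on (W \<inter> S) f" using assms[OF p] by (elim exE conjE)
  obtain V E E' where "C1_extension (W \<inter> S) f p V E E'" by (rule C1_onE[OF W(3) IntI[OF W(2) p]])
  note V = C1_extensionD[OF this]
  have "continuous_on (V \<inter> W) (\<lambda>q. E' q v)" for v
    using V(4)[rule_format] by (rule continuous_on_subset) auto
  then show "\<exists>V E E'. C1_extension S f p V E E'"
    unfolding C1_extension_def
    using V W by (intro exI[of _ "V \<inter> W"] exI[of _ E] exI[of _ E']) auto
qed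

lemma C1_on_imp_continuous_on:
  assumes "C1_on S f" shows "continuous_on S f"
proof (rule continuous_on_eq_continuous_within[THEN iffD2], rule ballI)
  fix p assume p: "p \<in> S"
  obtain V E E' where "C1_extension S f p V E E'" by (rule C1_onE[OF assms p])
  note V = C1_extensionD[OF this]
  have "continuous (at p within S) E"
    using V(2,3) has_derivative_continuous continuous_at_imp_continuous_at_within by blast
  then have "(E \<longlongrightarrow> f p) (at p within S)"
    using V(2,5) p by (simp add: continuous_within)
  moreover have "\<forall>\<^sub>F q in at p within S. E q = f q"
    unfolding eventually_at_topological by (rule exI[of _ V]) (use V(1,2,5) in auto)
  ultimately show "continuous (at p within S) f"
    unfolding continuous_within by (rule Lim_transform_eventually)
qed

lemma C1_on_const: "C1_on S (\<lambda>_. c)"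
  unfolding C1_on_def C1_extension_def
  by (rule ballI) (intro exI[of _ UNIV] exI[of _ "\<lambda>_. c"] exI[of _ "\<lambda>_ _. 0"], auto)

lemma C1_on_bounded_linear:
  assumes "bounded_linear h"
  shows "C1_on S h"
  unfolding C1_on_def C1_extension_def
  by (rule ballI) (intro exI[of _ UNIV] exI[of _ h] exI[of _ "\<lambda>_. h"], simp add: bounded_linear_imp_has_derivative[OF assms])

text \<open>Shrinking both neighbourhoods to their intersection puts the extensions of two functions
  on one open set, where they can be added and multiplied.\<close>

lemma C1_extension_common:
  assumes "C1_on S f" "C1_on S h" "p \<in> S"
  obtains V E E' F F' where "C1_extension S f p V E E'" "C1_extension S h p V F F'"
proof -
  obtain V E E' where "C1_extension S f p V E E'" by (rule C1_onE[OF assms(1,3)])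
  note V = C1_extensionD[OF this]
  obtain W F F' where "C1_extension S h p W F F'" by (rule C1_onE[OF assms(2,3)])
  note W = C1_extensionD[OF this]
  have "continuous_on (V \<inter> W) (\<lambda>q. E' q v)" "continuous_on (V \<inter> W) (\<lambda>q. F' q v)" for v
    using V(4)[rule_format, of v] W(4)[rule_format, of v] by (blast intro: continuous_on_subset)+
  then show thesis
    by (intro that[of "V \<inter> W" E E' F F'])
       (use V(1-3,5) W(1-3,5) in \<open>simp_all add: C1_extension_def open_Int\<close>)
qed

lemma C1_on_add:
  assumes "C1_on S f" "C1_on S h"
  shows "C1_on S (\<lambda>x. f x + h x)"
proof (rule C1_onI)
  fix p assume "p \<in> S"
  from assms this obtain V E E' F F' where ext: "C1_extension S f p V E E'" "C1_extension S h p V F F'"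
    by (rule C1_extension_common)
  note * = C1_extensionD[OF ext(1)] C1_extensionD[OF ext(2)]
  show "\<exists>V E E'. C1_extension S (\<lambda>q. f q + h q) p V E E'"
    unfolding C1_extension_def
    by (intro exI[of _ V] exI[of _ "\<lambda>q. E q + F q"] exI[of _ "\<lambda>q v. E' q v + F' q v"])
       (use * in \<open>auto intro!: has_derivative_add continuous_on_add\<close>)
qed

lemma C1_on_mult:
  fixes f h :: "'e::euclidean_space \<Rightarrow> real"
  assumes "C1_on S f" "C1_on S h"
  shows "C1_on S (\<lambda>x. f x * h x)"
proof (rule C1_onI)
  fix p assume "p \<in> S"
  from assms this obtain V E E' F F' where ext: "C1_extension S f p V E E'" "C1_extension S h p V F F'"
    by (rule C1_extension_common)
  note * = C1_extensionD[OF ext(1)] C1_extensionD[OF ext(2)]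
  show "\<exists>V E E'. C1_extension S (\<lambda>q. f q * h q) p V E E'"
    unfolding C1_extension_def
    by (intro exI[of _ V] exI[of _ "\<lambda>q. E q * F q"] exI[of _ "\<lambda>q v. E q * F' q v + E' q v * F q"])
       (use * in \<open>auto intro!: has_derivative_mult continuous_on_add continuous_on_mult\<close>)
qed

lemma C1_on_diff:
  fixes f h :: "'e::euclidean_space \<Rightarrow> real"
  assumes "C1_on S f" "C1_on S h"
  shows "C1_on S (\<lambda>x. f x - h x)"
  using C1_on_add[OF assms(1) C1_on_mult[OF C1_on_const[of S "-1"] assms(2)]] by simp

lemma C1_on_sum:
  assumes "\<And>i. i \<in> I \<Longrightarrow> C1_on S (f i)"
  shows "C1_on S (\<lambda>x. \<Sum>i\<in>I. f i x)"
  using assms by (induction I rule: infinite_finite_induct) (auto intro: C1_on_const C1_on_add)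

lemma C1_on_prod:
  fixes f :: "'i \<Rightarrow> 'e::euclidean_space \<Rightarrow> real"
  assumes "\<And>i. i \<in> I \<Longrightarrow> C1_on S (f i)"
  shows "C1_on S (\<lambda>x. \<Prod>i\<in>I. f i x)"
  using assms by (induction I rule: infinite_finite_induct) (auto intro: C1_on_const C1_on_mult)

text \<open>Extensions compose on the part of the first neighbourhood that is mapped into the
  second.\<close>

lemma C1_on_compose:
  fixes f :: "'e::euclidean_space \<Rightarrow> 'g::euclidean_space" and h :: "'g \<Rightarrow> 'f::real_normed_vector"
  assumes f: "C1_on S f" and h: "C1_on T h" and ST: "f ` S \<subseteq> T"
  shows "C1_on S (\<lambda>x. h (f x))"
proof (rule C1_onI)
  fix p assume p: "p \<in> S"
  obtain V E E' where "C1_extension S f p V E E'" by (rule C1_onE[OF f p])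
  note V = C1_extensionD[OF this]
  have fp: "f p \<in> T" using p ST by auto
  obtain W F F' where "C1_extension T h (f p) W F F'" by (rule C1_onE[OF h fp])
  note W = C1_extensionD[OF this]
  define U where "U = V \<inter> E -` W"
  have oU: "open U" unfolding U_def using V(1,6) W(1) by (simp add: continuous_open_preimage)
  have pU: "p \<in> U" using V(2,5) W(2) p by (auto simp: U_def)
  \<comment> \<open>The direction \<open>E' q v\<close> moves with \<open>q\<close>, whereas
    continuity of the outer derivative is known in fixed directions only; expanding in the basis
    reduces to these.\<close>
  have lin: "F' (E q) (E' q v) = (\<Sum>b\<in>Basis. (E' q v \<bullet> b) *\<^sub>R F' (E q) b)" if "q \<in> U" for q v
  proof -
    have "linear (F' (E q))" using that W(3) has_derivative_linear unfolding U_def by blast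
    then show ?thesis
      by (subst euclidean_representation[of "E' q v", symmetric])
         (simp only: linear_sum linear_cmul)
  qed
  have cF: "continuous_on U (\<lambda>q. F' (E q) b)" for b
    by (rule continuous_on_compose2[OF W(4)[rule_format]])
       (use V(6) in \<open>auto simp: U_def intro: continuous_on_subset\<close>)
  have cE: "continuous_on U (\<lambda>q. E' q v)" for v
    using V(4)[rule_format] by (rule continuous_on_subset) (auto simp: U_def)
  have c: "continuous_on U (\<lambda>q. F' (E q) (E' q v))" for v
    using continuous_on_cong[OF refl lin] by (force intro!: continuous_intros cF cE)
  have d: "((\<lambda>x. F (E x)) has_derivative (\<lambda>v. F' (E q) (E' q v))) (at q)" if "q \<in> U" for q
    using that V(3) W(3) by (intro has_derivative_compose[of E "E' q" q UNIV F "F' (E q)"]) (auto simp: U_def)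
  have eq: "F (E q) = h (f q)" if "q \<in> U \<inter> S" for q
    using that V(5) W(5) ST by (force simp: U_def)
  show "\<exists>V E E'. C1_extension S (\<lambda>q. h (f q)) p V E E'"
    unfolding C1_extension_def
    by (intro exI[of _ U] exI[of _ "\<lambda>x. F (E x)"] exI[of _ "\<lambda>q v. F' (E q) (E' q v)"])
       (simp add: oU pU d c eq)
qed

lemma C1_on_real_fun:
  fixes h h' :: "real \<Rightarrow> real"
  assumes "open T" "\<And>x. x \<in> T \<Longrightarrow> (h has_real_derivative h' x) (at x)" "continuous_on T h'"
  shows "C1_on T h"
  unfolding C1_on_def C1_extension_def
  by (rule ballI, intro exI[of _ T] exI[of _ h] exI[of _ "\<lambda>q v. h' q * v"])
     (use assms in \<open>auto simp: has_field_derivative_def intro!: continuous_intros\<close>)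

lemma C1_on_inverse:
  fixes f :: "'e::euclidean_space \<Rightarrow> real"
  assumes "C1_on S f" "\<And>x. x \<in> S \<Longrightarrow> f x \<noteq> 0"
  shows "C1_on S (\<lambda>x. inverse (f x))"
proof (rule C1_on_compose[OF assms(1)])
  show "C1_on (- {0}) (inverse :: real \<Rightarrow> real)"
    by (rule C1_on_real_fun[where h'="\<lambda>x. - inverse (x ^ 2)"])
       (auto intro!: derivative_eq_intros continuous_intros simp: power2_eq_square)
qed (use assms in auto)

lemma C1_on_divide:
  fixes f h :: "'e::euclidean_space \<Rightarrow> real"
  assumes "C1_on S f" "C1_on S h" "\<And>x. x \<in> S \<Longrightarrow> h x \<noteq> 0"
  shows "C1_on S (\<lambda>x. f x / h x)"
  using C1_on_mult[OF assms(1) C1_on_inverse[OF assms(2,3)]] by (simp add: divide_inverse)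

lemma C1_on_sqrt:
  fixes f :: "'e::euclidean_space \<Rightarrow> real"
  assumes "C1_on S f" "\<And>x. x \<in> S \<Longrightarrow> f x > 0"
  shows "C1_on S (\<lambda>x. sqrt (f x))"
proof (rule C1_on_compose[OF assms(1)])
  show "C1_on {0<..} sqrt"
    by (rule C1_on_real_fun[where h'="\<lambda>x. inverse (sqrt x) / 2"])
       (auto intro!: derivative_eq_intros continuous_intros)
qed (use assms in auto)

lemma C1_on_linear_comp:
  fixes f :: "'e::euclidean_space \<Rightarrow> 'g::euclidean_space" and h :: "'g \<Rightarrow> 'f::real_normed_vector"
  assumes "C1_on S f" "bounded_linear h"
  shows "C1_on S (\<lambda>x. h (f x))"
  by (rule C1_on_compose[OF assms(1) C1_on_bounded_linear[OF assms(2), of UNIV]]) auto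

lemma C1_on_vec_nth:
  fixes f :: "'e::euclidean_space \<Rightarrow> real^'n"
  assumes "C1_on S f" shows "C1_on S (\<lambda>x. f x $ i)"
  by (rule C1_on_linear_comp[OF assms bounded_linear_vec_nth])

lemma C1_on_mat_nth:
  fixes f :: "'e::euclidean_space \<Rightarrow> real^'n^'m"
  assumes "C1_on S f" shows "C1_on S (\<lambda>x. f x $ i $ j)"
  by (rule C1_on_vec_nth, rule C1_on_linear_comp[OF assms bounded_linear_vec_nth])

lemma C1_on_det:
  fixes f :: "'e::euclidean_space \<Rightarrow> real^'n^'n"
  assumes "\<And>i j. C1_on S (\<lambda>x. f x $ i $ j)" shows "C1_on S (\<lambda>x. det (f x))"
  unfolding det_def by (intro C1_on_sum C1_on_mult C1_on_prod C1_on_const assms)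

section \<open>Inverse matrices\<close>

lemma matrix_inv_left: "invertible A \<Longrightarrow> matrix_inv A ** A = mat 1"
  and matrix_inv_right: "invertible A \<Longrightarrow> A ** matrix_inv A = mat 1"
  unfolding invertible_def matrix_inv_def by (metis (mono_tags, lifting) someI_ex)+

text \<open>Cramer's rule for the equation that determines column \<open>l\<close> of the inverse.
  Each entry becomes a quotient of determinants, so that the regularity of the inverse reduces to
  that of \<open>det\<close> and of division.\<close>

lemma matrix_inv_cramer:
  fixes B :: "real^'n^'n"
  assumes "det B \<noteq> 0"
  shows "matrix_inv B $ k $ l = det (\<chi> i j. if j = k then (if i = l then 1 else 0) else B $ i $ j) / det B"
proof -
  have inv: "invertible B" using assms invertible_det_nz by blast
  have "B *v (matrix_inv B *v axis l 1) = axis l 1"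
    by (simp add: matrix_vector_mul_assoc matrix_inv_right[OF inv])
  then have "matrix_inv B *v axis l 1 =
      (\<chi> k. det (\<chi> i j. if j = k then axis l 1 $ i else B $ i $ j) / det B)"
    using cramer[OF assms] by blast
  then have "(matrix_inv B *v axis l 1) $ k = det (\<chi> i j. if j = k then axis l 1 $ i else B $ i $ j) / det B"
    by simp
  then show ?thesis
    by (simp add: matrix_vector_mul_component axis_def inner_vec_def if_distrib cong: if_cong)
qed

lemma C1_on_matrix_inv:
  fixes f :: "'e::euclidean_space \<Rightarrow> real^'n^'n"
  assumes "\<And>i j. C1_on S (\<lambda>x. f x $ i $ j)" "\<And>x. x \<in> S \<Longrightarrow> det (f x) \<noteq> 0"
  shows "C1_on S (\<lambda>x. matrix_inv (f x) $ k $ l)"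
proof (rule C1_on_cong)
  show "C1_on S (\<lambda>x. det (\<chi> i j. if j = k then (if i = l then 1 else 0) else f x $ i $ j) / det (f x))"
  proof (intro C1_on_divide C1_on_det assms)
    show "C1_on S (\<lambda>x. (\<chi> i j. if j = k then (if i = l then 1 else 0) else f x $ i $ j) $ i $ j)" for i j
      by (cases "j = k") (simp_all add: C1_on_const assms)
  qed
qed (simp add: matrix_inv_cramer assms)

lemma smooth_on_imp_C1_on:
  assumes "smooth_on S f" shows "C1_on S f"
proof (rule C1_onI)
  fix p assume "p \<in> S"
  then obtain V E where V: "open V" "p \<in> V" "\<forall>k. Ck_on k V E" "\<forall>q\<in>V \<inter> S. E q = f q"
    using assms unfolding smooth_on_def by blast
  have "Ck_on (Suc 0) V E" using V(3) by blast
  then have "\<forall>q\<in>V. E differentiable at q" "\<forall>v. continuous_on V (\<lambda>q. frechet_derivative E (at q) v)"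
    by simp_all
  then show "\<exists>V E E'. C1_extension S f p V E E'"
    unfolding C1_extension_def
    using V by (intro exI[of _ V] exI[of _ E] exI[of _ "\<lambda>q. frechet_derivative E (at q)"])
      (simp add: frechet_derivative_works)
qed

section \<open>Derivatives within the half-space\<close>

lemma closed_half_space: "closed (half_space :: (real^'n::finite) set)"
  unfolding half_space_def by (simp add: closed_halfspace_component_ge_cart)

lemma convex_half_space: "convex (half_space :: (real^'n::finite) set)"
  unfolding half_space_def by (auto simp: convex_def)

text \<open>From every point of the half-space one can move a little in the positive direction of
  each axis without leaving it, and this determines the derivative.\<close>

lemma has_derivative_unique_half_space:
  fixes f :: "real^'n::finite \<Rightarrow> 'b::real_normed_vector"
  assumes "q \<in> half_space" "(f has_derivative f') (at q within half_space)"
    "(f has_derivative f'') (at q within half_space)"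
  shows "f' = f''"
proof (rule frechet_derivative_unique_within[OF assms(2,3)])
  fix i :: "real^'n" and e :: real
  assume i: "i \<in> Basis" and e: "0 < e"
  obtain k where k: "i = axis k 1" using i by (auto simp: Basis_vec_def)
  show "\<exists>d. 0 < \<bar>d\<bar> \<and> \<bar>d\<bar> < e \<and> q + d *\<^sub>R i \<in> half_space"
    using assms(1) e by (intro exI[of _ "e/2"]) (auto simp: half_space_def k axis_def)
qed

lemma frechet_derivative_half_space_eq:
  fixes f :: "real^'n::finite \<Rightarrow> 'b::real_normed_vector"
  assumes "q \<in> half_space" "(f has_derivative f') (at q within half_space)"
  shows "frechet_derivative f (at q within half_space) = f'"
  using assms has_derivative_unique_half_space frechet_derivative_works differentiable_def by metis

lemma partial_eq:
  assumes "q \<in> half_space" "(f has_derivative f') (at q within half_space)"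
  shows "partial k f q = f' (axis k 1)"
  unfolding partial_def frechet_derivative_half_space_eq[OF assms] ..

lemma has_derivative_transform_openin:
  assumes S: "openin (top_of_set H) S" and q: "q \<in> S"
    and f: "(f has_derivative D) (at q within H)" "\<And>x. x \<in> S \<Longrightarrow> f x = h x"
  shows "(h has_derivative D) (at q within H)"
proof -
  obtain d where d: "d > 0" "\<And>x. x \<in> H \<Longrightarrow> dist x q < d \<Longrightarrow> x \<in> S" "S \<subseteq> H"
    using S q by (auto simp: openin_euclidean_subtopology_iff)
  show ?thesis
    by (rule has_derivative_transform_within[OF f(1) d(1)]) (use d(2,3) q f(2) in auto)
qed

text \<open>Whatever local extension is taken, its derivative is the derivative within the
  half-space. This is the bridge from extensions to \<open>partial\<close>.\<close>

lemma has_derivative_extension: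
  fixes f :: "real^'n::finite \<Rightarrow> 'b::real_normed_vector"
  assumes S: "openin (top_of_set half_space) S" and V: "open V" and q: "q \<in> V \<inter> S"
    and E: "(E has_derivative E') (at q)" "\<And>q. q \<in> V \<inter> S \<Longrightarrow> E q = f q"
  shows "(f has_derivative E') (at q within half_space)"
proof (rule has_derivative_transform_openin[of _ "V \<inter> S"])
  show "openin (top_of_set half_space) (V \<inter> S)"
    using S V by (metis inf_commute openin_Int_open)
  show "(E has_derivative E') (at q within half_space)"
    using E(1) has_derivative_at_withinI by blast
qed (use q E in auto)

text \<open>Near each point the derivative within the half-space agrees, by uniqueness, with the
  derivative of an extension, which is continuous in every direction.\<close>

lemma C1_on_frechet:
  fixes f :: "real^'n::finite \<Rightarrow> 'b::real_normed_vector"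
  assumes S: "openin (top_of_set half_space) S" and f: "C1_on S f"
  shows "q \<in> S \<Longrightarrow> (f has_derivative frechet_derivative f (at q within half_space)) (at q within half_space)"
    and "continuous_on S (\<lambda>q. frechet_derivative f (at q within half_space) v)"
proof -
  have SH: "S \<subseteq> half_space" using S openin_imp_subset by blast
  have D: "(f has_derivative frechet_derivative f (at q within half_space)) (at q within half_space)" if q: "q \<in> S" for q
  proof -
    obtain V E E' where "C1_extension S f q V E E'" by (rule C1_onE[OF f q])
    note V = C1_extensionD[OF this]
    from has_derivative_extension[OF S V(1) IntI[OF V(2) q] bspec[OF V(3,2)] V(5)[rule_format]] show ?thesis
      using q V(2) by (auto simp: differentiable_def frechet_derivative_works[symmetric])
  qed
  show "q \<in> S \<Longrightarrow> (f has_derivative frechet_derivative f (at q within half_space)) (at q within half_space)"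
    by (rule D)
  show "continuous_on S (\<lambda>q. frechet_derivative f (at q within half_space) v)"
    unfolding continuous_on_eq_continuous_within
  proof
    fix p assume p: "p \<in> S"
    obtain V E E' where "C1_extension S f p V E E'" by (rule C1_onE[OF f p])
    note V = C1_extensionD[OF this]
    have eq: "frechet_derivative f (at q within half_space) = E' q" if "q \<in> V \<inter> S" for q
      by (rule frechet_derivative_half_space_eq, use that SH in blast)
         (rule has_derivative_extension[OF S V(1) that _ V(5)[rule_format]], use V(3) that in auto)
    have "continuous (at p within S) (\<lambda>q. E' q v)"
      using V(4)[rule_format, of v] V(1,2) continuous_on_eq_continuous_at continuous_at_imp_continuous_at_within
      by blast
    then have "((\<lambda>q. E' q v) \<longlongrightarrow> frechet_derivative f (at p within half_space) v) (at p within S)"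
      using V(2) p eq[of p] by (simp add: continuous_within)
    moreover have "\<forall>\<^sub>F q in at p within S. E' q v = frechet_derivative f (at q within half_space) v"
      unfolding eventually_at_topological by (rule exI[of _ V]) (use V(1,2) eq in auto)
    ultimately show "continuous (at p within S) (\<lambda>q. frechet_derivative f (at q within half_space) v)"
      unfolding continuous_within by (rule Lim_transform_eventually)
  qed
qed

lemma C1_on_partial_continuous:
  assumes "openin (top_of_set half_space) S" "C1_on S f"
  shows "continuous_on S (partial k f)"
  using C1_on_frechet(2)[OF assms] unfolding partial_def by blast

text \<open>The directional derivative of an extension extends the partial derivative, and it
  belongs to each class \<open>Ck_on\<close> because the extension belongs to the next one.\<close>

lemma smooth_on_partial:
  fixes f :: "real^'n::finite \<Rightarrow> real"
  assumes S: "openin (top_of_set half_space) S" and f: "smooth_on S f"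
  shows "smooth_on S (partial k f)"
  unfolding smooth_on_def
proof
  fix p assume p: "p \<in> S"
  obtain V E where V: "open V" "p \<in> V" "\<forall>k. Ck_on k V E" "\<forall>q\<in>V \<inter> S. E q = f q"
    using f p unfolding smooth_on_def by blast
  have "Ck_on m V (\<lambda>q. frechet_derivative E (at q) (axis k 1))" for m
    using V(3)[rule_format, of "Suc m"] by simp
  moreover have "partial k f q = frechet_derivative E (at q) (axis k 1)" if "q \<in> V \<inter> S" for q
  proof (rule partial_eq)
    show "q \<in> half_space" using that S openin_imp_subset by blast
    have "(E has_derivative frechet_derivative E (at q)) (at q)"
      using V(3)[rule_format, of "Suc 0"] that by (auto simp: frechet_derivative_works[symmetric])
    then show "(f has_derivative frechet_derivative E (at q)) (at q within half_space)"
      using has_derivative_extension[OF S V(1) that] V(4) by blast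
  qed
  ultimately show "\<exists>V E. open V \<and> p \<in> V \<and> (\<forall>m. Ck_on m V E) \<and> (\<forall>q\<in>V \<inter> S. E q = partial k f q)"
    using V by (intro exI[of _ V] exI[of _ "\<lambda>q. frechet_derivative E (at q) (axis k 1)"]) auto
qed

text \<open>Differentiability is not at issue: both functions have the same derivatives within the
  half-space, so the choice made in \<open>frechet_derivative\<close> is the same for both.\<close>

lemma partial_cong:
  assumes S: "openin (top_of_set half_space) S" and q: "q \<in> S" and eq: "\<And>x. x \<in> S \<Longrightarrow> f x = h x"
  shows "partial k f q = partial k h q"
proof -
  have "(f has_derivative D) (at q within half_space) \<longleftrightarrow> (h has_derivative D) (at q within half_space)" for D
    using has_derivative_transform_openin[OF S q] eq by metis
  then show ?thesis unfolding partial_def frechet_derivative_def by simp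
qed

lemma partial_add:
  assumes "openin (top_of_set half_space) S" "q \<in> S" "C1_on S f" "C1_on S h"
  shows "partial k (\<lambda>x. f x + h x) q = partial k f q + partial k h q"
proof -
  have "q \<in> half_space" using assms openin_imp_subset by blast
  from partial_eq[OF this has_derivative_add[OF C1_on_frechet(1)[OF assms(1,3,2)] C1_on_frechet(1)[OF assms(1,4,2)]]]
  show ?thesis by (simp add: partial_def)
qed

lemma partial_mult:
  assumes "openin (top_of_set half_space) S" "q \<in> S" "C1_on S f" "C1_on S h"
  shows "partial k (\<lambda>x. f x * h x) q = f q * partial k h q + partial k f q * h q"
proof -
  have "q \<in> half_space" using assms openin_imp_subset by blast
  from partial_eq[OF this has_derivative_mult[OF C1_on_frechet(1)[OF assms(1,3,2)] C1_on_frechet(1)[OF assms(1,4,2)]]]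
  show ?thesis by (simp add: partial_def)
qed

lemma partial_const: "q \<in> half_space \<Longrightarrow> partial k (\<lambda>x. c) q = 0"
  using partial_eq[OF _ has_derivative_const] by blast

lemma partial_sum:
  assumes "openin (top_of_set half_space) S" "q \<in> S" "\<And>i. i \<in> I \<Longrightarrow> C1_on S (f i)"
  shows "partial k (\<lambda>x. \<Sum>i\<in>I. f i x) q = (\<Sum>i\<in>I. partial k (f i) q)"
proof -
  have H: "q \<in> half_space" using assms openin_imp_subset by blast
  show ?thesis using assms(3)
    by (induction I rule: infinite_finite_induct)
       (auto simp: partial_const[OF H] partial_add[OF assms(1,2) _ C1_on_sum])
qed

section \<open>Integration by parts on the half-space\<close>

lemma lborel_integral_translate:
  fixes f :: "'a::euclidean_space \<Rightarrow> real"
  assumes [measurable]: "f \<in> borel_measurable borel"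
  shows "(\<integral>x. f (c + x) \<partial>lborel) = (\<integral>x. f x \<partial>lborel)"
proof -
  have "(\<integral>x. f x \<partial>lborel) = (\<integral>x. f x \<partial>distr lborel borel ((+) c))"
    by (simp add: lborel_distr_plus)
  also have "\<dots> = (\<integral>x. f (c + x) \<partial>lborel)"
    by (subst integral_distr) auto
  finally show ?thesis by simp
qed

text \<open>Translation invariance makes the integral of every difference quotient vanish.\<close>

lemma integral_directional_derivative_eq_0:
  fixes X D :: "'a::euclidean_space \<Rightarrow> real"
  assumes [measurable]: "X \<in> borel_measurable borel" "D \<in> borel_measurable borel"
    and B: "bounded B" "\<And>q. q \<notin> B \<Longrightarrow> X q = 0" "\<And>q. \<bar>X q\<bar> \<le> K"
    and lip: "\<And>q s. \<bar>X (q + s *\<^sub>R v) - X q\<bar> \<le> C * \<bar>s\<bar>"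
    and lim: "AE q in lborel. ((\<lambda>s. (X (q + s *\<^sub>R v) - X q) / s) \<longlongrightarrow> D q) (at 0)"
  shows "(\<integral>q. D q \<partial>lborel) = 0"
proof -
  obtain R where "\<forall>q\<in>B. norm q \<le> R" using B(1) unfolding bounded_iff ..
  then have R: "X q = 0" if "R < norm q" for q using that B(2)[of q] by force
  define s where "s n = 1 / real (Suc n)" for n
  have s: "s n \<noteq> 0" "\<bar>s n\<bar> \<le> 1" for n by (auto simp: s_def)
  have s0: "filterlim s (at 0) sequentially"
    unfolding filterlim_at
  proof
    show "\<forall>\<^sub>F n in sequentially. s n \<in> UNIV \<and> s n \<noteq> 0" using s(1) by simp
    show "s \<longlonglongrightarrow> 0"
      using LIMSEQ_inverse_real_of_nat by (simp add: s_def[abs_def] inverse_eq_divide)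
  qed
  let ?f = "\<lambda>n q. (X (q + s n *\<^sub>R v) - X q) / s n"
  \<comment> \<open>Since the steps \<open>s n\<close> are at most one, the shifted support stays in
    the ball of radius \<open>R + norm v\<close>; the Lipschitz constant on that ball dominates all
    difference quotients.\<close>
  let ?w = "\<lambda>q. C * indicator (cball 0 (R + norm v)) q"
  have intX: "integrable lborel X"
  proof (rule Bochner_Integration.integrable_bound)
    show "integrable lborel (\<lambda>q. K * indicator (cball 0 R) q :: real)"
      by (intro integrable_mult_right) (auto intro!: integrable_real_indicator emeasure_lborel_cball_finite)
    have "0 \<le> K" using B(3)[of undefined] by linarith
    then show "AE q in lborel. norm (X q) \<le> norm (K * indicator (cball 0 R) q :: real)"
      using B(3) R by (intro AE_I2) (auto simp: not_le split: split_indicator)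
  qed simp
  have intX': "integrable lborel (\<lambda>q. X (c + q))" for c
    using intX lborel_distr_plus[of c] integrable_distr_eq[of "(+) c" lborel borel X] by simp
  have C0: "0 \<le> C" using lip[of undefined 1] by simp
  have "(\<lambda>n. \<integral>q. ?f n q \<partial>lborel) \<longlonglongrightarrow> (\<integral>q. D q \<partial>lborel)"
  proof (rule integral_dominated_convergence[where w="?w"])
    show "integrable lborel ?w"
      by (intro integrable_mult_right) (auto intro!: integrable_real_indicator emeasure_lborel_cball_finite)
    show "AE q in lborel. (\<lambda>n. ?f n q) \<longlonglongrightarrow> D q"
      using lim by eventually_elim (erule filterlim_compose[OF _ s0])
    show "AE q in lborel. norm (?f n q) \<le> ?w q" for n
    proof (rule AE_I2)
      fix q
      show "norm (?f n q) \<le> ?w q"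
      proof (cases "q \<in> cball 0 (R + norm v)")
        case True
        then show ?thesis using lip[of q "s n"] s(1)[of n]
          by (simp add: divide_simps mult.commute)
      next
        case False
        have "norm (s n *\<^sub>R v) \<le> norm v" using s(2)[of n] by (simp add: mult_left_le_one_le)
        then have "R < norm (q + s n *\<^sub>R v)" "R < norm q"
          using False norm_triangle_ineq4[of "q + s n *\<^sub>R v" "s n *\<^sub>R v"] norm_ge_zero[of v]
          by (auto simp: not_le intro: le_less_trans[of R "R + norm v"])
        then have "X q = 0" "X (q + s n *\<^sub>R v) = 0" using R by auto
        then show ?thesis using False by simp
      qed
    qed
  qed simp_all
  moreover have "(\<integral>q. ?f n q \<partial>lborel) = 0" for n
  proof -
    have "(\<integral>q. ?f n q \<partial>lborel) = ((\<integral>q. X (s n *\<^sub>R v + q) \<partial>lborel) - (\<integral>q. X q \<partial>lborel)) / s n"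
      using Bochner_Integration.integral_diff[OF intX'[of "s n *\<^sub>R v"] intX] by (simp add: add.commute)
    then show ?thesis by (simp add: lborel_integral_translate)
  qed
  ultimately have "(\<lambda>n. 0) \<longlonglongrightarrow> (\<integral>q. D q \<partial>lborel)" by (simp only:)
  then show ?thesis by (simp add: LIMSEQ_const_iff)
qed

lemma half_space_measurable [measurable]: "(half_space :: (real^'n::finite) set) \<in> sets borel"
  using closed_half_space by (rule borel_closed)

lemma openin_half_space_borel:
  "openin (top_of_set half_space) S \<Longrightarrow> (S :: (real^'n::finite) set) \<in> sets borel"
  by (auto simp: openin_open)

text \<open>A function cut off at the wall may fail to be differentiable on the wall itself, which
  is a hyperplane and hence a null set.\<close>

lemma AE_bdry_ix_nonzero: "AE q in lborel. (q :: real^'n::finite) $ bdry_ix \<noteq> 0"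
proof -
  have "{q :: real^'n. q $ bdry_ix = 0} \<in> null_sets lebesgue"
    using negligible_standard_hyperplane_cart negligible_iff_null_sets by blast
  moreover have "{q :: real^'n. q $ bdry_ix = 0} \<in> sets borel"
    by (intro borel_closed closed_Collect_eq continuous_intros)
  ultimately have "{q :: real^'n. q $ bdry_ix = 0} \<in> null_sets lborel"
    by (metis null_sets_completion_iff sets_lborel)
  then show ?thesis by (rule AE_I'[of _ _ "\<lambda>q. q $ bdry_ix \<noteq> 0"]) auto
qed

text \<open>The mean value inequality on the convex half-space. The derivative is bounded on the
  compact set by continuity in the basis directions, and it vanishes off that set.\<close>

lemma half_space_Lipschitz:
  fixes Z :: "real^'n::finite \<Rightarrow> real"
  assumes Z: "C1_on half_space Z" and K: "compact K" "\<And>q. q \<in> half_space \<Longrightarrow> q \<notin> K \<Longrightarrow> Z q = 0"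
  obtains L where "\<And>x y. x \<in> half_space \<Longrightarrow> y \<in> half_space \<Longrightarrow> \<bar>Z x - Z y\<bar> \<le> L * norm (x - y)"
proof -
  let ?D = "\<lambda>q. frechet_derivative Z (at q within half_space)"
  note D = C1_on_frechet[OF openin_subtopology_self Z]
  have "compact (K \<inter> half_space)" using K(1) closed_half_space by (rule compact_Int_closed)
  moreover have "continuous_on (K \<inter> half_space) (\<lambda>q. \<Sum>b\<in>Basis. norm (?D q b))"
    by (intro continuous_intros continuous_on_subset[OF D(2)]) auto
  ultimately have "bounded ((\<lambda>q. \<Sum>b\<in>Basis. norm (?D q b)) ` (K \<inter> half_space))"
    by (intro compact_imp_bounded compact_continuous_image)
  then obtain L where L: "\<And>q. q \<in> K \<inter> half_space \<Longrightarrow> \<bar>\<Sum>b\<in>Basis. norm (?D q b)\<bar> \<le> L"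
    unfolding bounded_iff by auto
  have onorm: "onorm (?D q) \<le> max L 0" if q: "q \<in> half_space" for q
  proof (cases "q \<in> K")
    case True
    have "onorm (?D q) \<le> (\<Sum>b\<in>Basis. norm (?D q b))"
      using D(1)[OF q] has_derivative_bounded_linear by (intro onorm_componentwise) blast
    then show ?thesis using L[of q] True q by auto
  next
    case False
    have "openin (top_of_set half_space) (half_space \<inter> - K)"
      using K(1) compact_imp_closed by (intro openin_open_Int) auto
    then have "(Z has_derivative (\<lambda>_. 0)) (at q within half_space)"
      by (rule has_derivative_transform_openin[OF _ _ has_derivative_const[of 0]]) (use False q K(2) in auto)
    from frechet_derivative_half_space_eq[OF q this] show ?thesis by (simp add: onorm_zero)
  qed
  show thesis
    using differentiable_bound[OF convex_half_space D(1) onorm] by (intro that[of "max L 0"]) auto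
qed

text \<open>After being cut off outside the half-space, \<open>Z\<close> is still Lipschitz along
  axis \<open>k\<close>: a tangential shift never crosses the wall, and for the normal axis
  \<open>Z\<close> vanishes on it. The integral of the derivative is then zero by translation
  invariance.\<close>

lemma integral_partial_half_space_eq_0:
  fixes Z :: "real^'n::finite \<Rightarrow> real"
  assumes Z: "C1_on half_space Z" and K: "compact K" "\<And>q. q \<in> half_space \<Longrightarrow> q \<notin> K \<Longrightarrow> Z q = 0"
    and bdry: "\<And>q. q \<in> half_space \<Longrightarrow> k = bdry_ix \<Longrightarrow> q $ bdry_ix = 0 \<Longrightarrow> Z q = 0"
  shows "(\<integral>q. indicator half_space q * partial k Z q \<partial>lborel) = 0"
proof -
  let ?X = "\<lambda>q. indicator half_space q * Z q" and ?v = "axis k 1 :: real^'n"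
  note D = C1_on_frechet[OF openin_subtopology_self Z]
  have contZ: "continuous_on half_space Z" using Z by (rule C1_on_imp_continuous_on)
  have contD: "continuous_on half_space (partial k Z)"
    by (rule C1_on_partial_continuous[OF openin_subtopology_self Z])
  obtain L where L: "\<And>x y. x \<in> half_space \<Longrightarrow> y \<in> half_space \<Longrightarrow> \<bar>Z x - Z y\<bar> \<le> L * norm (x - y)"
    using half_space_Lipschitz[OF Z K] by blast
  have "compact (K \<inter> half_space)" using K(1) closed_half_space by (rule compact_Int_closed)
  then have "bounded (Z ` (K \<inter> half_space))"
    by (intro compact_imp_bounded compact_continuous_image continuous_on_subset[OF contZ]) auto
  then obtain M where M: "\<And>q. q \<in> K \<inter> half_space \<Longrightarrow> \<bar>Z q\<bar> \<le> M"
    unfolding bounded_iff by auto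
  have "(0 :: real^'n) \<in> half_space" "(axis bdry_ix 1 :: real^'n) \<in> half_space"
    by (auto simp: half_space_def axis_def)
  \<comment> \<open>Two points at distance one force the Lipschitz constant to be
    nonnegative.\<close>
  from order_trans[OF abs_ge_zero L[OF this]] have L0: "0 \<le> L" by simp
  show ?thesis
  proof (rule integral_directional_derivative_eq_0[of ?X _ K "max M 0" ?v L])
    show "?X \<in> borel_measurable borel"
      using borel_measurable_continuous_on_indicator[OF half_space_measurable contZ] by simp
    show "(\<lambda>q. indicator half_space q * partial k Z q) \<in> borel_measurable borel"
      using borel_measurable_continuous_on_indicator[OF half_space_measurable contD] by simp
    show "bounded K" using K(1) by (rule compact_imp_bounded)
    show "?X q = 0" if "q \<notin> K" for q using K(2) that by (auto split: split_indicator)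
    show "\<bar>?X q\<bar> \<le> max M 0" for q
      using M[of q] K(2)[of q] by (cases "q \<in> K") (auto split: split_indicator)
    \<comment> \<open>A shift that leaves the half-space crosses the wall at \<open>q'\<close>,
      where \<open>Z\<close> is zero and whose distance from \<open>q\<close> is at most the length
      of the shift.\<close>
    have mixed: "\<bar>Z q\<bar> \<le> L * \<bar>s\<bar>" if q: "q \<in> half_space" "q + s *\<^sub>R ?v \<notin> half_space" for q s
    proof -
      have kb: "k = bdry_ix" using q by (auto simp: half_space_def axis_def split: if_splits)
      have sq: "q $ bdry_ix \<ge> 0" "s < - q $ bdry_ix" using q kb by (auto simp: half_space_def axis_def)
      define q' where "q' = q + (- q $ bdry_ix) *\<^sub>R ?v"
      have q': "q' $ bdry_ix = 0" "q' \<in> half_space" by (auto simp: q'_def kb half_space_def axis_def)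
      have "\<bar>Z q - Z q'\<bar> \<le> L * norm (q - q')" by (rule L[OF q(1) q'(2)])
      also have "norm (q - q') = \<bar>q $ bdry_ix\<bar>" by (simp add: q'_def)
      also have "L * \<bar>q $ bdry_ix\<bar> \<le> L * \<bar>s\<bar>" using sq L0 by (intro mult_left_mono) auto
      finally show ?thesis using bdry[OF q'(2) kb q'(1)] by simp
    qed
    show "\<bar>?X (q + s *\<^sub>R ?v) - ?X q\<bar> \<le> L * \<bar>s\<bar>" for q s
    proof (cases "q \<in> half_space"; cases "q + s *\<^sub>R ?v \<in> half_space")
      assume "q \<in> half_space" "q + s *\<^sub>R ?v \<in> half_space"
      then show ?thesis using L[of "q + s *\<^sub>R ?v" q] by simp
    next
      assume "q \<notin> half_space" "q + s *\<^sub>R ?v \<in> half_space"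
      then show ?thesis using mixed[of "q + s *\<^sub>R ?v" "-s"] by simp
    next
      assume "q \<in> half_space" "q + s *\<^sub>R ?v \<notin> half_space"
      then show ?thesis using mixed[of q s] by simp
    next
      assume "q \<notin> half_space" "q + s *\<^sub>R ?v \<notin> half_space"
      then show ?thesis using L0 by simp
    qed
    \<comment> \<open>Off the wall there are two cases: interior points see the derivative of
      \<open>Z\<close>, and exterior points see a function that vanishes nearby.\<close>
    show "AE q in lborel. ((\<lambda>s. (?X (q + s *\<^sub>R ?v) - ?X q) / s) \<longlongrightarrow> indicator half_space q * partial k Z q) (at 0)"
      using AE_bdry_ix_nonzero
    proof eventually_elim
      fix q :: "real^'n" assume q: "q $ bdry_ix \<noteq> 0"
      show "((\<lambda>s. (?X (q + s *\<^sub>R ?v) - ?X q) / s) \<longlongrightarrow> indicator half_space q * partial k Z q) (at 0)"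
      proof (cases "q $ bdry_ix > 0")
        case True
        let ?O = "{x :: real^'n. x $ bdry_ix > 0}"
        have O: "open ?O" by (intro open_Collect_less continuous_intros)
        have OH: "?O \<subseteq> half_space" by (auto simp: half_space_def)
        have "(Z has_derivative frechet_derivative Z (at q within half_space)) (at q within ?O)"
          using D(1) OH True by (intro has_derivative_subset[OF _ OH]) (auto simp: half_space_def)
        then have "(Z has_derivative frechet_derivative Z (at q within half_space)) (at q)"
          using at_within_open[OF _ O, of q] True by (simp only: mem_Collect_eq)
        then have dX: "(?X has_derivative frechet_derivative Z (at q within half_space)) (at q)"
          by (rule has_derivative_transform_within_open[OF _ O]) (use True OH in auto)
        have "((\<lambda>s. ?X (q + s *\<^sub>R ?v)) has_derivative (\<lambda>s. frechet_derivative Z (at q within half_space) (s *\<^sub>R ?v))) (at 0)"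
          by (rule has_derivative_compose[of "\<lambda>s. q + s *\<^sub>R ?v", where g="?X"]) (auto intro!: derivative_eq_intros dX)
        moreover have "frechet_derivative Z (at q within half_space) (s *\<^sub>R ?v) = partial k Z q * s" for s
          using linear_cmul[OF has_derivative_linear[OF dX]] by (simp add: partial_def)
        ultimately have "((\<lambda>s. ?X (q + s *\<^sub>R ?v)) has_real_derivative partial k Z q) (at 0)"
          by (simp add: has_field_derivative_def)
        then show ?thesis using True OH by (auto simp: has_field_derivative_iff)
      next
        case False
        let ?O = "{x :: real^'n. x $ bdry_ix < 0}"
        have O: "open ?O" by (intro open_Collect_less continuous_intros)
        have "((\<lambda>s. q + s *\<^sub>R ?v) \<longlongrightarrow> q + 0 *\<^sub>R ?v) (at 0)" by (intro tendsto_intros)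
        then have "\<forall>\<^sub>F s in at 0. q + s *\<^sub>R ?v \<in> ?O"
          by (rule topological_tendstoD[OF _ O]) (use False q in auto)
        moreover have nin: "x \<in> ?O \<Longrightarrow> x \<notin> half_space" for x by (auto simp: half_space_def)
        ultimately have "\<forall>\<^sub>F s in at 0. (?X (q + s *\<^sub>R ?v) - ?X q) / s = 0"
          using nin[of q] False q by (auto elim!: eventually_mono)
        then show ?thesis using nin[of q] False q by (auto intro: tendsto_eventually)
      qed
    qed
  qed
qed

text \<open>The relatively open set \<open>S\<close> and the complement of \<open>K\<close> cover
  \<open>H\<close>; on the first the function is \<open>f\<close>, on the second it is zero.\<close>

lemma C1_on_extend_zero:
  fixes f :: "'e::euclidean_space \<Rightarrow> real"
  assumes S: "openin (top_of_set H) S" and f: "C1_on S f" and K: "compact K" "K \<subseteq> S"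
    and z: "\<And>q. q \<in> S \<Longrightarrow> q \<notin> K \<Longrightarrow> f q = 0"
  shows "C1_on H (\<lambda>q. if q \<in> S then f q else 0)"
proof (rule C1_on_local)
  fix p assume p: "p \<in> H"
  obtain T where T: "open T" "S = H \<inter> T" using S by (auto simp: openin_open)
  show "\<exists>W. open W \<and> p \<in> W \<and> C1_on (W \<inter> H) (\<lambda>q. if q \<in> S then f q else 0)"
  proof (cases "p \<in> S")
    case True
    have "C1_on (T \<inter> H) (\<lambda>q. if q \<in> S then f q else 0)"
      by (rule C1_on_cong[OF C1_on_subset[OF f]]) (use T in auto)
    then show ?thesis using T True by blast
  next
    case False
    have "C1_on (- K \<inter> H) (\<lambda>q. if q \<in> S then f q else 0)"
      by (rule C1_on_cong[OF C1_on_const[of _ 0]]) (use z in auto)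
    then show ?thesis using K False compact_imp_closed by (intro exI[of _ "- K"]) auto
  qed
qed

section \<open>Change of variables for nonnegative integrals\<close>

text \<open>The change of variables theorem of the library needs a well-ordered index type, so
  it is transferred along a relabelling of the coordinates.\<close>

typedef 'n ix = "UNIV :: 'n set" morphisms of_ix to_ix ..

text \<open>Some numbering of the index type; the well-order of the natural numbers is pulled back
  along it.\<close>

definition ix_code :: "'n::finite \<Rightarrow> nat" where
  "ix_code = (SOME f. inj f)"

lemma inj_ix_code: "inj (ix_code :: 'n::finite \<Rightarrow> nat)"
  unfolding ix_code_def using finite_imp_inj_to_nat_seg[of "UNIV :: 'n set"] by (metis finite someI_ex)

instance ix :: (finite) finite
proof
  show "finite (UNIV :: 'a ix set)"
    by (rule finite_imageD[of of_ix]) (auto simp: inj_on_def of_ix_inject)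
qed

instantiation ix :: (finite) wellorder
begin

definition "less_eq_ix (x :: 'a ix) (y :: 'a ix) \<longleftrightarrow> ix_code (of_ix x) \<le> ix_code (of_ix y)"
definition "less_ix (x :: 'a ix) (y :: 'a ix) \<longleftrightarrow> ix_code (of_ix x) < ix_code (of_ix y)"

instance
proof
  fix x y z :: "'a ix"
  show "x < y \<longleftrightarrow> x \<le> y \<and> \<not> y \<le> x" by (auto simp: less_eq_ix_def less_ix_def)
  show "x \<le> x" by (simp add: less_eq_ix_def)
  show "x \<le> y \<Longrightarrow> y \<le> z \<Longrightarrow> x \<le> z" by (simp add: less_eq_ix_def)
  show "x = y" if "x \<le> y" "y \<le> x"
  proof -
    have "ix_code (of_ix x) = ix_code (of_ix y)" using that by (simp add: less_eq_ix_def)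
    then have "of_ix x = of_ix y" by (rule injD[OF inj_ix_code])
    then show ?thesis by (simp only: of_ix_inject)
  qed
  show "x \<le> y \<or> y \<le> x" by (auto simp: less_eq_ix_def)
next
  fix P :: "'a ix \<Rightarrow> bool" and a
  assume step: "\<And>x. (\<And>y. y < x \<Longrightarrow> P y) \<Longrightarrow> P x"
  show "P a"
    by (rule measure_induct_rule[of "\<lambda>x. ix_code (of_ix x)"], rule step) (simp add: less_ix_def)
qed

end

definition relabel :: "real^'n \<Rightarrow> real^('n ix)" where
  "relabel x = (\<chi> i. x $ of_ix i)"

definition unlabel :: "real^('n ix) \<Rightarrow> real^'n" where
  "unlabel x = (\<chi> i. x $ to_ix i)"

lemma relabel_unlabel [simp]: "relabel (unlabel x) = x" "unlabel (relabel y) = y"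
  by (simp_all add: relabel_def unlabel_def of_ix_inverse to_ix_inverse)

lemma bounded_linear_relabel: "bounded_linear (relabel :: real^'n::finite \<Rightarrow> _)"
  by (rule linear_conv_bounded_linear[THEN iffD1]) (auto intro!: linearI simp: relabel_def vec_eq_iff)

lemma bounded_linear_unlabel: "bounded_linear (unlabel :: _ \<Rightarrow> real^'n::finite)"
  by (rule linear_conv_bounded_linear[THEN iffD1]) (auto intro!: linearI simp: unlabel_def vec_eq_iff)

lemma relabel_measurable [measurable]: "(relabel :: real^'n::finite \<Rightarrow> _) \<in> borel_measurable borel"
  using bounded_linear_relabel by (intro borel_measurable_continuous_onI linear_continuous_on)

lemma unlabel_measurable [measurable]: "(unlabel :: _ \<Rightarrow> real^'n::finite) \<in> borel_measurable borel"
  using bounded_linear_unlabel by (intro borel_measurable_continuous_onI linear_continuous_on)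

lemma prod_Basis_vec: "(\<Prod>b\<in>(Basis :: (real^'n::finite) set). f b) = (\<Prod>i\<in>UNIV. f (axis i 1))"
proof -
  have B: "(Basis :: (real^'n) set) = (\<lambda>i. axis i 1) ` UNIV" by (auto simp: Basis_vec_def)
  have I: "inj (\<lambda>i. axis i 1 :: real^'n)" by (auto simp: inj_on_def axis_eq_axis)
  show ?thesis unfolding B by (subst prod.reindex[OF I]) simp
qed

text \<open>Lebesgue measure is determined by its values on boxes, and relabelling the coordinates
  merely permutes the side lengths.\<close>

lemma lborel_relabel: "distr lborel borel relabel = (lborel :: (real^('n::finite ix)) measure)"
proof (rule lborel_eqI[symmetric])
  fix l u :: "real^('n ix)"
  assume le: "\<And>b. b \<in> Basis \<Longrightarrow> l \<bullet> b \<le> u \<bullet> b"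
  have le': "l $ i \<le> u $ i" for i using le[of "axis i 1"] by (auto simp: Basis_vec_def inner_axis)
  have "relabel -` box l u = box (unlabel l) (unlabel u)"
  proof (rule set_eqI)
    fix x
    have "(\<forall>i. l $ i < x $ of_ix i \<and> x $ of_ix i < u $ i) \<longleftrightarrow> (\<forall>i. l $ to_ix i < x $ i \<and> x $ i < u $ to_ix i)"
      by (metis of_ix_inverse to_ix_inverse UNIV_I)
    then show "x \<in> relabel -` box l u \<longleftrightarrow> x \<in> box (unlabel l) (unlabel u)"
      by (simp add: mem_box_cart relabel_def unlabel_def)
  qed
  then have "emeasure (distr lborel borel relabel) (box l u) = emeasure lborel (box (unlabel l) (unlabel u))"
    by (subst emeasure_distr) auto
  also have "\<dots> = (\<Prod>b\<in>Basis. (unlabel u - unlabel l) \<bullet> b)"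
    by (rule emeasure_lborel_box) (auto simp: Basis_vec_def inner_axis unlabel_def le')
  also have "(\<Prod>b\<in>Basis. (unlabel u - unlabel l) \<bullet> b) = (\<Prod>i\<in>UNIV. u $ to_ix i - l $ to_ix i)"
    by (simp add: prod_Basis_vec inner_axis unlabel_def)
  also have "\<dots> = (\<Prod>i\<in>UNIV. u $ i - l $ i)"
    by (rule prod.reindex_bij_witness[of _ of_ix to_ix]) (auto simp: of_ix_inverse to_ix_inverse)
  also have "\<dots> = (\<Prod>b\<in>Basis. (u - l) \<bullet> b)"
    by (simp add: prod_Basis_vec inner_axis)
  finally show "emeasure (distr lborel borel relabel) (box l u) = ennreal (\<Prod>b\<in>Basis. (u - l) \<bullet> b)" .
qed simp

lemma nn_integral_relabel:
  assumes [measurable]: "f \<in> borel_measurable borel"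
  shows "(\<integral>\<^sup>+x. f x \<partial>lborel) = (\<integral>\<^sup>+x. f (relabel x) \<partial>(lborel :: (real^'n::finite) measure))"
  by (subst lborel_relabel[symmetric], subst nn_integral_distr) auto

text \<open>Conjugation with the relabelling is a bijection between the permutations of the two
  index types that preserves signs and products.\<close>

lemma det_relabel:
  fixes M :: "real^'n::finite^'n"
  shows "det (\<chi> i j. M $ of_ix i $ of_ix j) = det M"
proof -
  have bij: "bij_betw to_ix UNIV (UNIV :: 'n ix set)" "bij_betw of_ix UNIV (UNIV :: 'n set)"
    by (auto simp: bij_betw_def inj_on_def to_ix_inject of_ix_inject) (metis of_ix_inverse to_ix_inverse UNIV_I rangeI)+
  have inv: "inv_into UNIV to_ix = (of_ix :: 'n ix \<Rightarrow> 'n)" "inv_into UNIV of_ix = (to_ix :: 'n \<Rightarrow> 'n ix)"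
    by (rule inv_equality; simp add: of_ix_inverse to_ix_inverse)+
  have mp: "map_permutation UNIV to_ix p = to_ix \<circ> p \<circ> of_ix" for p :: "'n \<Rightarrow> 'n"
    using bij by (auto simp: map_permutation_def restrict_id_def inv bij_betw_def)
  have mp': "map_permutation UNIV of_ix q = of_ix \<circ> q \<circ> to_ix" for q :: "'n ix \<Rightarrow> 'n ix"
    using bij by (auto simp: map_permutation_def restrict_id_def inv bij_betw_def)
  have "(\<Sum>p | p permutes (UNIV :: 'n set). of_int (sign p) * (\<Prod>i\<in>UNIV. M $ i $ p i)) =
      (\<Sum>q | q permutes (UNIV :: 'n ix set). of_int (sign q) * (\<Prod>i\<in>UNIV. M $ of_ix i $ of_ix (q i)))"
  proof (rule sum.reindex_bij_witness[of _ "map_permutation UNIV of_ix" "map_permutation UNIV to_ix"])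
    fix p :: "'n \<Rightarrow> 'n" assume p: "p \<in> {p. p permutes UNIV}"
    show "map_permutation UNIV of_ix (map_permutation UNIV to_ix p) = p"
      by (simp add: mp mp' fun_eq_iff to_ix_inverse)
    show "map_permutation UNIV to_ix p \<in> {q. q permutes UNIV}"
      using map_permutation_permutes[OF bij(1)] p by auto
    have "(\<Prod>i\<in>UNIV. M $ of_ix i $ of_ix (map_permutation UNIV to_ix p i)) = (\<Prod>i\<in>UNIV. M $ i $ p i)"
      by (rule prod.reindex_bij_witness[of _ to_ix of_ix]) (auto simp: mp of_ix_inverse to_ix_inverse)
    moreover have "sign (map_permutation UNIV to_ix p) = sign p"
      by (rule sign_map_permutation) (use p bij in \<open>auto simp: bij_betw_def\<close>)
    ultimately show "of_int (sign (map_permutation UNIV to_ix p)) *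
        (\<Prod>i\<in>UNIV. M $ of_ix i $ of_ix (map_permutation UNIV to_ix p i)) =
        of_int (sign p) * (\<Prod>i\<in>UNIV. M $ i $ p i)" by simp
  next
    fix q :: "'n ix \<Rightarrow> 'n ix" assume q: "q \<in> {p. p permutes UNIV}"
    show "map_permutation UNIV to_ix (map_permutation UNIV of_ix q) = q"
      by (simp add: mp mp' fun_eq_iff of_ix_inverse)
    show "map_permutation UNIV of_ix q \<in> {q. q permutes UNIV}"
      using map_permutation_permutes[OF bij(2)] q by auto
  qed
  then show ?thesis by (simp add: det_def)
qed

text \<open>Translates a finite value of the nonnegative integral over \<open>lborel\<close> into
  absolute integrability over the completed measure, the language in which the change of variables
  theorem is formulated.\<close>

lemma nn_integral_eq_ennreal_iff:
  fixes f :: "'a::euclidean_space \<Rightarrow> real"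
  assumes m: "(\<lambda>x. indicator S x *\<^sub>R f x) \<in> borel_measurable borel"
    and pos: "\<And>x. x \<in> S \<Longrightarrow> 0 \<le> f x" and r: "0 \<le> r"
  shows "(\<integral>\<^sup>+x. ennreal (indicator S x *\<^sub>R f x) \<partial>lborel) = ennreal r \<longleftrightarrow>
    f absolutely_integrable_on S \<and> integral S f = r"
proof -
  let ?F = "\<lambda>x. indicator S x *\<^sub>R f x"
  have F0: "0 \<le> ?F x" for x using pos by (auto split: split_indicator)
  have m': "?F \<in> borel_measurable lborel" using m by simp
  have ai: "f absolutely_integrable_on S \<longleftrightarrow> integrable lborel ?F"
    unfolding set_integrable_def by (rule integrable_completion[OF m'])
  have int: "integral S f = (\<integral>x. ?F x \<partial>lborel)" if "f absolutely_integrable_on S"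
    using set_lebesgue_integral_eq_integral(2)[OF that] integral_completion[OF m']
    by (simp add: set_lebesgue_integral_def)
  show ?thesis
  proof
    assume *: "(\<integral>\<^sup>+x. ennreal (?F x) \<partial>lborel) = ennreal r"
    then have i: "integrable lborel ?F"
      by (intro integrableI_nonneg m' AE_I2 F0) simp
    moreover have "(\<integral>x. ?F x \<partial>lborel) = r"
      using nn_integral_eq_integral[OF i] F0 * r by (simp add: integral_nonneg)
    ultimately show "f absolutely_integrable_on S \<and> integral S f = r" using ai int by simp
  next
    assume "f absolutely_integrable_on S \<and> integral S f = r"
    then show "(\<integral>\<^sup>+x. ennreal (?F x) \<partial>lborel) = ennreal r"
      using ai int nn_integral_eq_integral[of lborel ?F] F0 by simp
  qed
qed

text \<open>The known theorem, applied with every candidate value \<open>b\<close>, says that both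
  sides attain the same finite values; the infinite value is then shared as well.\<close>

lemma nn_integral_change_of_variables_wellorder:
  fixes g :: "real^'m::{finite,wellorder} \<Rightarrow> real^'m::_" and f :: "real^'m::_ \<Rightarrow> real"
  assumes S: "S \<in> sets borel"
    and der: "\<And>x. x \<in> S \<Longrightarrow> (g has_derivative g' x) (at x within S)" and inj: "inj_on g S"
    and mf: "(\<lambda>x. indicator (g ` S) x *\<^sub>R f x) \<in> borel_measurable borel"
    and md: "(\<lambda>x. indicator S x *\<^sub>R (\<bar>det (matrix (g' x))\<bar> * f (g x))) \<in> borel_measurable borel"
    and pos: "\<And>x. x \<in> g ` S \<Longrightarrow> 0 \<le> f x"
  shows "(\<integral>\<^sup>+x. ennreal (indicator S x *\<^sub>R (\<bar>det (matrix (g' x))\<bar> * f (g x))) \<partial>lborel) =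
    (\<integral>\<^sup>+x. ennreal (indicator (g ` S) x *\<^sub>R f x) \<partial>lborel)" (is "?A = ?B")
proof -
  have "S \<in> sets lebesgue" using S by simp
  \<comment> \<open>The theorem concerns vector-valued integrands, so a real function is read as one
    into \<open>real^1\<close>.\<close>
  from has_absolute_integral_change_of_variables[OF this der inj, of "\<lambda>x. vec (f x) :: real^1" "vec b" for b]
  have cv: "(\<lambda>x. \<bar>det (matrix (g' x))\<bar> * f (g x)) absolutely_integrable_on S \<and>
        integral S (\<lambda>x. \<bar>det (matrix (g' x))\<bar> * f (g x)) = b
      \<longleftrightarrow> f absolutely_integrable_on (g ` S) \<and> integral (g ` S) f = b" for b
    by (simp add: absolutely_integrable_on_1_iff integral_on_1_eq)
  have "?A = ennreal r \<longleftrightarrow> ?B = ennreal r" if "0 \<le> r" for r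
    using cv nn_integral_eq_ennreal_iff[OF mf pos that] nn_integral_eq_ennreal_iff[OF md _ that] pos by simp
  then show ?thesis by (cases ?A; cases ?B) (force simp: top_unique)+
qed

lemma nn_integral_change_of_variables:
  fixes g :: "real^'n::finite \<Rightarrow> real^'n" and f :: "real^'n \<Rightarrow> real"
  assumes S: "S \<in> sets borel"
    and der: "\<And>x. x \<in> S \<Longrightarrow> (g has_derivative g' x) (at x within S)" and inj: "inj_on g S"
    and mf: "(\<lambda>x. indicator (g ` S) x *\<^sub>R f x) \<in> borel_measurable borel"
    and md: "(\<lambda>x. indicator S x *\<^sub>R (\<bar>det (matrix (g' x))\<bar> * f (g x))) \<in> borel_measurable borel"
    and pos: "\<And>x. x \<in> g ` S \<Longrightarrow> 0 \<le> f x"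
  shows "(\<integral>\<^sup>+x. ennreal (indicator S x *\<^sub>R (\<bar>det (matrix (g' x))\<bar> * f (g x))) \<partial>lborel) =
    (\<integral>\<^sup>+x. ennreal (indicator (g ` S) x *\<^sub>R f x) \<partial>lborel)"
proof -
  define T where "T = unlabel -` S"
  define h where "h = relabel \<circ> g \<circ> unlabel"
  define h' where "h' x = relabel \<circ> g' (unlabel x) \<circ> unlabel" for x
  have uT: "unlabel ` T = S" unfolding T_def
    by (metis relabel_unlabel(2) surjI surj_image_vimage_eq)
  have hT: "h ` T = unlabel -` (g ` S)"
  proof (intro set_eqI iffI)
    fix x assume "x \<in> unlabel -` (g ` S)"
    then obtain y where y: "y \<in> S" "unlabel x = g y" by auto
    have "x = h (relabel y)" using y(2) by (simp add: h_def flip: y(2))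
    then show "x \<in> h ` T" using y(1) by (auto simp: T_def)
  qed (auto simp: h_def T_def)
  have ind: "indicator T x = (indicator S (unlabel x) :: real)"
    "indicator (h ` T) x = (indicator (g ` S) (unlabel x) :: real)" for x
    by (simp_all add: hT) (simp_all add: T_def indicator_def)
  have der': "(h has_derivative h' x) (at x within T)" if "x \<in> T" for x
  proof -
    have "(g has_derivative g' (unlabel x)) (at (unlabel x) within unlabel ` T)"
      using der that uT by (auto simp: T_def)
    then have "(g \<circ> unlabel has_derivative g' (unlabel x) \<circ> unlabel) (at x within T)"
      by (intro diff_chain_within bounded_linear_imp_has_derivative bounded_linear_unlabel)
    then show ?thesis
      using bounded_linear.has_derivative[OF bounded_linear_relabel] unfolding h_def h'_def o_def by blast
  qed
  have det: "det (matrix (h' x)) = det (matrix (g' (unlabel x)))" for x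
  proof -
    have "unlabel (axis j 1) = axis (of_ix j) 1" for j :: "'n ix"
      by (auto simp: unlabel_def axis_def vec_eq_iff to_ix_inverse of_ix_inverse)
    then have "matrix (h' x) = (\<chi> i j. matrix (g' (unlabel x)) $ of_ix i $ of_ix j)"
      by (simp add: matrix_def h'_def relabel_def)
    then show ?thesis by (simp add: det_relabel)
  qed
  have "(\<integral>\<^sup>+x. ennreal (indicator S x *\<^sub>R (\<bar>det (matrix (g' x))\<bar> * f (g x))) \<partial>lborel) =
     (\<integral>\<^sup>+x. ennreal (indicator T x *\<^sub>R (\<bar>det (matrix (h' x))\<bar> * f (unlabel (h x)))) \<partial>lborel)"
    using measurable_compose[OF unlabel_measurable md]
    by (subst nn_integral_relabel) (auto simp: ind det h_def)
  also have "\<dots> = (\<integral>\<^sup>+x. ennreal (indicator (h ` T) x *\<^sub>R f (unlabel x)) \<partial>lborel)"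
  proof (rule nn_integral_change_of_variables_wellorder[where f="\<lambda>x. f (unlabel x)", OF _ der'])
    show "T \<in> sets borel" unfolding T_def using S by (rule measurable_sets_borel[OF unlabel_measurable])
    show "inj_on h T"
      using inj unfolding inj_on_def h_def T_def
      by (auto, metis relabel_unlabel)
    show "(\<lambda>x. indicator (h ` T) x *\<^sub>R f (unlabel x)) \<in> borel_measurable borel"
      unfolding ind using measurable_compose[OF unlabel_measurable mf] by simp
    show "(\<lambda>x. indicator T x *\<^sub>R (\<bar>det (matrix (h' x))\<bar> * f (unlabel (h x)))) \<in> borel_measurable borel"
      unfolding ind det using measurable_compose[OF unlabel_measurable md] by (simp add: h_def)
    show "0 \<le> f (unlabel x)" if "x \<in> h ` T" for x using that pos by (auto simp: hT)
  qed
  also have "\<dots> = (\<integral>\<^sup>+x. ennreal (indicator (g ` S) x *\<^sub>R f x) \<partial>lborel)"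
    unfolding ind using measurable_compose[OF unlabel_measurable mf]
    by (subst nn_integral_relabel) auto
  finally show ?thesis .
qed

section \<open>Charts, transition maps and metrics\<close>

lemma at_within_openin_eq:
  assumes "openin (top_of_set H) S" "q \<in> S"
  shows "at q within S = at q within H"
proof -
  obtain T where "open T" "S = H \<inter> T" using assms(1) by (auto simp: openin_open)
  then show ?thesis using assms(2) by (intro at_within_nhd[of q T]) auto
qed

locale compact_mfd =
  fixes M :: "'a::t2_space set" and A :: "('a, 'n::finite) chart set"
  assumes mfd: "compact_oriented_manifold M A"
begin

lemma compactM: "compact M" and atlas: "oriented_atlas M A"
  using mfd by (auto simp: compact_oriented_manifold_def)

lemma chart_atI: assumes "p \<in> M" shows "chart_at A p \<in> A" "p \<in> fst (chart_at A p)"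
proof -
  have "\<exists>c. c \<in> A \<and> p \<in> fst c" using assms atlas by (auto simp: oriented_atlas_def)
  from someI_ex[OF this] show "chart_at A p \<in> A" "p \<in> fst (chart_at A p)"
    by (auto simp: chart_at_def)
qed

context
  fixes c assumes c: "c \<in> A"
begin

lemma is_chartD: "is_chart M c"
  using c atlas by (auto simp: oriented_atlas_def)

lemma chart_open: "openin (top_of_set M) (fst c)"
  and image_open: "openin (top_of_set half_space) (chart_image c)"
  and chart_homeo: "homeomorphism (fst c) (chart_image c) (snd c) (chart_inv c)"
  using is_chartD by (auto simp: is_chart_def)

lemma chart_subset: "fst c \<subseteq> M" using chart_open openin_imp_subset by blast

lemma image_subset: "chart_image c \<subseteq> half_space" using image_open openin_imp_subset by blast

lemma chart_inv_left [simp]: "p \<in> fst c \<Longrightarrow> chart_inv c (snd c p) = p"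
  and chart_inv_right [simp]: "q \<in> chart_image c \<Longrightarrow> snd c (chart_inv c q) = q"
  and chart_inv_in [simp]: "q \<in> chart_image c \<Longrightarrow> chart_inv c q \<in> fst c"
  using chart_homeo by (auto simp: homeomorphism_def)

lemma snd_in_image [simp]: "p \<in> fst c \<Longrightarrow> snd c p \<in> chart_image c"
  by (auto simp: chart_image_def)

lemma bdry_coord_nonneg: "p \<in> fst c \<Longrightarrow> 0 \<le> snd c p $ bdry_ix"
  using snd_in_image image_subset by (auto simp: half_space_def subset_iff)

lemma cont_chart: "continuous_on (fst c) (snd c)"
  and cont_chart_inv: "continuous_on (chart_image c) (chart_inv c)"
  using chart_homeo by (auto simp: homeomorphism_def)

lemma inj_chart: "inj_on (snd c) (fst c)"
  by (metis inj_onI chart_inv_left)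

lemma openin_image:
  assumes "openin (top_of_set M) U" "U \<subseteq> fst c"
  shows "openin (top_of_set half_space) (snd c ` U)"
proof -
  have "openin (top_of_set (fst c)) U"
    using assms chart_subset openin_subset_trans by blast
  then have "openin (top_of_set (chart_image c)) (snd c ` U)"
    using homeomorphism_imp_open_map[OF chart_homeo] by blast
  then show ?thesis using image_open openin_trans by blast
qed

end

lemma overlap_open:
  assumes "c \<in> A" "c' \<in> A"
  shows "openin (top_of_set half_space) (snd c ` (fst c \<inter> fst c'))"
  using openin_image[OF assms(1)] chart_open assms by (simp add: openin_Int)

lemma trans_C1:
  assumes "c \<in> A" "c' \<in> A"
  shows "C1_on (snd c ` (fst c \<inter> fst c')) (snd c' \<circ> chart_inv c)"
  using atlas assms by (intro smooth_on_imp_C1_on) (auto simp: oriented_atlas_def)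

lemma det_trans_pos:
  assumes "c \<in> A" "c' \<in> A" "p \<in> fst c \<inter> fst c'"
  shows "0 < det (trans_jac c c' p)"
  using atlas assms by (auto simp: oriented_atlas_def)

lemma trans_deriv:
  assumes "c \<in> A" "c' \<in> A" "p \<in> fst c \<inter> fst c'"
  shows "((snd c' \<circ> chart_inv c) has_derivative (\<lambda>v. trans_jac c c' p *v v)) (at (snd c p) within half_space)"
proof -
  have D: "((snd c' \<circ> chart_inv c) has_derivative
      frechet_derivative (snd c' \<circ> chart_inv c) (at (snd c p) within half_space)) (at (snd c p) within half_space)"
    by (rule C1_on_frechet(1)[OF overlap_open trans_C1]) (use assms in auto)
  have "(\<lambda>v. trans_jac c c' p *v v) = frechet_derivative (snd c' \<circ> chart_inv c) (at (snd c p) within half_space)"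
    using has_derivative_linear[OF D] by (simp add: trans_jac_def jacobian_def matrix_works fun_eq_iff)
  then show ?thesis using D by simp
qed

lemma continuous_on_M:
  assumes "\<And>c. c \<in> A \<Longrightarrow> continuous_on (chart_image c) (f \<circ> chart_inv c)"
  shows "continuous_on M f"
  unfolding continuous_on_eq_continuous_within
proof
  fix p assume p: "p \<in> M"
  let ?c = "chart_at A p"
  have c: "?c \<in> A" "p \<in> fst ?c" using chart_atI[OF p] by auto
  have "continuous_on (fst ?c) f"
  proof (rule continuous_on_eq)
    show "continuous_on (fst ?c) ((f \<circ> chart_inv ?c) \<circ> snd ?c)"
      by (rule continuous_on_compose[OF cont_chart[OF c(1)] assms[OF c(1), unfolded chart_image_def]])
  qed (use c in auto)
  then have "continuous (at p within fst ?c) f"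
    using c(2) by (simp add: continuous_on_eq_continuous_within)
  then show "continuous (at p within M) f"
    using at_within_openin_eq[OF chart_open[OF c(1)] c(2)] by simp
qed

text \<open>The chain rule for \<open>u\<close> in the chart \<open>c'\<close> composed with the
  transition map. It is applied within the overlap, whose image lies in the half-space; as the
  overlap is relatively open, the derivative within it is the derivative within the
  half-space.\<close>

lemma differential_trans:
  assumes c: "c \<in> A" "c' \<in> A" "p \<in> fst c \<inter> fst c'"
    and u: "C1_on (chart_image c') (u \<circ> chart_inv c')"
  shows "differential u c p = transpose (trans_jac c c' p) *v differential u c' p"
proof -
  let ?F = "snd c' \<circ> chart_inv c" and ?U = "snd c ` (fst c \<inter> fst c')" and ?J = "trans_jac c c' p"
  let ?D = "frechet_derivative (u \<circ> chart_inv c') (at (snd c' p) within half_space)"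
  have q': "snd c' p \<in> chart_image c'" using c by auto
  have Fq: "?F (snd c p) = snd c' p" using c by auto
  have dU: "(?F has_derivative (\<lambda>v. ?J *v v)) (at (snd c p) within ?U)"
    by (rule has_derivative_subset[OF trans_deriv[OF c]])
       (use overlap_open[OF c(1,2)] openin_imp_subset in blast)
  have du: "((u \<circ> chart_inv c') has_derivative ?D) (at (snd c' p) within half_space)"
    by (rule C1_on_frechet(1)[OF image_open[OF c(2)] u q'])
  have "?F ` ?U \<subseteq> half_space" using c image_subset[OF c(2)] by (auto simp: chart_image_def)
  then have "((u \<circ> chart_inv c') has_derivative ?D) (at (?F (snd c p)) within ?F ` ?U)"
    unfolding Fq by (rule has_derivative_subset[OF du])
  from diff_chain_within[OF dU this]
  have "(((u \<circ> chart_inv c') \<circ> ?F) has_derivative (?D \<circ> (\<lambda>v. ?J *v v))) (at (snd c p) within ?U)" .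
  then have "(((u \<circ> chart_inv c') \<circ> ?F) has_derivative (?D \<circ> (\<lambda>v. ?J *v v))) (at (snd c p) within half_space)"
    using at_within_openin_eq[OF overlap_open[OF c(1,2)] imageI[OF c(3)]] by simp
  then have "((u \<circ> chart_inv c) has_derivative (?D \<circ> (\<lambda>v. ?J *v v))) (at (snd c p) within half_space)"
    by (rule has_derivative_transform_openin[OF overlap_open[OF c(1,2)], rotated]) (use c in auto)
  moreover have "snd c p \<in> half_space"
    using c image_subset[OF c(1)] snd_in_image[OF c(1)] by blast
  ultimately have 1: "partial k (u \<circ> chart_inv c) (snd c p) = ?D (?J *v axis k 1)" for k
    by (simp add: partial_eq)
  have "?D (?J *v axis k 1) = (\<Sum>m\<in>UNIV. ?J $ m $ k * partial m (u \<circ> chart_inv c') (snd c' p))" for k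
  proof -
    have "?J *v axis k 1 = (\<Sum>m\<in>UNIV. ?J $ m $ k *\<^sub>R axis m 1)"
      by (simp add: vec_eq_iff matrix_vector_mult_def axis_def if_distrib cong: if_cong)
    then show ?thesis
      using has_derivative_linear[OF du] by (simp add: linear_sum linear_cmul partial_def)
  qed
  then show ?thesis
    by (simp add: differential_def vec_eq_iff 1 matrix_vector_mult_def transpose_def)
qed

end

section \<open>Transformation rules for the metric, the volume density and the gradient\<close>

context compact_mfd
begin

lemma metricD:
  assumes h: "riemannian_metric A h" and c: "c \<in> A" "p \<in> fst c"
  shows "transpose (h c p) = h c p" "\<And>v. v \<noteq> 0 \<Longrightarrow> 0 < v \<bullet> (h c p *v v)"
  using h c by (auto simp: riemannian_metric_def)

lemma metric_trans:
  assumes h: "riemannian_metric A h" and c: "c \<in> A" "c' \<in> A" "p \<in> fst c \<inter> fst c'"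
  shows "h c p = transpose (trans_jac c c' p) ** h c' p ** trans_jac c c' p"
  using h c unfolding riemannian_metric_def tensor2_field_def by blast

end

text \<open>The segment from \<open>B\<close> to the identity consists of matrices that are positive
  on nonzero vectors, so the determinant has no zero along it and keeps the sign that it has at the
  identity.\<close>

lemma pos_def_det_pos:
  fixes B :: "real^'n::finite^'n"
  assumes sym: "transpose B = B" and pos: "\<And>v. v \<noteq> 0 \<Longrightarrow> 0 < v \<bullet> (B *v v)"
  shows "0 < det B"
proof -
  let ?C = "\<lambda>t. t *\<^sub>R mat 1 + (1 - t) *\<^sub>R B"
  have nz: "det (?C t) \<noteq> 0" if "t \<in> {0..1}" for t
  proof
    assume "det (?C t) = 0"
    then have "\<not> invertible (?C t)" by (simp add: invertible_det_nz)
    then obtain v where v: "v \<noteq> 0" "?C t *v v = 0"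
      by (metis invertible_left_inverse matrix_left_invertible_ker)
    have "0 = v \<bullet> (?C t *v v)" using v by simp
    also have "\<dots> = t * (v \<bullet> v) + (1 - t) * (v \<bullet> (B *v v))"
      by (simp add: matrix_vector_mult_add_rdistrib scaleR_matrix_vector_assoc[symmetric] inner_add_right)
    also have "\<dots> > 0"
    proof (cases "t = 0")
      case False
      then show ?thesis using that pos[OF v(1)] v(1)
        by (intro add_pos_nonneg mult_pos_pos mult_nonneg_nonneg) auto
    qed (use pos[OF v(1)] in simp)
    finally show False by simp
  qed
  have "continuous_on {0..1} (\<lambda>t. det (?C t))"
    by (simp add: det_def) (intro continuous_intros)
  then have "connected ((\<lambda>t. det (?C t)) ` {0..1})"
    by (rule connected_continuous_image) simp
  moreover have "det (?C 1) \<in> (\<lambda>t. det (?C t)) ` {0..1}" "det (?C 0) \<in> (\<lambda>t. det (?C t)) ` {0..1}"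
    by (rule imageI, simp)+
  ultimately show ?thesis
    using nz connectedD_interval[of "(\<lambda>t. det (?C t)) ` {0..1}" "det (?C 0)" "det (?C 1)" 0]
    by (force simp: not_less image_iff)
qed

lemma matrix_inv_unique:
  fixes B :: "real^'n::finite^'n"
  assumes "B ** C = mat 1" shows "matrix_inv B = C"
proof -
  have inv: "invertible B" using assms matrix_left_right_inverse unfolding invertible_def by blast
  have "matrix_inv B = matrix_inv B ** (B ** C)" by (simp add: assms)
  also have "\<dots> = C" using matrix_inv_left[OF inv] by (simp add: matrix_mul_assoc)
  finally show ?thesis .
qed

text \<open>The inner product of the differentials of \<open>u\<close> and \<open>v\<close> with
  respect to \<open>h\<close>, written as the covector of \<open>v\<close> applied to the gradient
  of \<open>u\<close>. The chart stays an argument, because independence of it has to be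
  proved.\<close>

definition pairing :: "('a, 'n::finite) tensor2 \<Rightarrow> ('a \<Rightarrow> real) \<Rightarrow> ('a \<Rightarrow> real) \<Rightarrow> ('a, 'n) chart \<Rightarrow> 'a \<Rightarrow> real" where
  "pairing h u v c p = differential v c p \<bullet> gradient h u c p"

definition vol_density :: "('a, 'n::finite) tensor2 \<Rightarrow> ('a, 'n) chart \<Rightarrow> 'a \<Rightarrow> real" where
  "vol_density h c p = sqrt (det (h c p))"

context compact_mfd
begin

lemma metric_det_pos:
  assumes "riemannian_metric A h" "c \<in> A" "p \<in> fst c"
  shows "0 < det (h c p)"
  using metricD[OF assms] pos_def_det_pos by blast

lemma metric_invertible:
  assumes "riemannian_metric A h" "c \<in> A" "p \<in> fst c"
  shows "invertible (h c p)"
  using metric_det_pos[OF assms] by (simp add: invertible_det_nz)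

lemma vol_density_pos:
  assumes "riemannian_metric A h" "c \<in> A" "p \<in> fst c"
  shows "0 < vol_density h c p"
  using metric_det_pos[OF assms] by (simp add: vol_density_def)

text \<open>The determinant of the metric picks up the square of the Jacobian determinant. The
  latter is positive by orientation, so no absolute value appears under the root.\<close>

lemma vol_density_trans:
  assumes h: "riemannian_metric A h" and c: "c \<in> A" "c' \<in> A" "p \<in> fst c \<inter> fst c'"
  shows "vol_density h c p = det (trans_jac c c' p) * vol_density h c' p"
proof -
  have "det (h c p) = (det (trans_jac c c' p))\<^sup>2 * det (h c' p)"
    by (subst metric_trans[OF assms]) (simp add: det_mul det_transpose power2_eq_square)
  then show ?thesis
    using det_trans_pos[OF c] by (simp add: vol_density_def real_sqrt_mult)
qed

lemma metric_gradient:
  assumes h: "riemannian_metric A h" and c: "c \<in> A" "p \<in> fst c"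
  shows "h c p *v gradient h u c p = differential u c p"
  using matrix_inv_right[OF metric_invertible[OF assms]]
  by (simp add: gradient_def matrix_vector_mul_assoc)

text \<open>The gradient solves the equation "metric times gradient equals differential".
  Transforming both sides and cancelling the transposed Jacobian avoids a transformation rule for
  the inverse metric.\<close>

lemma gradient_trans:
  assumes h: "riemannian_metric A h" and c: "c \<in> A" "c' \<in> A" "p \<in> fst c \<inter> fst c'"
    and u: "C1_on (chart_image c') (u \<circ> chart_inv c')"
  shows "gradient h u c' p = trans_jac c c' p *v gradient h u c p"
proof -
  let ?J = "trans_jac c c' p" and ?X = "gradient h u c p"
  have "transpose ?J *v (h c' p *v (?J *v ?X)) = h c p *v ?X"
    by (subst metric_trans[OF h c]) (simp only: matrix_vector_mul_assoc matrix_mul_assoc)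
  also have "\<dots> = transpose ?J *v differential u c' p"
    using metric_gradient[OF h c(1)] differential_trans[OF c u] c by simp
  finally have eq: "transpose ?J *v (h c' p *v (?J *v ?X)) = transpose ?J *v differential u c' p" .
  have "invertible (transpose ?J)"
    using det_trans_pos[OF c] by (simp add: invertible_det_nz det_transpose)
  from injD[OF inj_matrix_vector_mult[OF this] eq]
  have "h c' p *v (?J *v ?X) = differential u c' p" .
  then have "matrix_inv (h c' p) *v differential u c' p = (matrix_inv (h c' p) ** h c' p) *v (?J *v ?X)"
    by (simp only: matrix_vector_mul_assoc matrix_mul_assoc flip: matrix_vector_mul_assoc)
  then show ?thesis
    using matrix_inv_left[OF metric_invertible[OF h c(2)]] c by (simp add: gradient_def)
qed

text \<open>The covector transforms with the transposed Jacobian and the vector with the Jacobian,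
  so the two cancel.\<close>

lemma pairing_invariant:
  assumes h: "riemannian_metric A h" and c: "c \<in> A" "c' \<in> A" "p \<in> fst c \<inter> fst c'"
    and u: "C1_on (chart_image c') (u \<circ> chart_inv c')" and v: "C1_on (chart_image c') (v \<circ> chart_inv c')"
  shows "pairing h u v c p = pairing h u v c' p"
  unfolding pairing_def gradient_trans[OF h c u] differential_trans[OF c v]
  by (simp add: dot_lmul_matrix)

lemma pairing_commute:
  assumes h: "riemannian_metric A h" and c: "c \<in> A" "p \<in> fst c"
  shows "pairing h u v c p = pairing h v u c p"
proof -
  have "pairing h u v c p = (h c p *v gradient h v c p) \<bullet> gradient h u c p"
    by (simp add: pairing_def metric_gradient[OF assms])
  also have "\<dots> = gradient h v c p \<bullet> (transpose (h c p) *v gradient h u c p)"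
    by (metis dot_lmul_matrix inner_commute transpose_matrix_vector)
  also have "\<dots> = pairing h v u c p"
    by (simp add: pairing_def metricD(1)[OF assms] metric_gradient[OF assms] inner_commute del: transpose_matrix_vector)
  finally show ?thesis .
qed

section \<open>Boundary points and the Neumann condition in arbitrary charts\<close>

text \<open>The boundary is invariant: at an interior point the last coordinate of a transition map
  would attain its minimum, so that the Jacobian would be singular.\<close>

lemma interior_trans:
  assumes c: "c \<in> A" "c' \<in> A" "p \<in> fst c \<inter> fst c'" and pos: "snd c p $ bdry_ix > 0"
  shows "snd c' p $ bdry_ix > 0"
proof (rule ccontr)
  assume "\<not> snd c' p $ bdry_ix > 0"
  moreover have "snd c' p \<in> half_space"
    using c image_subset[OF c(2)] snd_in_image[OF c(2)] by blast
  ultimately have zero: "snd c' p $ bdry_ix = 0" by (simp add: half_space_def)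
  let ?J = "trans_jac c c' p" and ?F = "snd c' \<circ> chart_inv c"
  obtain T where T: "open T" "snd c ` (fst c \<inter> fst c') = half_space \<inter> T"
    using overlap_open[OF c(1,2)] by (auto simp: openin_open)
  let ?P = "{x :: real^'n. x $ bdry_ix > 0}"
  have P: "open ?P" by (intro open_Collect_less continuous_intros)
  have PH: "?P \<subseteq> half_space" by (auto simp: half_space_def)
  have q: "snd c p \<in> T \<inter> ?P" using T c pos by auto
  have sub: "T \<inter> ?P \<subseteq> snd c ` (fst c \<inter> fst c')" using T(2) PH by blast
  have "(?F has_derivative (\<lambda>v. ?J *v v)) (at (snd c p) within T \<inter> ?P)"
    by (rule has_derivative_subset[OF trans_deriv[OF c]]) (use PH in blast)
  then have "(?F has_derivative (\<lambda>v. ?J *v v)) (at (snd c p))"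
    using at_within_open[OF q] T(1) P by (simp add: open_Int)
  then have D: "((\<lambda>x. ?F x $ bdry_ix) has_derivative (\<lambda>v. (?J *v v) $ bdry_ix)) (at (snd c p))"
    by (rule bounded_linear.has_derivative[OF bounded_linear_vec_nth])
  have "(\<lambda>v. (?J *v v) $ bdry_ix) = (\<lambda>v. 0)"
  proof (rule differential_zero_maxmin[OF q _ D])
    show "open (T \<inter> ?P)" using T(1) P by (rule open_Int)
    have "?F x $ bdry_ix \<ge> ?F (snd c p) $ bdry_ix" if "x \<in> T \<inter> ?P" for x
    proof -
      have "x \<in> snd c ` (fst c \<inter> fst c')" using that sub by blast
      then have "?F x \<in> chart_image c'" using c by (auto simp: chart_image_def)
      then have "?F x $ bdry_ix \<ge> 0" using image_subset[OF c(2)] by (auto simp: half_space_def)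
      then show ?thesis using zero c by simp
    qed
    then show "(\<forall>y\<in>T \<inter> ?P. ?F y $ bdry_ix \<le> ?F (snd c p) $ bdry_ix) \<or>
      (\<forall>y\<in>T \<inter> ?P. ?F (snd c p) $ bdry_ix \<le> ?F y $ bdry_ix)" by blast
  qed
  then have "(?J *v axis k 1) $ bdry_ix = 0" for k by meson
  then have "row bdry_ix ?J = 0"
    by (simp add: row_def vec_eq_iff matrix_vector_mult_def axis_def if_distrib cong: if_cong)
  then have "det ?J = 0" by (rule det_zero_row)
  then show False using det_trans_pos[OF c] by simp
qed

lemma boundary_trans:
  assumes c: "c \<in> A" "c' \<in> A" "p \<in> fst c \<inter> fst c'"
  shows "snd c p $ bdry_ix = 0 \<longleftrightarrow> snd c' p $ bdry_ix = 0"
proof -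
  have "snd c' p $ bdry_ix \<ge> 0" "snd c p $ bdry_ix \<ge> 0"
    using c bdry_coord_nonneg by auto
  moreover have "p \<in> fst c' \<inter> fst c" using c by auto
  ultimately show ?thesis
    using interior_trans[OF c] interior_trans[OF c(2,1)] by force
qed

text \<open>A line in the wall through the point is carried into the wall by the transition map, so
  the bounding coordinate of the map is constantly zero along it.\<close>

lemma trans_jac_boundary_row:
  assumes c: "c \<in> A" "c' \<in> A" "p \<in> fst c \<inter> fst c'" and b: "snd c p $ bdry_ix = 0" and k: "k \<noteq> bdry_ix"
  shows "trans_jac c c' p $ bdry_ix $ k = 0"
proof -
  let ?J = "trans_jac c c' p" and ?F = "snd c' \<circ> chart_inv c" and ?U = "snd c ` (fst c \<inter> fst c')"
  let ?\<gamma> = "\<lambda>s. snd c p + s *\<^sub>R axis k 1"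
  have bdry: "?\<gamma> s $ bdry_ix = 0" for s using b k by (simp add: axis_def)
  have D: "((\<lambda>x. ?F x $ bdry_ix) has_derivative (\<lambda>v. (?J *v v) $ bdry_ix)) (at (snd c p) within half_space)"
    by (rule bounded_linear.has_derivative[OF bounded_linear_vec_nth trans_deriv[OF c]])
  have g: "(?\<gamma> has_derivative (\<lambda>s. s *\<^sub>R axis k 1)) (at 0)"
    by (auto intro!: derivative_eq_intros)
  have "range ?\<gamma> \<subseteq> half_space" using bdry by (auto simp: half_space_def simp del: vector_add_component)
  then have D': "((\<lambda>x. ?F x $ bdry_ix) has_derivative (\<lambda>v. (?J *v v) $ bdry_ix)) (at (?\<gamma> 0) within range ?\<gamma>)"
    using has_derivative_subset[OF D] by simp
  have "((\<lambda>x. ?F x $ bdry_ix) \<circ> ?\<gamma> has_derivative (\<lambda>v. (?J *v v) $ bdry_ix) \<circ> (\<lambda>s. s *\<^sub>R axis k 1)) (at 0)"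
    by (rule diff_chain_within[OF g D'])
  moreover have "((\<lambda>x. ?F x $ bdry_ix) \<circ> ?\<gamma> has_derivative (\<lambda>_. 0)) (at 0)"
  proof -
    obtain T where T: "open T" "?U = half_space \<inter> T" using overlap_open[OF c(1,2)] by (auto simp: openin_open)
    have oT: "open (?\<gamma> -` T)" using T(1) by (intro open_vimage continuous_intros) auto
    have "0 = ((\<lambda>x. ?F x $ bdry_ix) \<circ> ?\<gamma>) s" if "s \<in> ?\<gamma> -` T" for s
    proof -
      have "?\<gamma> s \<in> ?U" using that T(2) bdry[of s] by (auto simp: half_space_def)
      then obtain p' where p': "p' \<in> fst c \<inter> fst c'" "?\<gamma> s = snd c p'" by blast
      then have "snd c' p' $ bdry_ix = 0" using boundary_trans[OF c(1,2) p'(1)] bdry[of s] by simp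
      then show ?thesis using p' c by simp
    qed
    then show ?thesis
      using T c by (intro has_derivative_transform_within_open[OF has_derivative_const oT]) auto
  qed
  ultimately have "(\<lambda>v. (?J *v v) $ bdry_ix) \<circ> (\<lambda>s. s *\<^sub>R axis k 1) = (\<lambda>_. 0)"
    by (rule has_derivative_unique)
  then have "(?J *v (1 *\<^sub>R axis k 1)) $ bdry_ix = 0" by (metis comp_apply)
  then show ?thesis
    by (simp add: matrix_vector_mult_def axis_def if_distrib cong: if_cong)
qed

text \<open>In the chosen chart the normal derivative is a nonzero multiple of the bounding
  component of the gradient, since the normal is a multiple of the inverse metric applied to the
  bounding coordinate covector. In any other chart the boundary row of the Jacobian has a single
  nonzero entry, so that component vanishes there too.\<close>

lemma gradient_boundary:
  assumes h: "riemannian_metric A h" and c: "c \<in> A" "p \<in> fst c" and b: "snd c p $ bdry_ix = 0"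
    and u: "\<And>c. c \<in> A \<Longrightarrow> C1_on (chart_image c) (u \<circ> chart_inv c)"
    and N: "normal_derivative A h u p = 0"
  shows "gradient h u c p $ bdry_ix = 0"
proof -
  let ?c = "chart_at A p"
  have c': "?c \<in> A" "p \<in> fst ?c" using chart_atI c chart_subset by blast+
  let ?B = "h ?c p" and ?e = "axis bdry_ix 1 :: real^'n"
  let ?G = "matrix_inv ?B"
  \<comment> \<open>The metric dual of the covector that reads off the bounding coordinate. It is
    orthogonal to the boundary and points inwards.\<close>
  define w where "w = ?G *v ?e"
  have Bw: "?B *v w = ?e"
    using matrix_inv_right[OF metric_invertible[OF h c']] by (simp add: w_def matrix_vector_mul_assoc)
  have w0: "w \<noteq> 0" using Bw by (metis axis_eq_0_iff matrix_vector_mult_0_right one_neq_zero)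
  have sym: "x \<bullet> (?B *v y) = (?B *v x) \<bullet> y" for x y
    using metricD(1)[OF h c'] by (metis dot_lmul_matrix transpose_matrix_vector inner_commute)
  have wb: "w $ bdry_ix = w \<bullet> (?B *v w)" by (simp add: Bw inner_axis)
  have wpos: "0 < w $ bdry_ix" using metricD(2)[OF h c' w0] wb by simp
  define s where "s = sqrt (w $ bdry_ix)"
  have s: "s > 0" "s * s = w $ bdry_ix" using wpos by (auto simp: s_def)
  \<comment> \<open>The squared length of \<open>w\<close> is its own bounding component, so
    \<open>s\<close> is its length; the sign makes the normal point outwards.\<close>
  define r where "r = - 1 / s"
  have r: "r < 0" "r * (r * w $ bdry_ix) = 1" using s by (auto simp: r_def field_simps)
  have "outer_normal h ?c p = r *\<^sub>R w"
    unfolding outer_normal_def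
  proof (rule the_equality, intro conjI allI impI)
    show "r *\<^sub>R w \<bullet> (?B *v (r *\<^sub>R w)) = 1"
      using r wb by (simp add: matrix_vector_mult_scaleR)
    show "r *\<^sub>R w \<bullet> (?B *v x) = 0" if "x $ bdry_ix = 0" for x
      using that by (simp add: sym Bw inner_axis' matrix_vector_mult_scaleR)
    show "(r *\<^sub>R w) $ bdry_ix < 0" using r wpos by (simp add: mult_neg_pos)
  next
    fix v assume v: "v \<bullet> (?B *v v) = 1 \<and> (\<forall>w. w $ bdry_ix = 0 \<longrightarrow> v \<bullet> (?B *v w) = 0) \<and> v $ bdry_ix < 0"
    define m where "m = (?B *v v) $ bdry_ix"
    \<comment> \<open>Orthogonality to the boundary forces the lowered vector to be a multiple of
      the bounding covector. Hence \<open>v\<close> is a multiple of \<open>w\<close>, and length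
      and sign fix the factor.\<close>
    have "(?B *v v) $ k = 0" if "k \<noteq> bdry_ix" for k
    proof -
      have "v \<bullet> (?B *v axis k 1) = 0" using v that by (simp add: axis_def)
      then show ?thesis by (simp add: sym inner_axis)
    qed
    then have Bv: "?B *v v = m *\<^sub>R ?e" by (auto simp: m_def vec_eq_iff axis_def)
    have "v = ?G *v (?B *v v)"
      using matrix_inv_left[OF metric_invertible[OF h c']] by (simp add: matrix_vector_mul_assoc)
    then have vw: "v = m *\<^sub>R w" by (simp add: Bv w_def matrix_vector_mult_scaleR)
    have "m < 0" using v wpos by (simp add: vw mult_less_0_iff)
    moreover have "(m * s) * (m * s) = 1"
      using v s wb by (simp add: vw matrix_vector_mult_scaleR algebra_simps)
    ultimately have "m * s = -1"
      using s by (metis mult_neg_pos not_less_iff_gr_or_eq square_eq_1_iff zero_less_one)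
    then have "m = r" using s by (simp add: r_def field_simps)
    then show "v = r *\<^sub>R w" by (simp add: vw)
  qed
  then have "r *\<^sub>R w \<bullet> differential u ?c p = 0"
    using N by (simp add: normal_derivative_def Let_def inner_vec_def)
  then have "w \<bullet> differential u ?c p = 0" using r by simp
  then have "?e \<bullet> gradient h u ?c p = 0"
    by (simp only: metric_gradient[OF h c', symmetric] sym Bw)
  then have g0: "gradient h u ?c p $ bdry_ix = 0" by (simp add: inner_axis')
  have cc: "p \<in> fst c \<inter> fst ?c" using c c' by blast
  let ?J = "trans_jac c ?c p"
  have row: "?J $ bdry_ix $ k = 0" if "k \<noteq> bdry_ix" for k
    by (rule trans_jac_boundary_row[OF c(1) c'(1) cc b that])
  have "gradient h u ?c p $ bdry_ix = (\<Sum>k\<in>UNIV. ?J $ bdry_ix $ k * gradient h u c p $ k)"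
    by (simp add: gradient_trans[OF h c(1) c'(1) cc u[OF c'(1)]] matrix_vector_mult_def)
  also have "\<dots> = (\<Sum>k\<in>{bdry_ix}. ?J $ bdry_ix $ k * gradient h u c p $ k)"
    by (rule sum.mono_neutral_right) (auto simp: row)
  finally have "?J $ bdry_ix $ bdry_ix * gradient h u c p $ bdry_ix = 0" using g0 by simp
  \<comment> \<open>Otherwise the whole boundary row would vanish and the Jacobian would be
    singular.\<close>
  moreover have "?J $ bdry_ix $ bdry_ix \<noteq> 0"
  proof
    assume "?J $ bdry_ix $ bdry_ix = 0"
    then have "?J $ bdry_ix $ k = 0" for k using row by (cases "k = bdry_ix") auto
    then have "row bdry_ix ?J = 0" by (simp add: row_def vec_eq_iff)
    then show False using det_zero_row det_trans_pos[OF c(1) c'(1) cc] by fastforce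
  qed
  ultimately show ?thesis by simp
qed

end

section \<open>The Riemannian volume measure\<close>

text \<open>The volume seen in coordinates. \<open>chart_inv\<close> is meaningless off the image of
  the chart, hence the indicator inside the density.\<close>

definition chart_measure :: "('a, 'n::finite) tensor2 \<Rightarrow> ('a, 'n) chart \<Rightarrow> (real^'n) measure" where
  "chart_measure h c = density lborel (\<lambda>q. ennreal (indicator (chart_image c) q *\<^sub>R vol_density h c (chart_inv c q)))"

context compact_mfd
begin

abbreviation "MB \<equiv> restrict_space (borel :: 'a measure) M"

lemma space_MB [simp]: "space MB = M" by (simp add: space_restrict_space)

lemma closedM: "closed M" using compactM by (rule compact_imp_closed)

lemma openin_M_sets: "openin (top_of_set M) U \<Longrightarrow> U \<in> sets MB"
  unfolding openin_open sets_restrict_space by (blast intro: borel_open)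

lemma chart_sets [measurable]: "c \<in> A \<Longrightarrow> fst c \<in> sets MB"
  using chart_open openin_M_sets by blast

lemma image_borel: "c \<in> A \<Longrightarrow> chart_image c \<in> sets borel"
  using image_open openin_half_space_borel by blast

lemma chart_inv_measurable:
  assumes "c \<in> A" shows "chart_inv c \<in> restrict_space borel (chart_image c) \<rightarrow>\<^sub>M MB"
  using cont_chart_inv[OF assms] chart_inv_in[OF assms] chart_subset[OF assms]
  by (intro measurable_restrict_space2 borel_measurable_continuous_on_restrict)
     (auto simp: space_restrict_space)

lemma image_vimage:
  assumes "c \<in> A" "X \<subseteq> fst c"
  shows "snd c ` X = chart_inv c -` X \<inter> chart_image c"
proof (intro set_eqI iffI)
  fix q assume "q \<in> chart_inv c -` X \<inter> chart_image c"
  then show "q \<in> snd c ` X" by (intro image_eqI[of _ _ "chart_inv c q"]) (auto simp: assms(1))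
qed (use assms in auto)

lemma image_sets:
  assumes c: "c \<in> A" and X: "X \<in> sets MB" "X \<subseteq> fst c"
  shows "snd c ` X \<in> sets borel"
proof -
  have "snd c ` X \<in> sets (restrict_space borel (chart_image c))"
    using measurable_sets[OF chart_inv_measurable[OF c] X(1)] image_vimage[OF c X(2)]
    by (simp add: space_restrict_space)
  then show ?thesis
    using image_borel[OF c] by (simp add: sets_restrict_space_iff)
qed

lemma continuous_on_M_measurable:
  "continuous_on M f \<Longrightarrow> (f :: 'a \<Rightarrow> real) \<in> borel_measurable MB"
  by (rule borel_measurable_continuous_on_restrict)

lemma metric_C1:
  assumes "riemannian_metric A h" "c \<in> A"
  shows "C1_on (chart_image c) (\<lambda>q. h c (chart_inv c q) $ i $ j)"
proof -
  have "smooth_on (chart_image c) (h c \<circ> chart_inv c)"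
    using assms by (auto simp: riemannian_metric_def tensor2_field_def)
  from C1_on_mat_nth[OF smooth_on_imp_C1_on[OF this]] show ?thesis by (simp add: o_def)
qed

lemma vol_density_C1:
  assumes "riemannian_metric A h" "c \<in> A"
  shows "C1_on (chart_image c) (\<lambda>q. vol_density h c (chart_inv c q))"
  unfolding vol_density_def
  by (intro C1_on_sqrt C1_on_det metric_C1 assms) (simp add: metric_det_pos assms)

lemma matrix_inv_C1:
  assumes "riemannian_metric A h" "c \<in> A"
  shows "C1_on (chart_image c) (\<lambda>q. matrix_inv (h c (chart_inv c q)) $ i $ j)"
  using metric_det_pos[OF assms] chart_inv_in[OF assms(2)]
  by (intro C1_on_matrix_inv metric_C1 assms) (auto simp: less_le)

lemma chart_density_measurable [measurable]:
  assumes "riemannian_metric A h" "c \<in> A"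
  shows "(\<lambda>q. indicator (chart_image c) q *\<^sub>R vol_density h c (chart_inv c q)) \<in> borel_measurable borel"
  by (rule borel_measurable_continuous_on_indicator[OF image_borel C1_on_imp_continuous_on[OF vol_density_C1]])
     (use assms in auto)

lemma chart_measure_image:
  assumes h: "riemannian_metric A h" and c: "c \<in> A" and X: "X \<in> sets MB" "X \<subseteq> fst c"
  shows "emeasure (chart_measure h c) (snd c ` X) =
    (\<integral>\<^sup>+q\<in>snd c ` X. ennreal (sqrt (det (h c (chart_inv c q)))) \<partial>lborel)"
proof -
  have "emeasure (chart_measure h c) (snd c ` X) = (\<integral>\<^sup>+q. ennreal (indicator (chart_image c) q *\<^sub>R
      vol_density h c (chart_inv c q)) * indicator (snd c ` X) q \<partial>lborel)"
    unfolding chart_measure_def using image_sets[OF c X] chart_density_measurable[OF h c]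
    by (subst emeasure_density) auto
  also have "\<dots> = (\<integral>\<^sup>+q\<in>snd c ` X. ennreal (sqrt (det (h c (chart_inv c q)))) \<partial>lborel)"
    using X(2) snd_in_image[OF c]
    by (intro nn_integral_cong) (auto simp: vol_density_def split: split_indicator)
  finally show ?thesis .
qed

text \<open>The change of variables along the transition map: its Jacobian determinant is exactly
  the quotient of the two densities.\<close>

lemma chart_measure_invariant:
  assumes h: "riemannian_metric A h" and c: "c \<in> A" "c' \<in> A"
    and X: "X \<in> sets MB" "X \<subseteq> fst c \<inter> fst c'"
  shows "emeasure (chart_measure h c) (snd c ` X) = emeasure (chart_measure h c') (snd c' ` X)"
proof -
  let ?S = "snd c ` X" and ?g = "snd c' \<circ> chart_inv c"
  let ?g' = "\<lambda>x v. trans_jac c c' (chart_inv c x) *v v"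
  let ?f = "\<lambda>q. vol_density h c' (chart_inv c' q)"
  have Xc: "X \<subseteq> fst c" "X \<subseteq> fst c'" using X(2) by auto
  have gS: "?g ` ?S = snd c' ` X" using Xc c by (force simp: image_iff)
  have H: "?S \<subseteq> half_space" using Xc image_subset[OF c(1)] by (auto simp: chart_image_def)
  have eq: "\<bar>det (matrix (?g' x))\<bar> * ?f (?g x) = vol_density h c (chart_inv c x)" if x: "x \<in> ?S" for x
  proof -
    obtain p where p: "p \<in> X" "x = snd c p" using x by blast
    have p': "p \<in> fst c \<inter> fst c'" using p X(2) by blast
    then show ?thesis
      using vol_density_trans[OF h c p'] det_trans_pos[OF c p'] c p by simp
  qed
  have ind: "indicator (snd c ` X) q *\<^sub>R vol_density h c (chart_inv c q) =
     indicator (snd c ` X) q *\<^sub>R (indicator (chart_image c) q *\<^sub>R vol_density h c (chart_inv c q))"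
    if "c \<in> A" "X \<subseteq> fst c" for c :: "('a, 'n) chart" and q
    using that snd_in_image[OF that(1)] by (auto split: split_indicator)
  have m: "(\<lambda>q. indicator (snd c ` X) q *\<^sub>R vol_density h c (chart_inv c q)) \<in> borel_measurable borel"
    if "c \<in> A" "X \<subseteq> fst c" for c :: "('a, 'n) chart"
    unfolding ind[OF that] using image_sets[OF that(1) X(1) that(2)] chart_density_measurable[OF h that(1)]
    by measurable
  have eqi: "indicator ?S x *\<^sub>R (\<bar>det (matrix (?g' x))\<bar> * ?f (?g x)) =
      indicator ?S x *\<^sub>R vol_density h c (chart_inv c x)" for x
    using eq[of x] by (auto split: split_indicator)
  have set: "emeasure (chart_measure h c) (snd c ` X) =
     (\<integral>\<^sup>+q. ennreal (indicator (snd c ` X) q *\<^sub>R vol_density h c (chart_inv c q)) \<partial>lborel)"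
    if "c \<in> A" "X \<subseteq> fst c" for c :: "('a, 'n) chart"
    unfolding chart_measure_image[OF h that(1) X(1) that(2)]
    by (intro nn_integral_cong) (auto simp: vol_density_def split: split_indicator)
  have "(\<integral>\<^sup>+x. ennreal (indicator ?S x *\<^sub>R (\<bar>det (matrix (?g' x))\<bar> * ?f (?g x))) \<partial>lborel) =
    (\<integral>\<^sup>+x. ennreal (indicator (?g ` ?S) x *\<^sub>R ?f x) \<partial>lborel)"
  proof (rule nn_integral_change_of_variables)
    show "?S \<in> sets borel" using image_sets[OF c(1) X(1) Xc(1)] .
    show "(?g has_derivative ?g' x) (at x within ?S)" if x: "x \<in> ?S" for x
    proof -
      obtain p where p: "p \<in> X" "x = snd c p" using x by blast
      then have "p \<in> fst c \<inter> fst c'" using X(2) by blast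
      from has_derivative_subset[OF trans_deriv[OF c this] H] show ?thesis
        using p Xc c by (auto simp: o_def)
    qed
    show "inj_on ?g ?S"
    proof (rule comp_inj_on)
      show "inj_on (chart_inv c) ?S" by (rule inj_on_inverseI[of _ "snd c"]) (use Xc c in auto)
      have "chart_inv c ` ?S \<subseteq> fst c'" using Xc c by (auto simp: subset_iff)
      then show "inj_on (snd c') (chart_inv c ` ?S)" using inj_chart[OF c(2)] inj_on_subset by blast
    qed
    show "(\<lambda>x. indicator (?g ` ?S) x *\<^sub>R ?f x) \<in> borel_measurable borel"
      unfolding gS by (rule m[OF c(2) Xc(2)])
    show "(\<lambda>x. indicator ?S x *\<^sub>R (\<bar>det (matrix (?g' x))\<bar> * ?f (?g x))) \<in> borel_measurable borel"
      unfolding eqi by (rule m[OF c(1) Xc(1)])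
    show "0 \<le> ?f x" if "x \<in> ?g ` ?S" for x
      using that vol_density_pos[OF h c(2)] Xc c unfolding gS by (force simp: less_imp_le)
  qed
  then show ?thesis unfolding eqi gS set[OF c(1) Xc(1)] set[OF c(2) Xc(2)] .
qed

text \<open>A finite subcover by chart domains, made disjoint. For measures such a Borel partition
  does the work of a partition of unity.\<close>

lemma finite_Borel_partition:
  obtains N :: nat and c :: "nat \<Rightarrow> ('a, 'n) chart" and B where
    "\<forall>i<N. c i \<in> A" "\<forall>i<N. B i \<in> sets MB" "\<forall>i<N. B i \<subseteq> fst (c i)"
    "disjoint_family B" "M = (\<Union>i<N. B i)"
proof -
  have "\<exists>D\<subseteq>fst ` A. finite D \<and> M \<subseteq> \<Union>D"
  proof -
    have "\<And>T. T \<in> fst ` A \<Longrightarrow> openin (top_of_set M) T" using chart_open by auto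
    moreover have "M \<subseteq> \<Union> (fst ` A)" using atlas by (auto simp: oriented_atlas_def)
    ultimately show ?thesis
      using compactM unfolding compact_eq_openin_cover by metis
  qed
  then obtain C where C: "C \<subseteq> A" "finite C" "M \<subseteq> (\<Union>c\<in>C. fst c)"
    by (metis finite_subset_image)
  obtain c where c: "C = c ` {..<card C}"
    using ex_bij_betw_nat_finite[OF C(2)] by (metis bij_betw_imp_surj_on lessThan_atLeast0)
  define F where "F i = (if i < card C then fst (c i) else {})" for i
  have cA: "c i \<in> A" if "i < card C" for i using c C(1) that by blast
  have "range F \<subseteq> sets MB" using cA chart_sets by (auto simp: F_def)
  then have s: "range (disjointed F) \<subseteq> sets MB" by (rule sets.range_disjointed_sets)
  have sub: "disjointed F i \<subseteq> fst (c i)" if "i < card C" for i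
    using that disjointed_subset[of F i] by (auto simp: F_def)
  have "M \<subseteq> (\<Union>i. F i)"
  proof
    fix p assume "p \<in> M"
    then obtain k where "k \<in> C" "p \<in> fst k" using C(3) by blast
    moreover from this obtain i where "i < card C" "k = c i" using c by auto
    ultimately show "p \<in> (\<Union>i. F i)" by (auto simp: F_def)
  qed
  moreover have "F i \<subseteq> M" for i using cA chart_subset by (auto simp: F_def)
  ultimately have "M = (\<Union>i. disjointed F i)"
    unfolding UN_disjointed_eq by blast
  moreover have "disjointed F i = {}" if "\<not> i < card C" for i
    using that disjointed_subset[of F i] by (auto simp: F_def)
  ultimately have "M = (\<Union>i<card C. disjointed F i)" by blast
  then show thesis
    using cA s sub disjoint_family_disjointed[of F] by (intro that[of "card C" c "disjointed F"]) auto
qed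

text \<open>On each piece of the partition the value is prescribed by the density in one chart, and
  the pieces add up.\<close>

lemma volume_measure_unique:
  assumes h: "riemannian_metric A h" and m: "is_volume_measure M A h \<mu>" "is_volume_measure M A h \<nu>"
  shows "\<mu> = \<nu>"
proof (rule measure_eqI)
  obtain N :: nat and c B where B: "\<forall>i<N. c i \<in> A" "\<forall>i<N. B i \<in> sets MB"
    "\<forall>i<N. B i \<subseteq> fst (c i)" "disjoint_family B" "M = (\<Union>i<N. B i)"
    by (rule finite_Borel_partition)
  show "sets \<mu> = sets \<nu>" using m by (simp add: is_volume_measure_def)
  fix X assume "X \<in> sets \<mu>"
  then have X: "X \<in> sets MB" using m by (simp add: is_volume_measure_def)
  then have XM: "X = (\<Union>i<N. X \<inter> B i)" using B(5) sets.sets_into_space[OF X, unfolded space_MB] by blast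
  have "emeasure \<rho> X = (\<Sum>i<N. emeasure (chart_measure h (c i)) (snd (c i) ` (X \<inter> B i)))"
    if r: "is_volume_measure M A h \<rho>" for \<rho>
  proof -
    have sr: "sets \<rho> = sets MB" using r by (simp add: is_volume_measure_def)
    have XB: "X \<inter> B i \<in> sets MB" if "i < N" for i using X B(2) that by blast
    have "emeasure \<rho> X = (\<Sum>i<N. emeasure \<rho> (X \<inter> B i))"
      using B(4) XB sr by (subst XM, subst sum_emeasure) (auto simp: disjoint_family_on_def)
    also have "\<dots> = (\<Sum>i<N. emeasure (chart_measure h (c i)) (snd (c i) ` (X \<inter> B i)))"
    proof (rule sum.cong[OF refl])
      fix i assume i: "i \<in> {..<N}"
      then have sub: "X \<inter> B i \<subseteq> fst (c i)" using B(3) by auto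
      show "emeasure \<rho> (X \<inter> B i) = emeasure (chart_measure h (c i)) (snd (c i) ` (X \<inter> B i))"
        using r i B(1) XB sub sr
        by (subst chart_measure_image[OF h _ _ sub]) (auto simp: is_volume_measure_def)
    qed
    finally show ?thesis .
  qed
  then show "emeasure \<mu> X = emeasure \<nu> X" using m by simp
qed

text \<open>The measure is glued from the pieces of a Borel partition, each measured in its own
  chart. That it has the right density in every chart of the atlas is the invariance of
  \<open>chart_measure\<close>.\<close>

lemma volume_measure_exists:
  assumes h: "riemannian_metric A h"
  shows "\<exists>\<mu>. is_volume_measure M A h \<mu>"
proof -
  obtain N :: nat and c B where B: "\<forall>i<N. c i \<in> A" "\<forall>i<N. B i \<in> sets MB"
    "\<forall>i<N. B i \<subseteq> fst (c i)" "disjoint_family B" "M = (\<Union>i<N. B i)"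
    by (rule finite_Borel_partition)
  define m where "m X = (\<Sum>i<N. emeasure (chart_measure h (c i)) (snd (c i) ` (X \<inter> B i)))" for X
  define \<mu> where "\<mu> = measure_of M (sets MB) m"
  have sets: "sets \<mu> = sets MB" "space \<mu> = M"
    using sets.sigma_sets_eq[of MB] sets.space_closed[of MB] unfolding \<mu>_def
    by (simp_all add: sets_measure_of space_measure_of)
  have scm: "sets (chart_measure h c) = sets borel" for c by (simp add: chart_measure_def)
  have ca: "countably_additive (sets MB) m"
  proof (rule countably_additiveI)
    fix X :: "nat \<Rightarrow> 'a set"
    assume X: "range X \<subseteq> sets MB" "disjoint_family X" "(\<Union>n. X n) \<in> sets MB"
    have "(\<Sum>n. m (X n)) = (\<Sum>i<N. \<Sum>n. emeasure (chart_measure h (c i)) (snd (c i) ` (X n \<inter> B i)))"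
      unfolding m_def by (rule suminf_sum) simp
    also have "\<dots> = m (\<Union>n. X n)"
      unfolding m_def
    proof (rule sum.cong[OF refl])
      fix i assume i: "i \<in> {..<N}"
      have "(\<Sum>n. emeasure (chart_measure h (c i)) (snd (c i) ` (X n \<inter> B i))) =
          emeasure (chart_measure h (c i)) (\<Union>n. snd (c i) ` (X n \<inter> B i))"
      proof (rule suminf_emeasure)
        have i': "c i \<in> A" "B i \<in> sets MB" "B i \<subseteq> fst (c i)" using B i by auto
        have "X n \<inter> B i \<in> sets MB" for n using X(1) i'(2) by (intro sets.Int) auto
        then show "range (\<lambda>n. snd (c i) ` (X n \<inter> B i)) \<subseteq> sets (chart_measure h (c i))"
          using image_sets[OF i'(1)] i'(3) scm by (auto simp: le_infI2)
        show "disjoint_family (\<lambda>n. snd (c i) ` (X n \<inter> B i))"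
          using X(2) inj_onD[OF inj_on_subset[OF inj_chart[OF i'(1)] i'(3)]]
          unfolding disjoint_family_on_def by fast
      qed
      also have "(\<Union>n. snd (c i) ` (X n \<inter> B i)) = snd (c i) ` ((\<Union>n. X n) \<inter> B i)" by auto
      finally show "(\<Sum>n. emeasure (chart_measure h (c i)) (snd (c i) ` (X n \<inter> B i))) =
          emeasure (chart_measure h (c i)) (snd (c i) ` ((\<Union>n. X n) \<inter> B i))" .
    qed
    finally show "(\<Sum>n. m (X n)) = m (\<Union>n. X n)" .
  qed
  have em: "emeasure \<mu> X = m X" if X: "X \<in> sets MB" for X
  proof (rule emeasure_measure_of[OF \<mu>_def])
    show "sets MB \<subseteq> Pow M" using sets.space_closed[of MB] by simp
    show "positive (sets \<mu>) m" by (simp add: positive_def m_def)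
    show "countably_additive (sets \<mu>) m" using ca sets by simp
    show "X \<in> sets \<mu>" using X sets by simp
  qed
  have "emeasure \<mu> X = (\<integral>\<^sup>+q\<in>snd k ` X. ennreal (sqrt (det (h k (chart_inv k q)))) \<partial>lborel)"
    if k: "k \<in> A" and X: "X \<in> sets \<mu>" "X \<subseteq> fst k" for k X
  proof -
    have X': "X \<in> sets MB" using X sets by simp
    have XB: "X \<inter> B i \<in> sets MB" if "i < N" for i using X' B(2) that by blast
    have "emeasure \<mu> X = (\<Sum>i<N. emeasure (chart_measure h (c i)) (snd (c i) ` (X \<inter> B i)))"
      using em[OF X'] by (simp add: m_def)
    \<comment> \<open>The piece in \<open>B i\<close> is moved from its own chart to the common
      chart \<open>k\<close>, where the pieces can be united again.\<close>
    also have "\<dots> = (\<Sum>i<N. emeasure (chart_measure h k) (snd k ` (X \<inter> B i)))"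
      using B(1,3) k X(2) XB by (intro sum.cong refl chart_measure_invariant[OF h]) auto
    also have "\<dots> = emeasure (chart_measure h k) (\<Union>i<N. snd k ` (X \<inter> B i))"
    proof (rule sum_emeasure)
      show "(\<lambda>i. snd k ` (X \<inter> B i)) ` {..<N} \<subseteq> sets (chart_measure h k)"
        using image_sets[OF k XB] X(2) scm by auto
      show "disjoint_family_on (\<lambda>i. snd k ` (X \<inter> B i)) {..<N}"
        using B(4) inj_onD[OF inj_on_subset[OF inj_chart[OF k] X(2)]]
        unfolding disjoint_family_on_def by fast
    qed simp
    also have "(\<Union>i<N. snd k ` (X \<inter> B i)) = snd k ` X"
      using B(5) sets.sets_into_space[OF X', unfolded space_MB] by blast
    finally show ?thesis using chart_measure_image[OF h k X' X(2)] by simp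
  qed
  then have "is_volume_measure M A h \<mu>" using sets by (auto simp: is_volume_measure_def)
  then show ?thesis ..
qed

lemma volume_measure_eqI:
  assumes "riemannian_metric A h" "is_volume_measure M A h \<mu>"
  shows "volume_measure M A h = \<mu>"
  unfolding volume_measure_def using assms volume_measure_unique by (intro the_equality) auto

lemma is_volume_measure:
  assumes "riemannian_metric A h" shows "is_volume_measure M A h (volume_measure M A h)"
  using volume_measure_exists[OF assms] volume_measure_eqI[OF assms] by metis

end

section \<open>Bump functions and finite volume\<close>

definition C1_fun :: "('a, 'n::finite) chart set \<Rightarrow> ('a \<Rightarrow> real) \<Rightarrow> bool" where
  "C1_fun A f \<longleftrightarrow> (\<forall>c\<in>A. C1_on (chart_image c) (\<lambda>q. f (chart_inv c q)))"

lemma C1_fun_mult: "C1_fun A f \<Longrightarrow> C1_fun A h \<Longrightarrow> C1_fun A (\<lambda>x. f x * h x)"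
  and C1_fun_sum: "(\<And>i. i \<in> I \<Longrightarrow> C1_fun A (k i)) \<Longrightarrow> C1_fun A (\<lambda>x. \<Sum>i\<in>I. k i x)"
  unfolding C1_fun_def by (auto intro: C1_on_mult C1_on_sum)

lemma smooth_fun_C1: "smooth_fun A f \<Longrightarrow> C1_fun A f"
  unfolding smooth_fun_def C1_fun_def o_def by (auto intro: smooth_on_imp_C1_on)

text \<open>Squaring removes the corner of the positive part: at the origin the difference quotient
  is bounded by the absolute value of the increment.\<close>

lemma has_derivative_max_square: "((\<lambda>x. (max 0 x)\<^sup>2) has_real_derivative 2 * max 0 s) (at s)"
proof -
  consider "s > 0" | "s < 0" | "s = 0" by linarith
  then show ?thesis
  proof cases
    case 1
    have "((\<lambda>x. x\<^sup>2) has_real_derivative 2 * max 0 s) (at s)"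
      using 1 by (auto intro!: derivative_eq_intros)
    then show ?thesis
      by (rule has_field_derivative_transform_within_open[of _ _ _ "{0<..}"]) (use 1 in auto)
  next
    case 2
    have "((\<lambda>x. 0) has_real_derivative 2 * max 0 s) (at s)" using 2 by auto
    then show ?thesis
      by (rule has_field_derivative_transform_within_open[of _ _ _ "{..<0}"]) (use 2 in auto)
  next
    case 3
    have "((\<lambda>y. ((max 0 y)\<^sup>2 - (max 0 0)\<^sup>2) / (y - 0)) \<longlongrightarrow> (0::real)) (at 0)"
    proof (rule Lim_null_comparison)
      show "\<forall>\<^sub>F y in at 0. norm (((max 0 y)\<^sup>2 - (max 0 0)\<^sup>2) / (y - 0)) \<le> \<bar>y\<bar>"
        by (intro always_eventually) (auto simp: max_def power2_eq_square)
      show "((\<lambda>y. \<bar>y\<bar>) \<longlongrightarrow> (0::real)) (at 0)" by (auto intro!: tendsto_eq_intros)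
    qed
    then show ?thesis using 3 by (simp add: has_field_derivative_iff)
  qed
qed

text \<open>One derivative is enough for a test function, so a squared positive part of a quadratic
  polynomial takes the place of a smooth cut-off.\<close>

definition bump :: "real^'n::finite \<Rightarrow> real \<Rightarrow> real^'n \<Rightarrow> real" where
  "bump a r q = (max 0 (r\<^sup>2 - (norm (q - a))\<^sup>2))\<^sup>2"

lemma bump_C1: "C1_on UNIV (bump a r)"
  unfolding bump_def
proof (rule C1_on_compose[of UNIV _ UNIV "\<lambda>x. (max 0 x)\<^sup>2"])
  show "C1_on UNIV (\<lambda>x. (max 0 x :: real)\<^sup>2)"
    by (rule C1_on_real_fun[OF _ has_derivative_max_square]) (auto intro!: continuous_intros)
  have "C1_on UNIV (\<lambda>q. r\<^sup>2 - (\<Sum>i\<in>UNIV. (q $ i - a $ i) * (q $ i - a $ i)))"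
    by (intro C1_on_diff C1_on_sum C1_on_mult C1_on_const C1_on_bounded_linear bounded_linear_vec_nth)
  then show "C1_on UNIV (\<lambda>q. r\<^sup>2 - (norm (q - a))\<^sup>2)"
    by (simp add: power2_norm_eq_inner inner_vec_def)
qed simp

lemma bump_nonneg: "0 \<le> bump a r q" by (simp add: bump_def)

lemma bump_pos: "q \<in> ball a r \<Longrightarrow> 0 < bump a r q"
  using power_strict_mono[of "norm (q - a)" r 2] by (auto simp: bump_def dist_norm norm_minus_commute)

lemma bump_zero: "0 < r \<Longrightarrow> q \<notin> cball a r \<Longrightarrow> bump a r q = 0"
  by (auto simp: bump_def dist_norm norm_minus_commute not_le max_def power_mono)

context compact_mfd
begin

lemma openin_inv_image:
  assumes c: "c \<in> A" and V: "openin (top_of_set half_space) V" "V \<subseteq> chart_image c"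
  shows "openin (top_of_set M) (chart_inv c ` V)"
proof -
  have "openin (top_of_set (chart_image c)) V"
    using V image_subset[OF c] openin_subset_trans by blast
  then have "openin (top_of_set (fst c)) (chart_inv c ` V)"
    using homeomorphism_imp_open_map[OF homeomorphism_symD[OF chart_homeo[OF c]]] by blast
  then show ?thesis using chart_open[OF c] openin_trans by blast
qed

lemma continuous_on_extend:
  fixes f :: "'a \<Rightarrow> real"
  assumes c: "c \<in> A" and f: "continuous_on (chart_image c) (\<lambda>q. f (chart_inv c q))"
    and K: "compact K" "K \<subseteq> fst c" and z: "\<And>p. p \<in> M \<Longrightarrow> p \<notin> K \<Longrightarrow> f p = 0"
  shows "continuous_on M f"
  unfolding continuous_on_eq_continuous_within
proof
  fix p assume p: "p \<in> M"
  show "continuous (at p within M) f"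
  proof (cases "p \<in> fst c")
    case True
    have "continuous_on (fst c) f"
    proof (rule continuous_on_eq)
      show "continuous_on (fst c) (\<lambda>p. f (chart_inv c (snd c p)))"
        by (rule continuous_on_compose2[OF f cont_chart[OF c]]) (use c in auto)
    qed (use c in auto)
    then have "continuous (at p within fst c) f"
      using True by (simp add: continuous_on_eq_continuous_within)
    then show ?thesis by (simp only: at_within_openin_eq[OF chart_open[OF c] True])
  next
    case False
    have "closed K" using K(1) by (rule compact_imp_closed)
    then have o: "openin (top_of_set M) (M \<inter> - K)" by (intro openin_open_Int) auto
    have "continuous_on (M \<inter> - K) f"
      by (rule continuous_on_eq[OF continuous_on_const[of _ 0]]) (use z in auto)
    moreover have "p \<in> M \<inter> - K" using p False K by auto
    ultimately show ?thesis
      using at_within_openin_eq[OF o] by (metis continuous_on_eq_continuous_within)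
  qed
qed

text \<open>A bump on a small ball around the coordinate point, cut by the half-space and carried
  back by the chart. Its support \<open>K\<close> is compact, hence closed in the Hausdorff space,
  so the extension by zero is regular in every other chart as well.\<close>

lemma manifold_bump:
  assumes c: "c \<in> A" and p: "p \<in> U" "U \<subseteq> fst c" and U: "openin (top_of_set M) U"
  obtains \<psi> K W where "C1_fun A \<psi>" "compact K" "K \<subseteq> U" "\<forall>x\<in>M. x \<notin> K \<longrightarrow> \<psi> x = 0" "\<forall>x. 0 \<le> \<psi> x"
    "openin (top_of_set M) W" "p \<in> W" "W \<subseteq> K" "\<forall>x\<in>W. 0 < \<psi> x" "compact (snd c ` K)"
proof -
  have "openin (top_of_set half_space) (snd c ` U)" using openin_image[OF c U p(2)] .
  moreover have "snd c p \<in> snd c ` U" using p by blast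
  ultimately obtain r where r: "r > 0" "cball (snd c p) r \<inter> half_space \<subseteq> snd c ` U"
    unfolding openin_contains_cball by blast
  let ?a = "snd c p"
  let ?B = "cball ?a r \<inter> half_space" and ?D = "ball ?a r \<inter> half_space"
  have BS: "?B \<subseteq> chart_image c" using r(2) p(2) by (auto simp: chart_image_def)
  have DB: "?D \<subseteq> ?B" by auto
  have aH: "?a \<in> half_space" using p image_subset[OF c] snd_in_image[OF c] by blast
  have cB: "compact ?B" by (rule compact_Int_closed[OF compact_cball closed_half_space])
  define K where "K = chart_inv c ` ?B"
  define W where "W = chart_inv c ` ?D"
  define \<psi> where "\<psi> x = (if x \<in> fst c then bump ?a r (snd c x) else 0)" for x
  have K: "compact K" unfolding K_def
    by (rule compact_continuous_image[OF continuous_on_subset[OF cont_chart_inv[OF c] BS] cB])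
  have KU: "K \<subseteq> U"
  proof
    fix x assume "x \<in> K"
    then obtain q where q: "x = chart_inv c q" "q \<in> ?B" by (auto simp: K_def)
    then obtain y where "y \<in> U" "q = snd c y" using r(2) by blast
    then show "x \<in> U" using q p(2) c by auto
  qed
  have sK: "snd c ` K = ?B"
    unfolding K_def image_image using BS c by (simp add: subset_iff cong: image_cong_simp)
  have inK: "x \<in> K \<longleftrightarrow> snd c x \<in> cball ?a r" if "x \<in> fst c" for x
  proof
    assume "x \<in> K" then show "snd c x \<in> cball ?a r" using sK by blast
  next
    assume "snd c x \<in> cball ?a r"
    then have "snd c x \<in> ?B" using that image_subset[OF c] snd_in_image[OF c] by blast
    then have "chart_inv c (snd c x) \<in> K" unfolding K_def by (rule imageI)
    then show "x \<in> K" using that c by simp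
  qed
  have z: "\<psi> x = 0" if "x \<notin> K" for x
    using that inK r(1) bump_zero by (auto simp: \<psi>_def)
  have W: "openin (top_of_set M) W" unfolding W_def
    by (rule openin_inv_image[OF c]) (use BS DB in \<open>auto simp: openin_open\<close>)
  have pW: "p \<in> W" unfolding W_def using p c aH r(1) by (intro image_eqI[of _ _ ?a]) auto
  have WK: "W \<subseteq> K" unfolding W_def K_def using DB by blast
  have pos: "0 < \<psi> x" if "x \<in> W" for x
  proof -
    obtain q where q: "x = chart_inv c q" "q \<in> ?D" using \<open>x \<in> W\<close> by (auto simp: W_def)
    then have "q \<in> chart_image c" using BS DB by blast
    then show ?thesis using q c bump_pos by (auto simp: \<psi>_def)
  qed
  have "C1_on (chart_image c') (\<lambda>q. \<psi> (chart_inv c' q))" if c': "c' \<in> A" for c'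
  proof (rule C1_on_local)
    fix q assume q: "q \<in> chart_image c'"
    show "\<exists>V. open V \<and> q \<in> V \<and> C1_on (V \<inter> chart_image c') (\<lambda>q. \<psi> (chart_inv c' q))"
    proof (cases "chart_inv c' q \<in> fst c")
      case True
      let ?O = "snd c' ` (fst c' \<inter> fst c)"
      have "C1_on ?O (\<lambda>q. bump ?a r ((snd c \<circ> chart_inv c') q))"
        by (rule C1_on_compose[OF trans_C1[OF c' c] bump_C1]) auto
      then have C: "C1_on ?O (\<lambda>q. \<psi> (chart_inv c' q))"
        by (rule C1_on_cong) (use c' in \<open>auto simp: \<psi>_def\<close>)
      obtain T where T: "open T" "?O = half_space \<inter> T"
        using overlap_open[OF c' c] by (auto simp: openin_open)
      have "q \<in> ?O" using True q c' by (intro image_eqI[of _ _ "chart_inv c' q"]) auto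
      moreover have "T \<inter> chart_image c' \<subseteq> ?O" using T(2) image_subset[OF c'] by blast
      ultimately show ?thesis using T C1_on_subset[OF C] by blast
    next
      case False
      \<comment> \<open>A point outside the domain of \<open>c\<close> has a neighbourhood that
        avoids \<open>K\<close>, and there the bump is zero.\<close>
      let ?O = "snd c' ` (fst c' \<inter> - K)"
      have "openin (top_of_set M) (M \<inter> - K)"
        using compact_imp_closed[OF K] by (intro openin_open_Int) auto
      then have "openin (top_of_set M) (fst c' \<inter> (M \<inter> - K))"
        by (rule openin_Int[OF chart_open[OF c']])
      moreover have "fst c' \<inter> (M \<inter> - K) = fst c' \<inter> - K" using chart_subset[OF c'] by blast
      ultimately have "openin (top_of_set half_space) ?O" by (intro openin_image[OF c']) auto
      then obtain T where T: "open T" "?O = half_space \<inter> T" by (auto simp: openin_open)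
      have "q \<in> ?O" using False KU p(2) q c' by (intro image_eqI[of _ _ "chart_inv c' q"]) auto
      moreover have sub: "T \<inter> chart_image c' \<subseteq> ?O" using T(2) image_subset[OF c'] by blast
      have "C1_on (T \<inter> chart_image c') (\<lambda>q. \<psi> (chart_inv c' q))"
        by (rule C1_on_cong[OF C1_on_const[of _ 0]]) (use sub c' z in fastforce)
      ultimately show ?thesis using T by blast
    qed
  qed
  then have "C1_fun A \<psi>" by (auto simp: C1_fun_def)
  then show thesis
    using K KU z W pW WK pos sK cB
    by (intro that[of \<psi> K W]) (auto simp: \<psi>_def bump_nonneg)
qed

lemma vol_space_sets [simp]:
  assumes "riemannian_metric A h"
  shows "space (volume_measure M A h) = M" "sets (volume_measure M A h) = sets MB"
  using is_volume_measure[OF assms] by (auto simp: is_volume_measure_def)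

lemma vol_emeasure:
  assumes "riemannian_metric A h" "c \<in> A" "X \<in> sets MB" "X \<subseteq> fst c"
  shows "emeasure (volume_measure M A h) X = emeasure (chart_measure h c) (snd c ` X)"
  using is_volume_measure[OF assms(1)] assms
  by (simp add: chart_measure_image is_volume_measure_def)

lemma chart_measure_finite:
  assumes h: "riemannian_metric A h" and c: "c \<in> A" and K: "compact K" "K \<subseteq> chart_image c"
  shows "emeasure (chart_measure h c) K < \<infinity>"
proof -
  have "continuous_on K (\<lambda>q. vol_density h c (chart_inv c q))"
    using C1_on_imp_continuous_on[OF vol_density_C1[OF h c]] K(2) continuous_on_subset by blast
  then have "bounded ((\<lambda>q. vol_density h c (chart_inv c q)) ` K)"
    by (intro compact_imp_bounded compact_continuous_image K)
  then obtain C where C: "\<And>q. q \<in> K \<Longrightarrow> \<bar>vol_density h c (chart_inv c q)\<bar> \<le> C"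
    unfolding bounded_iff by auto
  have Kb: "K \<in> sets borel" using K(1) compact_imp_closed borel_closed by blast
  have "emeasure (chart_measure h c) K = (\<integral>\<^sup>+q. ennreal (indicator (chart_image c) q *\<^sub>R
      vol_density h c (chart_inv c q)) * indicator K q \<partial>lborel)"
    unfolding chart_measure_def using Kb chart_density_measurable[OF h c]
    by (subst emeasure_density) auto
  also have "\<dots> \<le> (\<integral>\<^sup>+q. ennreal C * indicator K q \<partial>lborel)"
    using C by (intro nn_integral_mono) (force split: split_indicator intro!: ennreal_leI)
  also have "\<dots> = ennreal C * emeasure lborel K" using Kb by (simp add: nn_integral_cmult_indicator)
  also have "\<dots> < \<infinity>"
    using emeasure_lborel_cbox_finite emeasure_bounded_finite[OF compact_imp_bounded[OF K(1)]]
    by (simp add: ennreal_mult_less_top)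
  finally show ?thesis .
qed

text \<open>A partition of unity before normalisation: the sum is merely positive, and the division
  takes place where a test function is localised. The sets \<open>K x\<close> and their coordinate
  images are compact so that bounds found chart by chart add up to bounds on
  \<open>M\<close>.\<close>

definition bump_cover :: "'a set \<Rightarrow> ('a \<Rightarrow> 'a \<Rightarrow> real) \<Rightarrow> ('a \<Rightarrow> 'a set) \<Rightarrow> bool" where
  "bump_cover I \<psi> K \<longleftrightarrow> finite I \<and> I \<subseteq> M \<and> M = (\<Union>x\<in>I. K x) \<and>
    (\<forall>y\<in>M. 0 < (\<Sum>x\<in>I. \<psi> x y)) \<and>
    (\<forall>x\<in>I. C1_fun A (\<psi> x) \<and> compact (K x) \<and> K x \<subseteq> fst (chart_at A x) \<and>
      (\<forall>y\<in>M. y \<notin> K x \<longrightarrow> \<psi> x y = 0) \<and> compact (snd (chart_at A x) ` K x))"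

lemma bump_coverD:
  assumes "bump_cover I \<psi> K"
  shows "finite I" "I \<subseteq> M" "\<forall>x\<in>I. C1_fun A (\<psi> x)" "\<forall>x\<in>I. compact (K x)"
    "\<forall>x\<in>I. K x \<subseteq> fst (chart_at A x)" "\<forall>x\<in>I. \<forall>y\<in>M. y \<notin> K x \<longrightarrow> \<psi> x y = 0"
    "M = (\<Union>x\<in>I. K x)" "\<forall>y\<in>M. 0 < (\<Sum>x\<in>I. \<psi> x y)" "\<forall>x\<in>I. compact (snd (chart_at A x) ` K x)"
  using assms unfolding bump_cover_def ball_conj_distrib by - (elim conjE, assumption)+

lemma finite_bump_cover:
  obtains I \<psi> K where "bump_cover I \<psi> K"
proof -
  have "\<forall>x\<in>M. \<exists>\<psi> K W. C1_fun A \<psi> \<and> compact K \<and> K \<subseteq> fst (chart_at A x) \<and> (\<forall>y\<in>M. y \<notin> K \<longrightarrow> \<psi> y = 0) \<and>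
      (\<forall>y. 0 \<le> \<psi> y) \<and> openin (top_of_set M) W \<and> x \<in> W \<and> W \<subseteq> K \<and> (\<forall>y\<in>W. 0 < \<psi> y) \<and>
      compact (snd (chart_at A x) ` K)"
  proof
    fix x assume x: "x \<in> M"
    show "\<exists>\<psi> K W. C1_fun A \<psi> \<and> compact K \<and> K \<subseteq> fst (chart_at A x) \<and> (\<forall>y\<in>M. y \<notin> K \<longrightarrow> \<psi> y = 0) \<and>
      (\<forall>y. 0 \<le> \<psi> y) \<and> openin (top_of_set M) W \<and> x \<in> W \<and> W \<subseteq> K \<and> (\<forall>y\<in>W. 0 < \<psi> y) \<and>
      compact (snd (chart_at A x) ` K)"
      by (rule manifold_bump[OF chart_atI(1)[OF x] chart_atI(2)[OF x] subset_refl chart_open[OF chart_atI(1)[OF x]]])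
         blast
  qed
  then obtain \<psi> K W where *: "\<forall>x\<in>M. C1_fun A (\<psi> x) \<and> compact (K x) \<and> K x \<subseteq> fst (chart_at A x) \<and>
      (\<forall>y\<in>M. y \<notin> K x \<longrightarrow> \<psi> x y = 0) \<and> (\<forall>y. 0 \<le> \<psi> x y) \<and> openin (top_of_set M) (W x) \<and> x \<in> W x \<and>
      W x \<subseteq> K x \<and> (\<forall>y\<in>W x. 0 < \<psi> x y) \<and> compact (snd (chart_at A x) ` K x)"
    by metis
  have "\<exists>D\<subseteq>W ` M. finite D \<and> M \<subseteq> \<Union>D"
  proof -
    have "\<And>T. T \<in> W ` M \<Longrightarrow> openin (top_of_set M) T" "M \<subseteq> \<Union> (W ` M)" using * by auto
    then show ?thesis using compactM unfolding compact_eq_openin_cover by metis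
  qed
  then obtain I where I: "I \<subseteq> M" "finite I" "M \<subseteq> (\<Union>x\<in>I. W x)"
    by (metis finite_subset_image)
  have nn: "0 \<le> \<psi> x y" and KM: "K x \<subseteq> M" and WK: "W x \<subseteq> K x" if "x \<in> I" for x y
    using * I(1) that chart_subset[OF chart_atI(1), of x] by (auto simp: subset_iff)
  have "0 < (\<Sum>x\<in>I. \<psi> x y)" if y: "y \<in> M" for y
  proof -
    obtain x where x: "x \<in> I" "y \<in> W x" using I(3) y by blast
    then have "0 < \<psi> x y" using * I(1) by auto
    then show ?thesis by (rule sum_pos2[OF I(2) x(1)]) (rule nn)
  qed
  moreover have "M = (\<Union>x\<in>I. K x)"
  proof
    show "M \<subseteq> (\<Union>x\<in>I. K x)" using I(3) WK by blast
    show "(\<Union>x\<in>I. K x) \<subseteq> M" using KM by blast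
  qed
  moreover have "\<forall>x\<in>I. C1_fun A (\<psi> x) \<and> compact (K x) \<and> K x \<subseteq> fst (chart_at A x) \<and>
      (\<forall>y\<in>M. y \<notin> K x \<longrightarrow> \<psi> x y = 0) \<and> compact (snd (chart_at A x) ` K x)"
    using * I(1) by auto
  ultimately have "bump_cover I \<psi> K" unfolding bump_cover_def using I(1,2) by blast
  then show thesis by (rule that)
qed

text \<open>Finitely many of the compact sets of a bump cover exhaust \<open>M\<close>, and in
  coordinates the density is bounded on each of them.\<close>

lemma finite_volume:
  assumes h: "riemannian_metric A h"
  shows "finite_measure (volume_measure M A h)"
proof
  obtain I \<psi> K where "bump_cover I \<psi> K" by (rule finite_bump_cover)
  note I = bump_coverD[OF this]
  let ?\<mu> = "volume_measure M A h"
  have KM: "K x \<in> sets MB" if "x \<in> I" for x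
  proof -
    have "K x \<subseteq> M" using I(7) that by blast
    moreover have "K x \<in> sets borel" using I(4) that compact_imp_closed borel_closed by blast
    ultimately show ?thesis using closedM by (simp add: sets_restrict_space_iff borel_closed)
  qed
  have fin: "emeasure ?\<mu> (K x) < \<infinity>" if "x \<in> I" for x
  proof -
    have x: "chart_at A x \<in> A" using chart_atI I(2) that by blast
    have "snd (chart_at A x) ` K x \<subseteq> chart_image (chart_at A x)"
      using I(5) that by (auto simp: chart_image_def)
    then show ?thesis
      using vol_emeasure[OF h x KM[OF that]] chart_measure_finite[OF h x] I(5,9) that by simp
  qed
  have "emeasure ?\<mu> M \<le> (\<Sum>x\<in>I. emeasure ?\<mu> (K x))"
    using emeasure_subadditive_finite[of I K ?\<mu>] KM I(1) vol_space_sets(2)[OF h]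
    by (auto simp flip: I(7))
  also have "\<dots> < \<infinity>" using fin I(1) by (simp add: ennreal_sum_less_top)
  finally show "emeasure ?\<mu> (space ?\<mu>) \<noteq> \<infinity>" using h by simp
qed

lemma integrable_vol:
  assumes h: "riemannian_metric A h" and f: "f \<in> borel_measurable MB" and b: "\<And>p. p \<in> M \<Longrightarrow> \<bar>f p\<bar> \<le> C"
  shows "integrable (volume_measure M A h) (f :: 'a \<Rightarrow> real)"
proof -
  interpret finite_measure "volume_measure M A h" using finite_volume[OF h] .
  show ?thesis
    by (rule integrable_const_bound[of _ C])
       (use f b h in \<open>auto simp: measurable_cong_sets[OF vol_space_sets(2)[OF h] refl]\<close>)
qed

lemma integrable_vol_continuous:
  assumes h: "riemannian_metric A h" and f: "continuous_on M (f :: 'a \<Rightarrow> real)"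
  shows "integrable (volume_measure M A h) f"
proof -
  have "bounded (f ` M)" by (intro compact_imp_bounded compact_continuous_image f compactM)
  then obtain C where "\<And>p. p \<in> M \<Longrightarrow> \<bar>f p\<bar> \<le> C" unfolding bounded_iff by auto
  then show ?thesis using continuous_on_M_measurable[OF f] integrable_vol[OF h] by blast
qed

end

section \<open>Green's formula and the weak form of the eigenvalue equation\<close>

text \<open>The coordinate formula with the chart kept as an argument; \<open>laplacian\<close> is
  its value in the chosen chart at each point.\<close>

definition chart_laplacian :: "('a, 'n::finite) tensor2 \<Rightarrow> ('a \<Rightarrow> real) \<Rightarrow> ('a, 'n) chart \<Rightarrow> 'a \<Rightarrow> real" where
  "chart_laplacian h u c p =
    (\<Sum>i\<in>UNIV. partial i (\<lambda>q. vol_density h c (chart_inv c q) * gradient h u c (chart_inv c q) $ i) (snd c p))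
      / vol_density h c p"

lemma laplacian_chart_at: "laplacian A h u p = chart_laplacian h u (chart_at A p) p"
  by (simp add: laplacian_def divergence_def chart_laplacian_def vol_density_def Let_def)

lemma integrable_compact_support:
  fixes f :: "real^'n::finite \<Rightarrow> real"
  assumes "continuous_on H f" "compact K" "K \<subseteq> H" "\<And>q. q \<in> H \<Longrightarrow> q \<notin> K \<Longrightarrow> f q = 0"
  shows "integrable lborel (\<lambda>q. indicator H q * f q)"
proof -
  have "integrable lborel (\<lambda>q. indicator K q *\<^sub>R f q)"
    using assms by (intro borel_integrable_compact) (auto intro: continuous_on_subset)
  also have "(\<lambda>q. indicator K q *\<^sub>R f q) = (\<lambda>q. indicator H q * f q)"
    by (rule ext) (use assms(3,4) in \<open>auto simp: indicator_def\<close>)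
  finally show ?thesis .
qed

context compact_mfd
begin

lemma chart_inv_measurable_lborel:
  assumes "c \<in> A" shows "chart_inv c \<in> restrict_space lborel (chart_image c) \<rightarrow>\<^sub>M MB"
  using chart_inv_measurable[OF assms] by (simp cong: measurable_cong_sets add: sets_restrict_space)

lemma vol_density_measurable:
  assumes "riemannian_metric A h" "c \<in> A"
  shows "(\<lambda>q. vol_density h c (chart_inv c q)) \<in> borel_measurable (restrict_space lborel (chart_image c))"
  using borel_measurable_continuous_on_restrict[OF C1_on_imp_continuous_on[OF vol_density_C1[OF assms]]]
  by (simp cong: measurable_cong_sets add: sets_restrict_space)

text \<open>The volume restricted to a chart domain is the image of a weighted Lebesgue measure
  under the inverse chart. This turns integrals over the domain into integrals over the
  half-space.\<close>

lemma vol_density_eq_distr: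
  assumes h: "riemannian_metric A h" and c: "c \<in> A"
  shows "density (volume_measure M A h) (\<lambda>p. ennreal (indicator (fst c) p)) =
    distr (density (restrict_space lborel (chart_image c)) (\<lambda>q. ennreal (vol_density h c (chart_inv c q)))) MB (chart_inv c)"
    (is "?D = distr ?E MB _")
proof (rule measure_eqI)
  let ?R = "restrict_space lborel (chart_image c) :: (real^'n) measure"
  have S: "chart_image c \<in> sets lborel" using image_borel[OF c] by simp
  note cinv = chart_inv_measurable_lborel[OF c] and dm = vol_density_measurable[OF h c]
  have fm: "fst c \<in> sets (volume_measure M A h)" using chart_sets[OF c] h by simp
  show "sets ?D = sets (distr ?E MB (chart_inv c))" using h by simp
  fix X assume "X \<in> sets ?D"
  then have X: "X \<in> sets MB" using h by simp
  have XF: "X \<inter> fst c \<in> sets MB" using X chart_sets[OF c] by blast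
  have im: "snd c ` (X \<inter> fst c) = chart_inv c -` X \<inter> chart_image c"
    using image_vimage[OF c, of "X \<inter> fst c"] chart_inv_in[OF c] by auto
  have "emeasure ?D X = emeasure (volume_measure M A h) (X \<inter> fst c)"
    using X fm h borel_measurable_indicator[OF fm, where 'b=ennreal]
    by (subst emeasure_density) (auto simp: nn_integral_cmult_indicator ennreal_indicator
        indicator_inter_arith[symmetric] Int_commute simp flip: indicator_inter_arith)
  also have "\<dots> = emeasure (chart_measure h c) (snd c ` (X \<inter> fst c))"
    by (rule vol_emeasure[OF h c XF]) simp
  also have "\<dots> = (\<integral>\<^sup>+q. ennreal (vol_density h c (chart_inv c q)) * indicator (snd c ` (X \<inter> fst c)) q \<partial>lborel)"
    by (simp add: chart_measure_image[OF h c XF] vol_density_def)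
  also have "\<dots> = (\<integral>\<^sup>+q. ennreal (vol_density h c (chart_inv c q)) * indicator (chart_inv c -` X \<inter> chart_image c) q \<partial>?R)"
    using S unfolding im by (subst nn_integral_restrict_space) (auto intro!: nn_integral_cong split: split_indicator)
  also have "\<dots> = emeasure ?E (chart_inv c -` X \<inter> chart_image c)"
    using dm measurable_sets[OF cinv X] by (subst emeasure_density) (auto simp: space_restrict_space)
  also have "\<dots> = emeasure (distr ?E MB (chart_inv c)) X"
    using cinv X by (subst emeasure_distr) (auto simp: space_restrict_space)
  finally show "emeasure ?D X = emeasure (distr ?E MB (chart_inv c)) X" .
qed

lemma vol_chart_integral:
  assumes h: "riemannian_metric A h" and c: "c \<in> A"
    and f: "f \<in> borel_measurable MB" and z: "\<And>p. p \<in> M \<Longrightarrow> p \<notin> fst c \<Longrightarrow> f p = 0"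
  shows "(\<integral>p. f p \<partial>volume_measure M A h) =
    (\<integral>q. indicator (chart_image c) q * (vol_density h c (chart_inv c q) * f (chart_inv c q)) \<partial>lborel)"
proof -
  let ?R = "restrict_space lborel (chart_image c) :: (real^'n) measure"
  have S: "chart_image c \<in> sets lborel" using image_borel[OF c] by simp
  note cinv = chart_inv_measurable_lborel[OF c] and dm = vol_density_measurable[OF h c]
  have fm: "f \<in> borel_measurable (volume_measure M A h)"
    using f by (simp add: measurable_cong_sets[OF vol_space_sets(2)[OF h] refl])
  have "(\<integral>p. f p \<partial>volume_measure M A h) = (\<integral>p. indicator (fst c) p *\<^sub>R f p \<partial>volume_measure M A h)"
    using z h by (intro Bochner_Integration.integral_cong) (auto split: split_indicator)
  also have "\<dots> = (\<integral>p. f p \<partial>density (volume_measure M A h) (\<lambda>p. ennreal (indicator (fst c) p)))"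
    using fm borel_measurable_indicator[of "fst c" "volume_measure M A h"] chart_sets[OF c] h
    by (subst integral_density) auto
  also have "\<dots> = (\<integral>q. f (chart_inv c q) \<partial>density ?R (\<lambda>q. ennreal (vol_density h c (chart_inv c q))))"
    unfolding vol_density_eq_distr[OF h c] using cinv f by (subst integral_distr) auto
  also have "\<dots> = (\<integral>q. vol_density h c (chart_inv c q) *\<^sub>R f (chart_inv c q) \<partial>?R)"
    using dm measurable_compose[OF cinv f] vol_density_pos[OF h c] c
    by (subst integral_density) (auto intro!: AE_I2 simp: space_restrict_space less_imp_le)
  also have "\<dots> = (\<integral>q. indicator (chart_image c) q * (vol_density h c (chart_inv c q) * f (chart_inv c q)) \<partial>lborel)"
    using S by (subst integral_restrict_space) auto
  finally show ?thesis .
qed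

lemma partial_u_C1:
  assumes "smooth_fun A u" "c \<in> A"
  shows "C1_on (chart_image c) (partial l (u \<circ> chart_inv c))"
  using assms by (intro smooth_on_imp_C1_on smooth_on_partial image_open) (auto simp: smooth_fun_def)

lemma gradient_C1:
  assumes h: "riemannian_metric A h" and u: "smooth_fun A u" and c: "c \<in> A"
  shows "C1_on (chart_image c) (\<lambda>q. gradient h u c (chart_inv c q) $ k)"
proof (rule C1_on_cong)
  show "C1_on (chart_image c) (\<lambda>q. \<Sum>l\<in>UNIV. matrix_inv (h c (chart_inv c q)) $ k $ l * partial l (u \<circ> chart_inv c) q)"
    by (intro C1_on_sum C1_on_mult matrix_inv_C1 partial_u_C1 h u c)
qed (use c in \<open>simp add: gradient_def matrix_vector_mult_def differential_def\<close>)

lemma flux_C1: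
  assumes h: "riemannian_metric A h" and u: "smooth_fun A u" and c: "c \<in> A"
  shows "C1_on (chart_image c) (\<lambda>q. vol_density h c (chart_inv c q) * gradient h u c (chart_inv c q) $ k)"
  by (intro C1_on_mult vol_density_C1 gradient_C1 h u c)

lemma differential_continuous:
  assumes v: "C1_fun A v" and c: "c \<in> A"
  shows "continuous_on (chart_image c) (\<lambda>q. differential v c (chart_inv c q) $ k)"
proof (rule continuous_on_eq)
  show "continuous_on (chart_image c) (partial k (v \<circ> chart_inv c))"
    using C1_on_partial_continuous[OF image_open[OF c]] v c by (simp add: C1_fun_def o_def)
qed (use c in \<open>simp add: differential_def\<close>)

lemma gradient_continuous:
  assumes h: "riemannian_metric A h" and u: "C1_fun A u" and c: "c \<in> A"
  shows "continuous_on (chart_image c) (\<lambda>q. gradient h u c (chart_inv c q) $ k)"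
  unfolding gradient_def matrix_vector_mult_def vec_lambda_beta
  by (intro continuous_on_sum continuous_on_mult differential_continuous u c
      C1_on_imp_continuous_on matrix_inv_C1 h)

lemma pairing_continuous:
  assumes "riemannian_metric A h" "C1_fun A u" "C1_fun A v" "c \<in> A"
  shows "continuous_on (chart_image c) (\<lambda>q. pairing h u v c (chart_inv c q))"
  unfolding pairing_def inner_vec_def inner_real_def
  by (intro continuous_on_sum continuous_on_mult differential_continuous gradient_continuous assms)

lemma chart_laplacian_continuous:
  assumes h: "riemannian_metric A h" and u: "smooth_fun A u" and c: "c \<in> A"
  shows "continuous_on (chart_image c) (\<lambda>q. chart_laplacian h u c (chart_inv c q))"
proof (rule continuous_on_eq)
  show "continuous_on (chart_image c) (\<lambda>q.
     (\<Sum>i\<in>UNIV. partial i (\<lambda>q. vol_density h c (chart_inv c q) * gradient h u c (chart_inv c q) $ i) q)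
      / vol_density h c (chart_inv c q))"
    using vol_density_pos[OF h c] c
    by (intro continuous_on_divide continuous_on_sum C1_on_partial_continuous flux_C1 image_open
        C1_on_imp_continuous_on vol_density_C1 h u c ballI) (auto simp: less_le)
qed (use c in \<open>simp add: chart_laplacian_def\<close>)

lemma differential_outside_support:
  assumes k: "k \<in> A" "p \<in> fst k" and K: "compact K" "p \<notin> K" "\<forall>x\<in>M. x \<notin> K \<longrightarrow> \<psi> x = 0"
  shows "differential \<psi> k p = 0"
proof -
  let ?V = "snd k ` (fst k \<inter> (M \<inter> - K))"
  have "openin (top_of_set M) (fst k \<inter> (M \<inter> - K))"
    using compact_imp_closed[OF K(1)] by (intro openin_Int chart_open[OF k(1)] openin_open_Int) auto
  then have V: "openin (top_of_set half_space) ?V" by (rule openin_image[OF k(1)]) auto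
  have xV: "snd k p \<in> ?V" using k K(2) chart_subset[OF k(1)] by blast
  have "snd k p \<in> half_space" using V xV openin_imp_subset by blast
  then have "partial l (\<psi> \<circ> chart_inv k) (snd k p) = 0" for l
    using partial_cong[OF V xV, of "\<psi> \<circ> chart_inv k" "\<lambda>_. 0"] K(3) k(1) partial_const by fastforce
  then show ?thesis by (simp add: differential_def vec_eq_iff)
qed

text \<open>In a chart the integrand below is the divergence of a compactly supported field, which is
  tangential to the boundary by the Neumann condition.\<close>

lemma green_chart:
  assumes h: "riemannian_metric A h" and u: "smooth_fun A u" and c: "c \<in> A"
    and N: "\<forall>p\<in>fst c. snd c p $ bdry_ix = 0 \<longrightarrow> gradient h u c p $ bdry_ix = 0"
    and \<psi>: "C1_fun A \<psi>" and K: "compact K" "K \<subseteq> fst c" "\<forall>p\<in>M. p \<notin> K \<longrightarrow> \<psi> p = 0"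
  shows "(\<integral>p. (if p \<in> fst c then \<psi> p * chart_laplacian h u c p else 0) \<partial>volume_measure M A h) =
    - (\<integral>p. (if p \<in> fst c then pairing h u \<psi> c p else 0) \<partial>volume_measure M A h)"
    and "continuous_on M (\<lambda>p. if p \<in> fst c then \<psi> p * chart_laplacian h u c p else 0)"
    and "continuous_on M (\<lambda>p. if p \<in> fst c then pairing h u \<psi> c p else 0)"
proof -
  let ?S = "chart_image c"
  let ?Y = "\<lambda>k q. vol_density h c (chart_inv c q) * gradient h u c (chart_inv c q) $ k"
  let ?P = "\<lambda>q. \<psi> (chart_inv c q)"
  \<comment> \<open>The flux of \<open>u\<close> times the test function, extended by zero. With the
    volume density as a factor, the plain coordinate divergence becomes density times Riemannian
    divergence.\<close>
  define Z where "Z k q = (if q \<in> ?S then ?P q * ?Y k q else 0)" for k q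
  let ?\<kappa> = "snd c ` K"
  let ?f1 = "\<lambda>p. if p \<in> fst c then \<psi> p * chart_laplacian h u c p else 0"
  let ?f2 = "\<lambda>p. if p \<in> fst c then pairing h u \<psi> c p else 0"
  have \<kappa>: "compact ?\<kappa>" "?\<kappa> \<subseteq> ?S"
    using K(1,2) cont_chart[OF c] by (auto intro!: compact_continuous_image intro: continuous_on_subset simp: chart_image_def)
  have SH: "?S \<subseteq> half_space" using image_subset[OF c] .
  have P: "C1_on ?S ?P" using \<psi> c by (auto simp: C1_fun_def)
  have YP: "C1_on ?S (\<lambda>q. ?P q * ?Y k q)" for k by (intro C1_on_mult P flux_C1[OF h u c])
  have Pz: "?P q = 0" if "q \<in> ?S" "q \<notin> ?\<kappa>" for q
  proof -
    have "chart_inv c q \<notin> K" using that c by force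
    then show ?thesis using K(3) chart_subset[OF c] chart_inv_in[OF c that(1)] by blast
  qed
  have ZC: "C1_on half_space (Z k)" for k
    unfolding Z_def by (rule C1_on_extend_zero[OF image_open[OF c] YP \<kappa>]) (simp add: Pz)
  have Zz: "Z k q = 0" if "q \<notin> ?\<kappa>" for k q using that Pz by (simp add: Z_def)
  have oK: "openin (top_of_set half_space) (half_space \<inter> - ?\<kappa>)"
    using compact_imp_closed[OF \<kappa>(1)] by (intro openin_open_Int) auto
  have pz: "partial k (Z k) q = 0" if "q \<in> half_space" "q \<notin> ?\<kappa>" for k q
    using partial_cong[OF oK, of q "Z k" "\<lambda>_. 0"] that Zz partial_const by auto
  have int: "integrable lborel (\<lambda>q. indicator half_space q * partial k (Z k) q)" for k
    by (rule integrable_compact_support[OF C1_on_partial_continuous[OF openin_subtopology_self ZC] \<kappa>(1)])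
       (use \<kappa>(2) SH pz in auto)
  have zero: "(\<integral>q. indicator half_space q * partial k (Z k) q \<partial>lborel) = 0" for k
  proof (rule integral_partial_half_space_eq_0[OF ZC \<kappa>(1)])
    show "Z k q = 0" if "q \<notin> ?\<kappa>" for q using Zz that by blast
    show "Z k q = 0" if "k = bdry_ix" "q $ bdry_ix = 0" for q
      using that N[rule_format, of "chart_inv c q"] c by (simp add: Z_def)
  qed
  \<comment> \<open>The product rule: differentiating the flux produces the Laplacian term, and
    differentiating the test function produces the pairing.\<close>
  have pw: "(\<Sum>k\<in>UNIV. indicator half_space q * partial k (Z k) q) =
     indicator ?S q * (vol_density h c (chart_inv c q) * (?f1 (chart_inv c q) + ?f2 (chart_inv c q)))" for q
  proof (cases "q \<in> ?S")
    case True
    have d: "vol_density h c (chart_inv c q) \<noteq> 0"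
      using vol_density_pos[OF h c chart_inv_in[OF c True]] by simp
    have "partial k (Z k) q = ?P q * partial k (?Y k) q + partial k (\<psi> \<circ> chart_inv c) q * ?Y k q" for k
    proof -
      have "partial k (Z k) q = partial k (\<lambda>q. ?P q * ?Y k q) q"
        by (rule partial_cong[OF image_open[OF c] True]) (simp add: Z_def)
      also have "\<dots> = ?P q * partial k (?Y k) q + partial k ?P q * ?Y k q"
        by (rule partial_mult[OF image_open[OF c] True P flux_C1[OF h u c]])
      finally show ?thesis by (simp add: o_def)
    qed
    then have "(\<Sum>k\<in>UNIV. partial k (Z k) q) = ?P q * (\<Sum>k\<in>UNIV. partial k (?Y k) q) +
       vol_density h c (chart_inv c q) * pairing h u \<psi> c (chart_inv c q)"
      using True c by (simp add: sum.distrib sum_distrib_left pairing_def inner_vec_def differential_def algebra_simps)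
    also have "(\<Sum>k\<in>UNIV. partial k (?Y k) q) = vol_density h c (chart_inv c q) * chart_laplacian h u c (chart_inv c q)"
      using True c d by (simp add: chart_laplacian_def)
    finally show ?thesis using True SH c by (auto simp: algebra_simps)
  next
    case False
    then have "q \<notin> ?\<kappa>" using \<kappa>(2) by blast
    then show ?thesis using False pz[of q] by (auto split: split_indicator)
  qed
  show c1: "continuous_on M ?f1"
  proof (rule continuous_on_extend[OF c _ K(1,2)])
    have "continuous_on ?S (\<lambda>q. ?P q * chart_laplacian h u c (chart_inv c q))"
      by (intro continuous_on_mult C1_on_imp_continuous_on[OF P] chart_laplacian_continuous[OF h u c])
    then show "continuous_on ?S (\<lambda>q. ?f1 (chart_inv c q))"
      by (rule continuous_on_eq) (use c in simp)
  qed (use K(3) in simp)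
  show c2: "continuous_on M ?f2"
  proof (rule continuous_on_extend[OF c _ K(1,2)])
    have "continuous_on ?S (\<lambda>q. pairing h u \<psi> c (chart_inv c q))"
      by (rule pairing_continuous[OF h smooth_fun_C1[OF u] \<psi> c])
    then show "continuous_on ?S (\<lambda>q. ?f2 (chart_inv c q))"
      by (rule continuous_on_eq) (use c in simp)
    show "?f2 p = 0" if "p \<in> M" "p \<notin> K" for p
    proof (cases "p \<in> fst c")
      case True
      have "differential \<psi> c p = 0"
        by (rule differential_outside_support[OF c True K(1) that(2) K(3)])
      then show ?thesis by (simp add: pairing_def)
    qed simp
  qed
  have "(\<integral>p. ?f1 p + ?f2 p \<partial>volume_measure M A h) =
     (\<integral>q. (\<Sum>k\<in>UNIV. indicator half_space q * partial k (Z k) q) \<partial>lborel)"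
    unfolding pw
    by (rule vol_chart_integral[OF h c]) (use continuous_on_M_measurable[OF continuous_on_add[OF c1 c2]] in auto)
  also have "\<dots> = 0" using int zero by (subst Bochner_Integration.integral_sum) auto
  finally show "(\<integral>p. ?f1 p \<partial>volume_measure M A h) = - (\<integral>p. ?f2 p \<partial>volume_measure M A h)"
    using integrable_vol_continuous[OF h c1] integrable_vol_continuous[OF h c2] by simp
qed

text \<open>The density is positive, so the coordinate image of a null set is Lebesgue null, yet the
  image of a nonempty relatively open set contains a nonempty open subset of the interior of the
  half-space.\<close>

lemma vol_open_pos:
  assumes h: "riemannian_metric A h" and W: "openin (top_of_set M) W" "p \<in> W"
  shows "emeasure (volume_measure M A h) W \<noteq> 0"
proof
  assume 0: "emeasure (volume_measure M A h) W = 0"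
  let ?c = "chart_at A p"
  have "p \<in> M" using W openin_imp_subset by blast
  then have c: "?c \<in> A" "p \<in> fst ?c" using chart_atI by auto
  let ?X = "W \<inter> fst ?c"
  have X: "openin (top_of_set M) ?X" using W chart_open[OF c(1)] by (intro openin_Int)
  have "emeasure (volume_measure M A h) ?X \<le> 0"
    using emeasure_mono[of ?X W "volume_measure M A h"] 0 openin_M_sets[OF W(1)] h by simp
  then have "emeasure (chart_measure h ?c) (snd ?c ` ?X) = 0"
    using vol_emeasure[OF h c(1) openin_M_sets[OF X]] by simp
  moreover have Xb: "snd ?c ` ?X \<in> sets borel" by (rule image_sets[OF c(1) openin_M_sets[OF X]]) simp
  moreover have "ennreal (vol_density h ?c x) \<noteq> 0" if "x \<in> fst ?c" for x
    using vol_density_pos[OF h c(1) that] by (simp add: ennreal_eq_0_iff)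
  ultimately have "AE q in lborel. q \<notin> snd ?c ` ?X"
    unfolding chart_measure_def using chart_density_measurable[OF h c(1)]
    by (subst (asm) emeasure_density, simp, simp, subst (asm) nn_integral_0_iff_AE)
       (auto elim!: eventually_mono simp: c(1) split: split_indicator_asm)
  then have null: "snd ?c ` ?X \<in> null_sets lborel"
    using Xb AE_iff_null_sets by (metis sets_lborel)
  obtain T where T: "open T" "snd ?c ` ?X = half_space \<inter> T"
    using openin_image[OF c(1) X] by (auto simp: openin_open)
  let ?q = "snd ?c p"
  have q: "?q \<in> T" "?q \<in> half_space" using T(2) W(2) c(2) by auto
  obtain e where e: "e > 0" "ball ?q e \<subseteq> T" using T(1) q(1) open_contains_ball by blast
  let ?O = "ball ?q e \<inter> {x. x $ bdry_ix > 0}"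
  \<comment> \<open>Moving inwards by half the radius reaches the open half-space even when the
    point lies on the boundary.\<close>
  have "?q + (e/2) *\<^sub>R axis bdry_ix 1 \<in> ?O"
    using e(1) q(2) by (auto simp: dist_norm half_space_def)
  moreover have "open ?O" by (intro open_Int open_ball open_Collect_less continuous_intros)
  moreover have "?O \<subseteq> half_space \<inter> T" using e(2) by (auto simp: half_space_def)
  then have "negligible ?O"
    using null T(2) by (metis negligible_iff_null_sets negligible_subset null_sets_completionI)
  ultimately show False using open_not_negligible by blast
qed

text \<open>A bump supported where the difference of the two chart Laplacians has one sign would
  give them different integrals. Green's formula in either chart evaluates both integrals to the
  same number, since the pairing is independent of the chart.\<close>

lemma chart_laplacian_invariant:
  assumes h: "riemannian_metric A h" and u: "smooth_fun A u" and c: "c \<in> A" "c' \<in> A" "p \<in> fst c \<inter> fst c'"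
    and N: "\<forall>c\<in>A. \<forall>p\<in>fst c. snd c p $ bdry_ix = 0 \<longrightarrow> gradient h u c p $ bdry_ix = 0"
  shows "chart_laplacian h u c p = chart_laplacian h u c' p"
proof (rule ccontr)
  assume neq: "chart_laplacian h u c p \<noteq> chart_laplacian h u c' p"
  let ?d = "\<lambda>p. chart_laplacian h u c p - chart_laplacian h u c' p" and ?O = "fst c \<inter> fst c'"
  let ?\<mu> = "volume_measure M A h"
  \<comment> \<open>Multiplication by this sign makes the difference positive at \<open>p\<close>,
    whichever of the two values is larger.\<close>
  define s where "s = sgn (?d p)"
  have cont: "continuous_on (fst c) (chart_laplacian h u c)" if "c \<in> A" for c
  proof (rule continuous_on_eq)
    show "continuous_on (fst c) (\<lambda>p. chart_laplacian h u c (chart_inv c (snd c p)))"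
      by (rule continuous_on_compose2[OF chart_laplacian_continuous[OF h u that] cont_chart[OF that]]) (use that in auto)
  qed (use that in simp)
  have cd: "continuous_on ?O (\<lambda>p. s * ?d p)"
    by (intro continuous_intros continuous_on_subset[OF cont[OF c(1)]] continuous_on_subset[OF cont[OF c(2)]]) auto
  define U where "U = {p \<in> ?O. s * ?d p > 0}"
  have O: "openin (top_of_set M) ?O" using chart_open c by (intro openin_Int) auto
  have "openin (top_of_set ?O) (?O \<inter> (\<lambda>p. s * ?d p) -` {0<..})"
    by (rule continuous_openin_preimage_gen[OF cd]) simp
  moreover have "?O \<inter> (\<lambda>p. s * ?d p) -` {0<..} = U" by (auto simp: U_def)
  ultimately have U: "openin (top_of_set M) U" using O openin_trans by metis
  have pU: "p \<in> U" using neq c(3) by (auto simp: U_def s_def sgn_if)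
  have UO: "U \<subseteq> fst c" "U \<subseteq> fst c'" by (auto simp: U_def)
  obtain \<psi> K W where \<psi>: "C1_fun A \<psi>" "compact K" "K \<subseteq> U" "\<forall>x\<in>M. x \<notin> K \<longrightarrow> \<psi> x = 0" "\<forall>x. 0 \<le> \<psi> x"
    "openin (top_of_set M) W" "p \<in> W" "W \<subseteq> K" "\<forall>x\<in>W. 0 < \<psi> x" "compact (snd c ` K)"
    by (rule manifold_bump[OF c(1) pU UO(1) U])
  let ?f = "\<lambda>c p. if p \<in> fst c then \<psi> p * chart_laplacian h u c p else 0"
  let ?g = "\<lambda>c p. if p \<in> fst c then pairing h u \<psi> c p else 0"
  have Kc: "K \<subseteq> fst c" "K \<subseteq> fst c'" using \<psi>(3) UO by auto
  have zK: "\<And>p. p \<in> M \<Longrightarrow> p \<notin> K \<Longrightarrow> \<psi> p = 0" using \<psi>(4) by blast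
  note G = green_chart[OF h u c(1) bspec[OF N c(1)] \<psi>(1,2) Kc(1) \<psi>(4)]
  note G' = green_chart[OF h u c(2) bspec[OF N c(2)] \<psi>(1,2) Kc(2) \<psi>(4)]
  \<comment> \<open>On the overlap this is invariance of the pairing; off the overlap the bump
    vanishes nearby, and so does its differential.\<close>
  have geq: "?g c x = ?g c' x" if x: "x \<in> M" for x
  proof (cases "x \<in> ?O")
    case True
    then show ?thesis
      using pairing_invariant[OF h c(1,2) True] smooth_fun_C1[OF u] \<psi>(1) c by (simp add: C1_fun_def o_def)
  next
    case False
    have "?g k x = 0" if k: "k \<in> A" "K \<subseteq> fst k" for k
    proof (cases "x \<in> fst k")
      case True
      have "x \<notin> K" using False Kc by blast
      from differential_outside_support[OF k(1) True \<psi>(2) this \<psi>(4)] show ?thesis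
        by (simp add: pairing_def)
    qed simp
    then show ?thesis using c Kc by simp
  qed
  have "(\<integral>x. ?g c x \<partial>?\<mu>) = (\<integral>x. ?g c' x \<partial>?\<mu>)"
    by (rule Bochner_Integration.integral_cong[OF refl geq]) (simp add: h)
  then have eq: "(\<integral>x. ?f c x \<partial>?\<mu>) = (\<integral>x. ?f c' x \<partial>?\<mu>)"
    using G(1) G'(1) by (simp only:)
  let ?F = "\<lambda>x. s * (?f c x - ?f c' x)"
  have i: "integrable ?\<mu> (?f c)" "integrable ?\<mu> (?f c')"
    using integrable_vol_continuous[OF h] G(2) G'(2) by blast+
  have F0: "0 \<le> ?F x" if x: "x \<in> M" for x
  proof (cases "x \<in> K")
    case True
    then have xU: "x \<in> U" using \<psi>(3) by blast
    then have "?F x = \<psi> x * (s * ?d x)" by (auto simp: U_def algebra_simps)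
    moreover have "0 \<le> \<psi> x * (s * ?d x)"
      by (rule mult_nonneg_nonneg) (use xU \<psi>(5) in \<open>auto simp: U_def\<close>)
    ultimately show ?thesis by (simp only:)
  qed (use zK x in simp)
  have "(\<integral>x. ?F x \<partial>?\<mu>) = 0" using eq i by simp
  moreover have "integrable ?\<mu> ?F" using i by simp
  moreover have "AE x in ?\<mu>. 0 \<le> ?F x" by (rule AE_I2) (use F0 h in auto)
  ultimately have "AE x in ?\<mu>. ?F x = 0"
    using integral_nonneg_eq_0_iff_AE by blast
  moreover have "?F x > 0" if x: "x \<in> W" for x
  proof -
    have xU: "x \<in> U" using \<psi>(3,8) x by blast
    then have "?F x = \<psi> x * (s * ?d x)" by (auto simp: U_def algebra_simps)
    moreover have "0 < \<psi> x * (s * ?d x)"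
      by (rule mult_pos_pos) (use xU x \<psi>(9) in \<open>auto simp: U_def\<close>)
    ultimately show ?thesis by (simp only:)
  qed
  ultimately have "AE x in ?\<mu>. x \<notin> W" by (force elim!: eventually_mono)
  then have "emeasure ?\<mu> W = 0"
    using AE_iff_null_sets[of W ?\<mu>] openin_M_sets[OF \<psi>(6)] h by auto
  then show False using vol_open_pos[OF h \<psi>(6,7)] by blast
qed

end

section \<open>From single charts to the whole manifold\<close>

context compact_mfd
begin

text \<open>The chart chosen by \<open>chart_at\<close> varies with the point in no regular way.
  Invariance permits replacing it by one fixed chart near the point under consideration.\<close>

lemma continuous_on_invariant:
  fixes F :: "('a, 'n) chart \<Rightarrow> 'a \<Rightarrow> real"
  assumes inv: "\<And>c c' p. c \<in> A \<Longrightarrow> c' \<in> A \<Longrightarrow> p \<in> fst c \<inter> fst c' \<Longrightarrow> F c p = F c' p"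
    and cont: "\<And>c. c \<in> A \<Longrightarrow> continuous_on (chart_image c) (\<lambda>q. F c (chart_inv c q))"
  shows "continuous_on M (\<lambda>p. F (chart_at A p) p)"
proof (rule continuous_on_M)
  fix c assume c: "c \<in> A"
  show "continuous_on (chart_image c) ((\<lambda>p. F (chart_at A p) p) \<circ> chart_inv c)"
  proof (rule continuous_on_eq[OF cont[OF c]])
    fix q assume "q \<in> chart_image c"
    then have p: "chart_inv c q \<in> fst c" using c by simp
    then have "chart_inv c q \<in> M" using chart_subset[OF c] by blast
    from chart_atI[OF this] show "F c (chart_inv c q) = ((\<lambda>p. F (chart_at A p) p) \<circ> chart_inv c) q"
      using inv[OF c, of "chart_at A (chart_inv c q)" "chart_inv c q"] p by simp
  qed
qed

lemma C1_fun_continuous: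
  assumes "C1_fun A f" shows "continuous_on M f"
  using assms by (intro continuous_on_M) (auto simp: C1_fun_def o_def intro: C1_on_imp_continuous_on)

lemma pairing_inv:
  assumes "riemannian_metric A h" "C1_fun A u" "C1_fun A v" "c \<in> A" "c' \<in> A" "p \<in> fst c \<inter> fst c'"
  shows "pairing h u v c p = pairing h u v c' p"
  using pairing_invariant[OF assms(1,4,5,6)] assms(2,3,5) by (simp add: C1_fun_def o_def)

lemma pairing_continuous_M:
  assumes "riemannian_metric A h" "C1_fun A u" "C1_fun A v"
  shows "continuous_on M (\<lambda>p. pairing h u v (chart_at A p) p)"
  by (rule continuous_on_invariant[OF pairing_inv[OF assms] pairing_continuous[OF assms]])

lemma differential_cong:
  assumes c: "c \<in> A" "p \<in> fst c" and eq: "\<And>x. x \<in> M \<Longrightarrow> f x = k x"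
  shows "differential f c p = differential k c p"
  unfolding differential_def vec_eq_iff vec_lambda_beta
proof (intro allI partial_cong[OF image_open[OF c(1)]])
  fix q assume "q \<in> chart_image c"
  then have "chart_inv c q \<in> M" using chart_subset[OF c(1)] chart_inv_in[OF c(1)] by blast
  then show "(f \<circ> chart_inv c) q = (k \<circ> chart_inv c) q" using eq by simp
qed (use c in simp)

lemma differential_sum:
  assumes c: "c \<in> A" "p \<in> fst c" and f: "\<And>i. i \<in> I \<Longrightarrow> C1_fun A (f i)"
  shows "differential (\<lambda>x. \<Sum>i\<in>I. f i x) c p = (\<Sum>i\<in>I. differential (f i) c p)"
proof -
  have "partial k ((\<lambda>x. \<Sum>i\<in>I. f i x) \<circ> chart_inv c) (snd c p) = (\<Sum>i\<in>I. partial k (f i \<circ> chart_inv c) (snd c p))" for k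
    using partial_sum[OF image_open[OF c(1)], of "snd c p" I "\<lambda>i. f i \<circ> chart_inv c" k] c f
    by (simp add: C1_fun_def o_def)
  then show ?thesis by (simp add: differential_def vec_eq_iff)
qed

lemma gradient_bdry_zero:
  assumes h: "riemannian_metric A h" and u: "smooth_fun A u"
    and N: "\<forall>p\<in>mfd_boundary A. normal_derivative A h u p = 0"
  shows "\<forall>c\<in>A. \<forall>p\<in>fst c. snd c p $ bdry_ix = 0 \<longrightarrow> gradient h u c p $ bdry_ix = 0"
proof (intro ballI impI)
  fix c p assume c: "c \<in> A" "p \<in> fst c" "snd c p $ bdry_ix = 0"
  then have "p \<in> mfd_boundary A" by (auto simp: mfd_boundary_def)
  then show "gradient h u c p $ bdry_ix = 0"
    using gradient_boundary[OF h c] N smooth_fun_C1[OF u] by (simp add: C1_fun_def o_def)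
qed

text \<open>The test function is split by a normalised bump cover into pieces, each supported in one
  chart. Green's formula applies to every piece, and both sides are additive in the test
  function.\<close>

lemma weak_form:
  assumes h: "riemannian_metric A h" and u: "smooth_fun A u"
    and N: "\<forall>p\<in>mfd_boundary A. normal_derivative A h u p = 0"
    and eig: "\<forall>p\<in>M. - laplacian A h u p = l * u p"
    and \<psi>: "C1_fun A \<psi>"
  shows "(\<integral>p. pairing h u \<psi> (chart_at A p) p \<partial>volume_measure M A h) =
    l * (\<integral>p. u p * \<psi> p \<partial>volume_measure M A h)"
proof -
  let ?\<mu> = "volume_measure M A h"
  obtain I \<beta> K where "bump_cover I \<beta> K" by (rule finite_bump_cover)
  note I = bump_coverD[OF this]
  define B where "B y = (\<Sum>x\<in>I. \<beta> x y)" for y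
  \<comment> \<open>Dividing by the positive sum \<open>B\<close> makes the pieces add up to the
    test function.\<close>
  define \<eta> where "\<eta> x y = \<beta> x y * (\<psi> y / B y)" for x y
  note Nc = gradient_bdry_zero[OF h u N]
  note uC = smooth_fun_C1[OF u]
  have "C1_fun A B" unfolding B_def by (rule C1_fun_sum) (use I(3) in blast)
  moreover have "B (chart_inv c q) \<noteq> 0" if "c \<in> A" "q \<in> chart_image c" for c q
    using I(8) chart_subset[OF that(1)] chart_inv_in[OF that] by (force simp: B_def)
  ultimately have "C1_fun A (\<lambda>y. \<psi> y / B y)"
    using \<psi> by (auto simp: C1_fun_def intro!: C1_on_divide)
  then have \<eta>C: "C1_fun A (\<eta> x)" if "x \<in> I" for x
    unfolding \<eta>_def using I(3) that by (intro C1_fun_mult) auto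
  have sum\<eta>: "(\<Sum>x\<in>I. \<eta> x y) = \<psi> y" if "y \<in> M" for y
  proof -
    have "(\<Sum>x\<in>I. \<eta> x y) = B y * (\<psi> y / B y)"
      unfolding \<eta>_def sum_distrib_right[symmetric] by (simp add: B_def)
    then show ?thesis using I(8) that by (auto simp: B_def)
  qed
  have loc: "(\<integral>p. pairing h u (\<eta> x) (chart_at A p) p \<partial>?\<mu>) = l * (\<integral>p. u p * \<eta> x p \<partial>?\<mu>)" if x: "x \<in> I" for x
  proof -
    let ?c = "chart_at A x"
    have c: "?c \<in> A" using chart_atI I(2) x by blast
    have z: "\<forall>p\<in>M. p \<notin> K x \<longrightarrow> \<eta> x p = 0" using I(6) x by (simp add: \<eta>_def)
    have Kx: "compact (K x)" "K x \<subseteq> fst ?c" using I(4,5) x by auto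
    have f1: "(if p \<in> fst ?c then \<eta> x p * chart_laplacian h u ?c p else 0) = - l * (u p * \<eta> x p)" if p: "p \<in> M" for p
    proof (cases "p \<in> fst ?c")
      case True
      \<comment> \<open>The equation is given in the chart chosen at \<open>p\<close>, while Green's
        formula wants the chart of the piece; this is where chart independence enters.\<close>
      have "chart_laplacian h u ?c p = laplacian A h u p"
        unfolding laplacian_chart_at
        by (rule chart_laplacian_invariant[OF h u c chart_atI(1)[OF p] _ Nc]) (use True chart_atI p in auto)
      moreover have "laplacian A h u p = - (l * u p)" using bspec[OF eig p] by linarith
      ultimately show ?thesis using True by simp
    qed (use z p Kx in auto)
    have f2: "(if p \<in> fst ?c then pairing h u (\<eta> x) ?c p else 0) = pairing h u (\<eta> x) (chart_at A p) p" if p: "p \<in> M" for p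
    proof (cases "p \<in> fst ?c")
      case True
      then show ?thesis using pairing_inv[OF h uC \<eta>C[OF x] c chart_atI(1)[OF p]] chart_atI[OF p] by simp
    next
      case False
      then have "p \<notin> K x" using Kx by blast
      from differential_outside_support[OF chart_atI[OF p] Kx(1) this z] show ?thesis
        using False by (simp add: pairing_def)
    qed
    have "(\<integral>p. - l * (u p * \<eta> x p) \<partial>?\<mu>) =
        (\<integral>p. (if p \<in> fst ?c then \<eta> x p * chart_laplacian h u ?c p else 0) \<partial>?\<mu>)"
      by (rule Bochner_Integration.integral_cong[OF refl f1[symmetric]]) (simp add: h)
    also have "\<dots> = - (\<integral>p. (if p \<in> fst ?c then pairing h u (\<eta> x) ?c p else 0) \<partial>?\<mu>)"
      by (rule green_chart(1)[OF h u c bspec[OF Nc c] \<eta>C[OF x] Kx z])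
    also have "(\<integral>p. (if p \<in> fst ?c then pairing h u (\<eta> x) ?c p else 0) \<partial>?\<mu>) =
        (\<integral>p. pairing h u (\<eta> x) (chart_at A p) p \<partial>?\<mu>)"
      by (rule Bochner_Integration.integral_cong[OF refl f2]) (simp add: h)
    finally show ?thesis by simp
  qed
  have int1: "integrable ?\<mu> (\<lambda>p. pairing h u (\<eta> x) (chart_at A p) p)" if "x \<in> I" for x
    by (rule integrable_vol_continuous[OF h pairing_continuous_M[OF h uC \<eta>C[OF that]]])
  have int2: "integrable ?\<mu> (\<lambda>p. u p * \<eta> x p)" if "x \<in> I" for x
    by (intro integrable_vol_continuous[OF h] continuous_on_mult C1_fun_continuous uC \<eta>C that)
  have "(\<integral>p. pairing h u \<psi> (chart_at A p) p \<partial>?\<mu>) = (\<integral>p. (\<Sum>x\<in>I. pairing h u (\<eta> x) (chart_at A p) p) \<partial>?\<mu>)"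
  proof (rule Bochner_Integration.integral_cong[OF refl])
    fix p assume "p \<in> space ?\<mu>"
    then have p: "p \<in> M" using h by simp
    have "differential \<psi> (chart_at A p) p = differential (\<lambda>y. \<Sum>x\<in>I. \<eta> x y) (chart_at A p) p"
      by (rule differential_cong[OF chart_atI[OF p]]) (simp add: sum\<eta>)
    also have "\<dots> = (\<Sum>x\<in>I. differential (\<eta> x) (chart_at A p) p)"
      by (rule differential_sum[OF chart_atI[OF p] \<eta>C])
    finally show "pairing h u \<psi> (chart_at A p) p = (\<Sum>x\<in>I. pairing h u (\<eta> x) (chart_at A p) p)"
      by (simp add: pairing_def inner_sum_left)
  qed
  also have "\<dots> = (\<Sum>x\<in>I. l * (\<integral>p. u p * \<eta> x p \<partial>?\<mu>))"
    using int1 loc by (subst Bochner_Integration.integral_sum) auto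
  also have "\<dots> = l * (\<integral>p. (\<Sum>x\<in>I. u p * \<eta> x p) \<partial>?\<mu>)"
    using int2 by (subst Bochner_Integration.integral_sum) (auto simp: sum_distrib_left)
  also have "(\<integral>p. (\<Sum>x\<in>I. u p * \<eta> x p) \<partial>?\<mu>) = (\<integral>p. u p * \<psi> p \<partial>?\<mu>)"
    by (rule Bochner_Integration.integral_cong[OF refl]) (simp add: h sum\<eta> flip: sum_distrib_left)
  finally show ?thesis .
qed

lemma gradient_mult:
  assumes c: "c \<in> A" "p \<in> fst c" and u: "C1_fun A u" and v: "C1_fun A v"
  shows "gradient h (\<lambda>x. u x * v x) c p = u p *\<^sub>R gradient h v c p + v p *\<^sub>R gradient h u c p"
proof -
  have "partial k ((\<lambda>x. u x * v x) \<circ> chart_inv c) (snd c p) =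
     u p * partial k (v \<circ> chart_inv c) (snd c p) + v p * partial k (u \<circ> chart_inv c) (snd c p)" for k
    using partial_mult[OF image_open[OF c(1)], of "snd c p" "u \<circ> chart_inv c" "v \<circ> chart_inv c" k] c u v
    by (simp add: C1_fun_def o_def)
  then have "differential (\<lambda>x. u x * v x) c p = u p *\<^sub>R differential v c p + v p *\<^sub>R differential u c p"
    by (simp add: differential_def vec_eq_iff)
  then show ?thesis
    by (simp add: gradient_def matrix_vector_right_distrib matrix_vector_mult_scaleR)
qed

text \<open>All Laplacians at \<open>p\<close> refer to the same chosen chart, so this is the
  product rule in the divergence formula. Its two cross terms coincide by symmetry of the metric,
  whence the factor 2.\<close>

lemma laplacian_mult:
  assumes h: "riemannian_metric A h" and u: "smooth_fun A u" and v: "smooth_fun A v" and p: "p \<in> M"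
  shows "laplacian A h (\<lambda>x. u x * v x) p =
    u p * laplacian A h v p + v p * laplacian A h u p + 2 * pairing h u v (chart_at A p) p"
proof -
  let ?c = "chart_at A p"
  have c: "?c \<in> A" "p \<in> fst ?c" using chart_atI[OF p] by auto
  let ?q = "snd ?c p"
  let ?w = "\<lambda>q. vol_density h ?c (chart_inv ?c q)"
  let ?Y = "\<lambda>u k q. ?w q * gradient h u ?c (chart_inv ?c q) $ k"
  have q: "?q \<in> chart_image ?c" using c by simp
  have uC: "C1_on (chart_image ?c) (\<lambda>q. u (chart_inv ?c q))" and vC: "C1_on (chart_image ?c) (\<lambda>q. v (chart_inv ?c q))"
    using smooth_fun_C1[OF u] smooth_fun_C1[OF v] c by (auto simp: C1_fun_def)
  have wp: "0 < vol_density h ?c p" by (rule vol_density_pos[OF h c])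
  have "partial k (?Y (\<lambda>x. u x * v x) k) ?q =
      (u p * partial k (?Y v k) ?q + v p * partial k (?Y u k) ?q) +
      vol_density h ?c p * (differential u ?c p $ k * gradient h v ?c p $ k + differential v ?c p $ k * gradient h u ?c p $ k)" for k
  proof -
    have "partial k (?Y (\<lambda>x. u x * v x) k) ?q =
        partial k (\<lambda>q. u (chart_inv ?c q) * ?Y v k q + v (chart_inv ?c q) * ?Y u k q) ?q"
    proof (rule partial_cong[OF image_open[OF c(1)] q])
      fix q assume q: "q \<in> chart_image ?c"
      show "?Y (\<lambda>x. u x * v x) k q = u (chart_inv ?c q) * ?Y v k q + v (chart_inv ?c q) * ?Y u k q"
        using gradient_mult[OF c(1) chart_inv_in[OF c(1) q] smooth_fun_C1[OF u] smooth_fun_C1[OF v], of h]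
        by (simp add: algebra_simps)
    qed
    also have "\<dots> = (u p * partial k (?Y v k) ?q + partial k (\<lambda>q. u (chart_inv ?c q)) ?q * ?Y v k ?q) +
       (v p * partial k (?Y u k) ?q + partial k (\<lambda>q. v (chart_inv ?c q)) ?q * ?Y u k ?q)"
      using partial_add[OF image_open[OF c(1)] q C1_on_mult[OF uC flux_C1[OF h v c(1)]] C1_on_mult[OF vC flux_C1[OF h u c(1)]]]
        partial_mult[OF image_open[OF c(1)] q uC flux_C1[OF h v c(1)]]
        partial_mult[OF image_open[OF c(1)] q vC flux_C1[OF h u c(1)]] c by simp
    finally show ?thesis using c by (simp add: differential_def o_def algebra_simps)
  qed
  then have "(\<Sum>k\<in>UNIV. partial k (?Y (\<lambda>x. u x * v x) k) ?q) =
      u p * (\<Sum>k\<in>UNIV. partial k (?Y v k) ?q) + v p * (\<Sum>k\<in>UNIV. partial k (?Y u k) ?q) +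
      vol_density h ?c p * (pairing h v u ?c p + pairing h u v ?c p)"
    by (simp add: sum.distrib sum_distrib_left pairing_def inner_vec_def algebra_simps)
  moreover have "pairing h v u ?c p = pairing h u v ?c p" by (rule pairing_commute[OF h c])
  ultimately show ?thesis
    using wp unfolding laplacian_chart_at chart_laplacian_def by (simp add: field_simps)
qed

section \<open>Comparison of the volume measures of two metrics\<close>

definition vol_ratio :: "('a, 'n) tensor2 \<Rightarrow> ('a, 'n) tensor2 \<Rightarrow> ('a, 'n) chart \<Rightarrow> 'a \<Rightarrow> real" where
  "vol_ratio h k c p = vol_density h c p / vol_density k c p"

lemma vol_ratio_inv:
  assumes h: "riemannian_metric A h" and k: "riemannian_metric A k" and c: "c \<in> A" "c' \<in> A" "p \<in> fst c \<inter> fst c'"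
  shows "vol_ratio h k c p = vol_ratio h k c' p"
  using vol_density_trans[OF h c] vol_density_trans[OF k c] det_trans_pos[OF c] by (simp add: vol_ratio_def)

lemma vol_ratio_continuous:
  assumes h: "riemannian_metric A h" and k: "riemannian_metric A k" and c: "c \<in> A"
  shows "continuous_on (chart_image c) (\<lambda>q. vol_ratio h k c (chart_inv c q))"
  unfolding vol_ratio_def using vol_density_pos[OF k c] c
  by (intro continuous_on_divide C1_on_imp_continuous_on vol_density_C1 h k ballI) (auto simp: less_le)

lemma vol_ratio_continuous_M:
  assumes "riemannian_metric A h" "riemannian_metric A k"
  shows "continuous_on M (\<lambda>p. vol_ratio h k (chart_at A p) p)"
  by (rule continuous_on_invariant[OF vol_ratio_inv[OF assms] vol_ratio_continuous[OF assms]])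

lemma vol_ratio_pos:
  assumes "riemannian_metric A h" "riemannian_metric A k" "c \<in> A" "p \<in> fst c"
  shows "0 < vol_ratio h k c p"
  using vol_density_pos assms by (simp add: vol_ratio_def)

text \<open>\<open>vol_ratio\<close> is the Radon-Nikodym density. By uniqueness of the volume
  measure it is enough to compute the weighted measure inside each chart. Integrals for every
  parameter can thereby be taken against one fixed measure.\<close>

lemma volume_measure_ratio:
  assumes h: "riemannian_metric A h" and k: "riemannian_metric A k"
  shows "volume_measure M A h = density (volume_measure M A k) (\<lambda>p. ennreal (vol_ratio h k (chart_at A p) p))"
    (is "_ = density ?\<nu> ?r")
proof (rule volume_measure_eqI[OF h])
  have rm: "?r \<in> borel_measurable MB"
    using continuous_on_M_measurable[OF vol_ratio_continuous_M[OF h k]] by simp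
  then have rm': "?r \<in> borel_measurable ?\<nu>"
    by (simp add: measurable_cong_sets[OF vol_space_sets(2)[OF k] refl])
  have "emeasure (density ?\<nu> ?r) B = (\<integral>\<^sup>+q\<in>snd c ` B. ennreal (sqrt (det (h c (chart_inv c q)))) \<partial>lborel)"
    if c: "c \<in> A" and B: "B \<in> sets MB" "B \<subseteq> fst c" for c B
  proof -
    let ?R = "restrict_space lborel (chart_image c) :: (real^'n) measure"
    let ?E = "density ?R (\<lambda>q. ennreal (vol_density k c (chart_inv c q)))"
    have S: "chart_image c \<in> sets lborel" using image_borel[OF c] by simp
    note cinv = chart_inv_measurable_lborel[OF c] and dm = vol_density_measurable[OF k c]
    let ?f = "\<lambda>p. ?r p * indicator B p"
    have fm: "?f \<in> borel_measurable MB" using rm B by measurable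
    have fm': "?f \<in> borel_measurable ?\<nu>"
      using fm by (simp add: measurable_cong_sets[OF vol_space_sets(2)[OF k] refl])
    have Fm: "fst c \<in> sets ?\<nu>" using chart_sets[OF c] k by simp
    have "emeasure (density ?\<nu> ?r) B = (\<integral>\<^sup>+p. ?f p \<partial>?\<nu>)"
      using rm' B k by (subst emeasure_density) auto
    also have "\<dots> = (\<integral>\<^sup>+p. ennreal (indicator (fst c) p) * ?f p \<partial>?\<nu>)"
      using B(2) by (intro nn_integral_cong) (auto split: split_indicator)
    also have "\<dots> = (\<integral>\<^sup>+p. ?f p \<partial>density ?\<nu> (\<lambda>p. ennreal (indicator (fst c) p)))"
      using fm' borel_measurable_indicator[OF Fm, where 'b=real] by (subst nn_integral_density) auto
    also have "\<dots> = (\<integral>\<^sup>+q. ?f (chart_inv c q) \<partial>?E)"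
      unfolding vol_density_eq_distr[OF k c] using cinv fm by (subst nn_integral_distr) auto
    also have "\<dots> = (\<integral>\<^sup>+q. ennreal (vol_density k c (chart_inv c q)) * ?f (chart_inv c q) \<partial>?R)"
      using dm measurable_compose[OF cinv fm] by (subst nn_integral_density) auto
    also have "\<dots> = (\<integral>\<^sup>+q. ennreal (vol_density k c (chart_inv c q)) * ?f (chart_inv c q) * indicator (chart_image c) q \<partial>lborel)"
      using S by (subst nn_integral_restrict_space) auto
    also have "\<dots> = (\<integral>\<^sup>+q. ennreal (sqrt (det (h c (chart_inv c q)))) * indicator (snd c ` B) q \<partial>lborel)"
    proof (rule nn_integral_cong)
      fix q
      show "ennreal (vol_density k c (chart_inv c q)) * ?f (chart_inv c q) * indicator (chart_image c) q =
        ennreal (sqrt (det (h c (chart_inv c q)))) * indicator (snd c ` B) q"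
      proof (cases "q \<in> snd c ` B")
        case True
        then obtain p where p: "p \<in> B" "q = snd c p" by blast
        then have pc: "p \<in> fst c" "p \<in> M" using B(2) chart_subset[OF c] by auto
        have "vol_ratio h k (chart_at A p) p = vol_ratio h k c p"
          using vol_ratio_inv[OF h k chart_atI(1)[OF pc(2)] c] chart_atI(2) pc by blast
        then have "vol_density k c p * vol_ratio h k (chart_at A p) p = vol_density h c p"
          using vol_density_pos[OF k c pc(1)] by (simp add: vol_ratio_def)
        then show ?thesis
          using p pc c vol_density_pos[OF k c pc(1)]
          by (simp add: vol_density_def flip: ennreal_mult')
      next
        case False
        have "chart_inv c q \<notin> B" if "q \<in> chart_image c" using False that c by (metis chart_inv_right imageI)
        then show ?thesis using False by (auto split: split_indicator)
      qed
    qed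
    finally show ?thesis .
  qed
  then show "is_volume_measure M A h (density ?\<nu> ?r)"
    using k by (auto simp: is_volume_measure_def)
qed

lemma integral_volume_ratio:
  assumes h: "riemannian_metric A h" and k: "riemannian_metric A k" and f: "continuous_on M f"
  shows "(\<integral>p. f p \<partial>volume_measure M A h) = (\<integral>p. vol_ratio h k (chart_at A p) p * f p \<partial>volume_measure M A k)"
proof -
  have m: "f \<in> borel_measurable (volume_measure M A k)"
    "(\<lambda>p. vol_ratio h k (chart_at A p) p) \<in> borel_measurable (volume_measure M A k)"
    using continuous_on_M_measurable[OF f] continuous_on_M_measurable[OF vol_ratio_continuous_M[OF h k]]
    by (simp_all add: measurable_cong_sets[OF vol_space_sets(2)[OF k] refl])
  have "AE p in volume_measure M A k. 0 \<le> vol_ratio h k (chart_at A p) p"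
    using vol_ratio_pos[OF h k chart_atI] k by (intro AE_I2) (auto simp: less_imp_le)
  with m show ?thesis unfolding volume_measure_ratio[OF h k] by (subst integral_density) auto
qed

end

section \<open>Dependence on the parameter\<close>

text \<open>A permutation other than the identity moves at least two indices. When one factor is
  differentiated, another off-diagonal entry of the identity matrix remains, so only the diagonal
  product contributes.\<close>

lemma has_derivative_det_mat_1:
  fixes Y :: "real \<Rightarrow> real^'n::finite^'n"
  assumes Y: "\<And>i j. ((\<lambda>t. Y t $ i $ j) has_real_derivative D $ i $ j) (at a)" and Y0: "Y a = mat 1"
  shows "((\<lambda>t. det (Y t)) has_real_derivative trace D) (at a)"
proof -
  let ?P = "{p. p permutes (UNIV :: 'n set)}"
  let ?d = "\<lambda>p. \<Sum>i\<in>UNIV. D $ i $ p i * (\<Prod>j\<in>UNIV - {i}. Y a $ j $ p j)"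
  have pr: "((\<lambda>t. \<Prod>i\<in>UNIV. Y t $ i $ p i) has_real_derivative ?d p) (at a)" for p
  proof -
    have "((\<lambda>t. \<Prod>i\<in>UNIV. Y t $ i $ p i) has_derivative
       (\<lambda>y. \<Sum>i\<in>UNIV. (D $ i $ p i * y) * (\<Prod>j\<in>UNIV - {i}. Y a $ j $ p j))) (at a)"
      by (rule has_derivative_prod) (use Y in \<open>simp add: has_field_derivative_def\<close>)
    moreover have "(\<lambda>y. \<Sum>i\<in>UNIV. (D $ i $ p i * y) * (\<Prod>j\<in>UNIV - {i}. Y a $ j $ p j)) = (*) (?d p)"
      by (simp add: fun_eq_iff sum_distrib_left mult_ac)
    ultimately show ?thesis by (simp add: has_field_derivative_def)
  qed
  have "((\<lambda>t. det (Y t)) has_real_derivative (\<Sum>p\<in>?P. of_int (sign p) * ?d p)) (at a)"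
    unfolding det_def by (intro DERIV_sum DERIV_cmult pr)
  also have "(\<Sum>p\<in>?P. of_int (sign p) * ?d p) = (\<Sum>p\<in>{id}. of_int (sign p) * ?d p)"
  proof (rule sum.mono_neutral_right)
    show "\<forall>p\<in>?P - {id}. of_int (sign p) * ?d p = 0"
    proof
      fix p assume p: "p \<in> ?P - {id}"
      have "(\<Prod>j\<in>UNIV - {i}. Y a $ j $ p j) = 0" for i
      proof -
        \<comment> \<open>A permutation fixing every index but \<open>i\<close> must fix
          \<open>i\<close> too, by injectivity.\<close>
        have "\<exists>j. j \<noteq> i \<and> p j \<noteq> j"
        proof (rule ccontr)
          assume "\<not> ?thesis"
          then have fx: "\<And>j. j \<noteq> i \<Longrightarrow> p j = j" by blast
          moreover have "p i = i" using fx p permutes_inj[of p UNIV] by (metis DiffD1 injD mem_Collect_eq)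
          ultimately have "p x = id x" for x by (cases "x = i") auto
          then have "p = id" by (rule ext)
          then show False using p by simp
        qed
        then obtain j where "j \<noteq> i" "p j \<noteq> j" by blast
        then show ?thesis by (intro prod_zero) (auto simp: Y0 mat_def intro!: bexI[of _ j])
      qed
      then show "of_int (sign p) * ?d p = 0" by (simp del: prod_zero_iff)
    qed
  qed (auto simp: permutes_id finite_permutations)
  also have "\<dots> = trace D" by (simp add: Y0 mat_def trace_def)
  finally show ?thesis .
qed

text \<open>Jacobi's formula, reduced to the identity matrix by multiplying with the inverse of
  \<open>X a\<close> on the left.\<close>

lemma has_derivative_det:
  fixes X :: "real \<Rightarrow> real^'n::finite^'n"
  assumes X: "\<And>i j. ((\<lambda>t. X t $ i $ j) has_real_derivative H $ i $ j) (at a)" and inv: "invertible (X a)"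
  shows "((\<lambda>t. det (X t)) has_real_derivative det (X a) * trace (matrix_inv (X a) ** H)) (at a)"
proof -
  let ?G = "matrix_inv (X a)"
  have "((\<lambda>t. det (?G ** X t)) has_real_derivative trace (?G ** H)) (at a)"
  proof (rule has_derivative_det_mat_1)
    show "((\<lambda>t. (?G ** X t) $ i $ j) has_real_derivative (?G ** H) $ i $ j) (at a)" for i j
      by (simp add: matrix_matrix_mult_def) (intro DERIV_sum DERIV_cmult X)
  qed (rule matrix_inv_left[OF inv])
  then have "((\<lambda>t. det (X a) * det (?G ** X t)) has_real_derivative det (X a) * trace (?G ** H)) (at a)"
    by (rule DERIV_cmult)
  moreover have "det (X a) * det (?G ** X t) = det (X t)" for t
  proof -
    have "det (X a) * det (?G ** X t) = det ((X a ** ?G) ** X t)" by (simp add: det_mul)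
    then show ?thesis by (simp add: matrix_inv_right[OF inv])
  qed
  ultimately show ?thesis by simp
qed

definition eventually_bounded :: "'b set \<Rightarrow> (real \<Rightarrow> 'b \<Rightarrow> real) \<Rightarrow> bool" where
  "eventually_bounded K a \<longleftrightarrow> (\<exists>C. \<forall>\<^sub>F t in at 0. \<forall>q\<in>K. \<bar>a t q\<bar> \<le> C)"

lemma eventually_bounded_add:
  assumes "eventually_bounded K a" "eventually_bounded K b"
  shows "eventually_bounded K (\<lambda>t q. a t q + b t q)"
proof -
  obtain C D where "\<forall>\<^sub>F t in at 0. \<forall>q\<in>K. \<bar>a t q\<bar> \<le> C" "\<forall>\<^sub>F t in at 0. \<forall>q\<in>K. \<bar>b t q\<bar> \<le> D"
    using assms by (auto simp: eventually_bounded_def)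
  then have "\<forall>\<^sub>F t in at 0. \<forall>q\<in>K. \<bar>a t q + b t q\<bar> \<le> C + D"
    by eventually_elim (auto intro: order_trans[OF abs_triangle_ineq] add_mono)
  then show ?thesis by (auto simp: eventually_bounded_def)
qed

lemma eventually_bounded_mult:
  assumes "eventually_bounded K a" "eventually_bounded K b"
  shows "eventually_bounded K (\<lambda>t q. a t q * b t q)"
proof -
  obtain C D where "\<forall>\<^sub>F t in at 0. \<forall>q\<in>K. \<bar>a t q\<bar> \<le> C" "\<forall>\<^sub>F t in at 0. \<forall>q\<in>K. \<bar>b t q\<bar> \<le> D"
    using assms by (auto simp: eventually_bounded_def)
  then have "\<forall>\<^sub>F t in at 0. \<forall>q\<in>K. \<bar>a t q * b t q\<bar> \<le> C * D"
    by eventually_elim (auto simp: abs_mult intro!: mult_mono' )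
  then show ?thesis by (auto simp: eventually_bounded_def)
qed

lemma eventually_bounded_fixed:
  assumes "\<And>q. q \<in> K \<Longrightarrow> \<bar>b q\<bar> \<le> C" shows "eventually_bounded K (\<lambda>t q. b q)"
  using assms by (auto simp: eventually_bounded_def)

lemma eventually_bounded_continuous:
  assumes "compact K" "continuous_on K (b :: 'b::topological_space \<Rightarrow> real)"
  shows "eventually_bounded K (\<lambda>t q. b q)"
proof -
  have "bounded (b ` K)" using assms by (intro compact_imp_bounded compact_continuous_image)
  then obtain C where "\<And>q. q \<in> K \<Longrightarrow> \<bar>b q\<bar> \<le> C" by (auto simp: bounded_iff)
  then show ?thesis by (rule eventually_bounded_fixed)
qed

lemma eventually_bounded_uminus:
  "eventually_bounded K a \<Longrightarrow> eventually_bounded K (\<lambda>t q. - a t q)"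
  by (simp add: eventually_bounded_def)

lemma eventually_bounded_diff:
  "eventually_bounded K a \<Longrightarrow> eventually_bounded K b \<Longrightarrow> eventually_bounded K (\<lambda>t q. a t q - b t q)"
  using eventually_bounded_add[OF _ eventually_bounded_uminus] by fastforce

lemma eventually_bounded_sum:
  assumes "\<And>i. i \<in> I \<Longrightarrow> eventually_bounded K (a i)"
  shows "eventually_bounded K (\<lambda>t q. \<Sum>i\<in>I. a i t q)"
  using assms by (induction I rule: infinite_finite_induct)
    (auto intro: eventually_bounded_add eventually_bounded_fixed[of _ _ 0])

lemma eventually_bounded_cong:
  assumes "eventually_bounded K a" "\<forall>\<^sub>F t in at 0. \<forall>q\<in>K. a t q = b t q"
  shows "eventually_bounded K b"
proof -
  obtain C where "\<forall>\<^sub>F t in at 0. \<forall>q\<in>K. \<bar>a t q\<bar> \<le> C" using assms(1) by (auto simp: eventually_bounded_def)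
  with assms(2) have "\<forall>\<^sub>F t in at 0. \<forall>q\<in>K. \<bar>b t q\<bar> \<le> C" by eventually_elim auto
  then show ?thesis by (auto simp: eventually_bounded_def)
qed

text \<open>For nonzero \<open>t\<close> the function is its value at 0 plus \<open>t\<close> times
  the quotient, and \<open>t\<close> itself may be kept below one.\<close>

lemma eventually_bounded_from_quotient:
  assumes "eventually_bounded K (\<lambda>t q. (a t q - a 0 q) / t)" "eventually_bounded K (\<lambda>t q. a 0 q)"
  shows "eventually_bounded K a"
proof (rule eventually_bounded_cong)
  show "eventually_bounded K (\<lambda>t q. a 0 q + t * ((a t q - a 0 q) / t))"
  proof (intro eventually_bounded_add eventually_bounded_mult assms)
    have "\<forall>\<^sub>F t in at (0::real). t \<in> ball 0 1" by (rule eventually_at_in_open') auto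
    then show "eventually_bounded K (\<lambda>t q. t)"
      unfolding eventually_bounded_def by (intro exI[of _ 1]) (auto elim!: eventually_mono)
  qed
  show "\<forall>\<^sub>F t in at 0. \<forall>q\<in>K. a 0 q + t * ((a t q - a 0 q) / t) = a t q"
    by (auto simp: eventually_at_filter)
qed

section \<open>Functions of a parameter and a point\<close>

lemma C1_time_differentiable:
  fixes F :: "real \<times> 'e::euclidean_space \<Rightarrow> 'f::real_normed_vector"
  assumes F: "C1_on (I \<times> S) F" and I: "open I" "t \<in> I" and q: "q \<in> S"
  shows "(\<lambda>s. F (s, q)) differentiable (at t)"
proof -
  have "(t, q) \<in> I \<times> S" using I q by blast
  then obtain V E E' where "C1_extension (I \<times> S) F (t, q) V E E'" by (rule C1_onE[OF F])
  note V = C1_extensionD[OF this]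
  have "((\<lambda>s. E (s, q)) has_derivative (\<lambda>h. E' (t, q) (h, 0))) (at t)"
    by (rule has_derivative_compose[of "\<lambda>s. (s, q)" _ t UNIV E "E' (t, q)"])
       (use V in \<open>auto intro!: derivative_eq_intros\<close>)
  moreover have "open (I \<inter> (\<lambda>s. (s, q)) -` V)"
    by (intro open_Int I open_vimage V continuous_intros)
  ultimately have "((\<lambda>s. F (s, q)) has_derivative (\<lambda>h. E' (t, q) (h, 0))) (at t)"
    by (rule has_derivative_transform_within_open) (use V I q in auto)
  then show ?thesis by (rule differentiableI)
qed

lemma C1_fixed_time:
  fixes F :: "real \<times> 'e::euclidean_space \<Rightarrow> real"
  assumes F: "C1_on (I \<times> S) F" and t: "t \<in> I"
  shows "C1_on S (\<lambda>q. F (t, q))"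
proof (rule C1_onI)
  fix p assume p: "p \<in> S"
  then have "(t, p) \<in> I \<times> S" using t by blast
  then obtain V E E' where "C1_extension (I \<times> S) F (t, p) V E E'" by (rule C1_onE[OF F])
  note V = C1_extensionD[OF this]
  let ?U = "(\<lambda>q. (t, q)) -` V"
  have "((\<lambda>q. E (t, q)) has_derivative (\<lambda>h. E' (t, q) (0, h))) (at q)" if "q \<in> ?U" for q
    by (rule has_derivative_compose[of "\<lambda>q. (t, q)" _ q UNIV E "E' (t, q)"])
       (use V that in \<open>auto intro!: derivative_eq_intros\<close>)
  moreover have "continuous_on ?U (\<lambda>q. E' (t, q) (0, v))" for v
    by (rule continuous_on_compose2[OF V(4)[rule_format]]) (auto intro!: continuous_intros)
  moreover have "open ?U" by (intro open_vimage V continuous_intros)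
  ultimately show "\<exists>V E E'. C1_extension S (\<lambda>q. F (t, q)) p V E E'"
    unfolding C1_extension_def
    using V t p by (intro exI[of _ ?U] exI[of _ "\<lambda>q. E (t, q)"] exI[of _ "\<lambda>q h. E' (t, q) (0, h)"]) auto
qed

text \<open>Around each point of \<open>K\<close> the parameter derivative of an extension is
  bounded on a product neighbourhood, and the mean value inequality applies there. Finitely many
  neighbourhoods suffice, and the sum of their constants in absolute value serves for all.\<close>

lemma C1_time_quotient_bounded:
  fixes F :: "real \<times> 'e::euclidean_space \<Rightarrow> real"
  assumes F: "C1_on (I \<times> S) F" and I: "open I" "0 \<in> I" and K: "compact K" "K \<subseteq> S"
  shows "eventually_bounded K (\<lambda>t q. (F (t, q) - F (0, q)) / t)"
proof -
  have loc: "\<exists>U \<delta> C. open U \<and> q \<in> U \<and> \<delta> > 0 \<and>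
      (\<forall>x\<in>U \<inter> S. \<forall>t. \<bar>t\<bar> < \<delta> \<longrightarrow> \<bar>F (t, x) - F (0, x)\<bar> \<le> C * \<bar>t\<bar>)" if q: "q \<in> K" for q
  proof -
    have "(0, q) \<in> I \<times> S" using I K q by blast
    then obtain V E E' where "C1_extension (I \<times> S) F (0, q) V E E'" by (rule C1_onE[OF F])
    note V = C1_extensionD[OF this]
    let ?D = "\<lambda>x. E' x (1, 0)"
    \<comment> \<open>The added 1 makes the inequality strict at the point, so that it persists on
      an open set.\<close>
    define C where "C = \<bar>?D (0, q)\<bar> + 1"
    have "continuous_on V (\<lambda>x. \<bar>?D x\<bar>)" using V(4) by (intro continuous_on_rabs) blast
    then have "open (V \<inter> (\<lambda>x. \<bar>?D x\<bar>) -` {..<C})"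
      by (rule continuous_open_preimage[OF _ V(1)]) simp
    moreover have "(0, q) \<in> V \<inter> (\<lambda>x. \<bar>?D x\<bar>) -` {..<C}" using V(2) by (simp add: C_def)
    ultimately obtain J U where "open J" "open U" "(0, q) \<in> J \<times> U"
        "J \<times> U \<subseteq> V \<inter> (\<lambda>x. \<bar>?D x\<bar>) -` {..<C}"
      by (rule open_prod_elim)
    then have JU: "open J" "open U" "0 \<in> J" "q \<in> U" "J \<times> U \<subseteq> V \<inter> (\<lambda>x. \<bar>?D x\<bar>) -` {..<C}"
      by auto
    \<comment> \<open>Staying inside \<open>I\<close> as well keeps the whole parameter segment in
      the region where the extension agrees with \<open>F\<close>.\<close>
    obtain \<delta> where \<delta>: "\<delta> > 0" "ball 0 \<delta> \<subseteq> J \<inter> I"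
      using JU(1,3) I by (metis open_contains_ball open_Int IntI)
    have "\<bar>F (t, x) - F (0, x)\<bar> \<le> C * \<bar>t\<bar>" if x: "x \<in> U \<inter> S" and t: "\<bar>t\<bar> < \<delta>" for x t
    proof -
      have mem: "(s, x) \<in> V" "s \<in> I" "norm (?D (s, x)) \<le> C" if "s \<in> ball 0 \<delta>" for s
      proof -
        have "(s, x) \<in> J \<times> U" "s \<in> I" using that \<delta>(2) x by auto
        then show "(s, x) \<in> V" "s \<in> I" "norm (?D (s, x)) \<le> C" using JU(5) by force+
      qed
      have "((\<lambda>s. E (s, x)) has_real_derivative ?D (s, x)) (at s within ball 0 \<delta>)" if s: "s \<in> ball 0 \<delta>" for s
      proof -
        have d: "(E has_derivative E' (s, x)) (at (s, x))" using V(3) mem[OF s] by blast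
        have "((\<lambda>s. E (s, x)) has_derivative (\<lambda>h. E' (s, x) (h, 0))) (at s)"
          by (rule has_derivative_compose[of "\<lambda>s. (s, x)" _ s UNIV E "E' (s, x)"])
             (use d in \<open>auto intro!: derivative_eq_intros\<close>)
        moreover have "E' (s, x) (h, 0) = ?D (s, x) * h" for h
        proof -
          have "E' (s, x) (h *\<^sub>R (1, 0)) = h *\<^sub>R ?D (s, x)"
            by (rule linear_cmul[OF has_derivative_linear[OF d]])
          then show ?thesis by (simp add: mult.commute)
        qed
        then have "(\<lambda>h. E' (s, x) (h, 0)) = (*) (?D (s, x))" by (rule ext)
        ultimately have "((\<lambda>s. E (s, x)) has_derivative (*) (?D (s, x))) (at s)" by (simp only:)
        then show ?thesis
          unfolding has_field_derivative_def by (rule has_derivative_at_withinI)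
      qed
      from field_differentiable_bound[OF convex_ball this mem(3), of t 0]
      have "\<bar>E (t, x) - E (0, x)\<bar> \<le> C * \<bar>t\<bar>" using t \<delta>(1) by simp
      moreover have "E (t, x) = F (t, x)" "E (0, x) = F (0, x)"
        using V(5) mem[of t] mem[of 0] x t \<delta>(1) by auto
      ultimately show ?thesis by simp
    qed
    then show ?thesis using JU(2,4) \<delta>(1) by blast
  qed
  then obtain U \<delta> C where U: "\<forall>q\<in>K. open (U q) \<and> q \<in> U q \<and> \<delta> q > (0::real) \<and>
      (\<forall>x\<in>U q \<inter> S. \<forall>t. \<bar>t\<bar> < \<delta> q \<longrightarrow> \<bar>F (t, x) - F (0, x)\<bar> \<le> C q * \<bar>t\<bar>)" by metis
  obtain D where D: "D \<subseteq> K" "finite D" "K \<subseteq> (\<Union>q\<in>D. U q)"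
    by (rule compactE_image[OF K(1), of K U]) (use U in auto)
  have "\<forall>\<^sub>F t in at 0. t \<in> ball 0 (\<delta> q)" if "q \<in> D" for q
    using U D(1) that by (intro eventually_at_in_open') auto
  then have "\<forall>\<^sub>F t in at 0. \<forall>q\<in>D. t \<in> ball 0 (\<delta> q)"
    by (intro eventually_ball_finite[OF D(2)]) blast
  moreover have "\<forall>\<^sub>F t in at (0::real). t \<noteq> 0" by (simp add: eventually_at_filter)
  ultimately have "\<forall>\<^sub>F t in at 0. \<forall>x\<in>K. \<bar>(F (t, x) - F (0, x)) / t\<bar> \<le> (\<Sum>q\<in>D. \<bar>C q\<bar>)"
  proof eventually_elim
    case (elim t)
    show ?case
    proof
      fix x assume x: "x \<in> K"
      then obtain q where q: "q \<in> D" "x \<in> U q" using D(3) by blast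
      then have "\<bar>F (t, x) - F (0, x)\<bar> \<le> C q * \<bar>t\<bar>" using U D(1) elim(1) x K(2) by (auto simp: subset_iff)
      then have "\<bar>(F (t, x) - F (0, x)) / t\<bar> \<le> C q" using elim(2) by (simp add: divide_simps)
      also have "\<dots> \<le> \<bar>C q\<bar>" by simp
      also have "\<dots> \<le> (\<Sum>q\<in>D. \<bar>C q\<bar>)" by (rule member_le_sum[OF q(1) _ D(2)]) simp
      finally show "\<bar>(F (t, x) - F (0, x)) / t\<bar> \<le> (\<Sum>q\<in>D. \<bar>C q\<bar>)" .
    qed
  qed
  then show ?thesis by (auto simp: eventually_bounded_def)
qed

lemma C1_time_bounded:
  fixes F :: "real \<times> 'e::euclidean_space \<Rightarrow> real"
  assumes F: "C1_on (I \<times> S) F" and I: "open I" "0 \<in> I" and K: "compact K" "K \<subseteq> S"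
  shows "eventually_bounded K (\<lambda>t q. F (t, q))"
proof (rule eventually_bounded_from_quotient[OF C1_time_quotient_bounded[OF assms]])
  show "eventually_bounded K (\<lambda>t q. F (0, q))"
    using C1_on_imp_continuous_on[OF C1_fixed_time[OF F I(2)]] K
    by (intro eventually_bounded_continuous) (auto intro: continuous_on_subset)
qed

lemma uniform_limit_eventually_bounded:
  fixes X :: "real \<Rightarrow> 'b::topological_space \<Rightarrow> real"
  assumes "uniform_limit K X l (at 0)" "compact K" "continuous_on K l"
  shows "eventually_bounded K X"
proof -
  have "bounded (l ` K)" using assms by (intro compact_imp_bounded compact_continuous_image)
  then obtain C where C: "\<And>q. q \<in> K \<Longrightarrow> \<bar>l q\<bar> \<le> C" by (auto simp: bounded_iff)
  have "\<forall>\<^sub>F t in at 0. \<forall>q\<in>K. dist (X t q) (l q) < 1" using assms(1) by (rule uniform_limitD) simp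
  then have "\<forall>\<^sub>F t in at 0. \<forall>q\<in>K. \<bar>X t q\<bar> \<le> C + 1"
    by eventually_elim (use C in \<open>force simp: dist_real_def\<close>)
  then show ?thesis by (auto simp: eventually_bounded_def)
qed

text \<open>A bounded difference quotient forces the increment to be at most a constant times the
  absolute value of \<open>t\<close>.\<close>

lemma eventually_bounded_quotient_tendsto:
  assumes "eventually_bounded K (\<lambda>t q. (a t q - a 0 q) / t)" "q \<in> K"
  shows "((\<lambda>t. a t q) \<longlongrightarrow> a 0 q) (at 0)"
proof -
  obtain C where "\<forall>\<^sub>F t in at 0. \<forall>q\<in>K. \<bar>(a t q - a 0 q) / t\<bar> \<le> C"
    using assms(1) by (auto simp: eventually_bounded_def)
  moreover have "\<forall>\<^sub>F t in at (0::real). t \<noteq> 0" by (simp add: eventually_at_filter)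
  ultimately have "\<forall>\<^sub>F t in at 0. norm (a t q - a 0 q) \<le> C * \<bar>t\<bar>"
    by eventually_elim (use assms(2) in \<open>force simp: divide_simps\<close>)
  moreover have "((\<lambda>t. C * \<bar>t\<bar>) \<longlongrightarrow> 0) (at 0)" by (auto intro!: tendsto_eq_intros)
  ultimately have "((\<lambda>t. a t q - a 0 q) \<longlongrightarrow> 0) (at 0)" by (rule Lim_null_comparison)
  then show ?thesis by (simp add: LIM_zero_iff)
qed

lemma transpose_matrix_inv:
  fixes B :: "real^'n::finite^'n"
  assumes "invertible B" "transpose B = B"
  shows "transpose (matrix_inv B) = matrix_inv B"
proof -
  have "B ** transpose (matrix_inv B) = transpose (matrix_inv B ** B)"
    using assms(2) by (simp add: matrix_transpose_mul)
  then show ?thesis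
    using matrix_inv_left[OF assms(1)] matrix_inv_unique[of B "transpose (matrix_inv B)"] by (simp add: transpose_mat)
qed

section \<open>Metrics and curves of functions near parameter 0\<close>

locale metric_variation = compact_mfd M A
  for M :: "'a::t2_space set" and A :: "('a, 'n::finite) chart set" +
  fixes \<epsilon> :: real and g :: "real \<Rightarrow> ('a, 'n) tensor2"
  assumes eps: "0 < \<epsilon>" and variation: "smooth_variation A {-\<epsilon><..<\<epsilon>} g"
begin

abbreviation "I \<equiv> {-\<epsilon><..<\<epsilon>}"

lemma I: "open I" "0 \<in> I" using eps by auto

lemma eventually_I: "\<forall>\<^sub>F t in at 0. t \<in> I"
  using I by (rule eventually_at_in_open')

lemma metric: "t \<in> I \<Longrightarrow> riemannian_metric A (g t)"
  using variation by (auto simp: smooth_variation_def)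

lemma metric0: "riemannian_metric A (g 0)"
  using metric I by blast

context
  fixes c assumes c: "c \<in> A"
begin

lemma metric_time_C1: "C1_on (I \<times> chart_image c) (\<lambda>x. g (fst x) c (chart_inv c (snd x)))"
  using variation c by (intro smooth_on_imp_C1_on) (auto simp: smooth_variation_def case_prod_unfold)

lemma metric_time_nth_C1: "C1_on (I \<times> chart_image c) (\<lambda>x. g (fst x) c (chart_inv c (snd x)) $ i $ j)"
  using metric_time_C1 by (rule C1_on_mat_nth)

lemma det_time_pos: "x \<in> I \<times> chart_image c \<Longrightarrow> 0 < det (g (fst x) c (chart_inv c (snd x)))"
  by (rule metric_det_pos[OF metric c]) (auto simp: c)

lemma vol_density_time_C1: "C1_on (I \<times> chart_image c) (\<lambda>x. vol_density (g (fst x)) c (chart_inv c (snd x)))"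
  unfolding vol_density_def by (intro C1_on_sqrt C1_on_det metric_time_nth_C1 det_time_pos)

lemma matrix_inv_time_C1: "C1_on (I \<times> chart_image c) (\<lambda>x. matrix_inv (g (fst x) c (chart_inv c (snd x))) $ i $ j)"
proof (intro C1_on_matrix_inv metric_time_nth_C1)
  fix x assume "x \<in> I \<times> chart_image c"
  from det_time_pos[OF this] show "det (g (fst x) c (chart_inv c (snd x))) \<noteq> 0" by simp
qed

lemma variation_deriv:
  assumes p: "p \<in> fst c"
  shows "((\<lambda>t. g t c p $ i $ j) has_real_derivative variation_tensor g c p $ i $ j) (at 0)"
proof -
  have "(\<lambda>s. g s c p) differentiable (at 0)"
    using C1_time_differentiable[OF metric_time_C1 I(1,2), of "snd c p"] p c by simp
  then have "((\<lambda>s. g s c p) has_vector_derivative variation_tensor g c p) (at 0)"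
    unfolding variation_tensor_def by (simp add: vector_derivative_works)
  from bounded_linear.has_vector_derivative[OF bounded_linear_vec_nth
      bounded_linear.has_vector_derivative[OF bounded_linear_vec_nth this]]
  show ?thesis by (simp add: has_real_derivative_iff_has_vector_derivative)
qed

text \<open>Jacobi's formula followed by the derivative of the square root, which is the origin of
  the factor one half in front of the trace of H.\<close>

lemma vol_ratio_deriv:
  assumes p: "p \<in> fst c"
  shows "((\<lambda>t. vol_ratio (g t) (g 0) c p) has_real_derivative
    trace (matrix_inv (g 0 c p) ** variation_tensor g c p) / 2) (at 0)"
proof -
  let ?T = "trace (matrix_inv (g 0 c p) ** variation_tensor g c p)"
  let ?d = "det (g 0 c p)"
  have d: "0 < ?d" by (rule metric_det_pos[OF metric0 c p])
  have "((\<lambda>t. det (g t c p)) has_real_derivative ?d * ?T) (at 0)"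
    by (rule has_derivative_det[OF variation_deriv[OF p] metric_invertible[OF metric0 c p]])
  from DERIV_chain2[OF DERIV_real_sqrt[OF d] this]
  have "((\<lambda>t. vol_density (g t) c p) has_real_derivative inverse (sqrt ?d) / 2 * (?d * ?T)) (at 0)"
    by (simp add: vol_density_def)
  from DERIV_cdivide[OF this, of "vol_density (g 0) c p"]
  have "((\<lambda>t. vol_ratio (g t) (g 0) c p) has_real_derivative
      inverse (sqrt ?d) / 2 * (?d * ?T) / sqrt ?d) (at 0)"
    by (simp add: vol_ratio_def vol_density_def)
  moreover have "inverse (sqrt ?d) / 2 * (?d * ?T) / sqrt ?d = ?T / 2"
    using d by (simp add: field_simps)
  ultimately show ?thesis by (simp only:)
qed

lemma vol_ratio_0: "p \<in> fst c \<Longrightarrow> vol_ratio (g 0) (g 0) c p = 1"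
  using vol_density_pos[OF metric0 c] by (force simp: vol_ratio_def)

context
  fixes K assumes K: "compact K" "K \<subseteq> chart_image c"
begin

lemma metric_quotient_bounded:
  "eventually_bounded K (\<lambda>t q. (g t c (chart_inv c q) $ i $ j - g 0 c (chart_inv c q) $ i $ j) / t)"
  using C1_time_quotient_bounded[OF metric_time_nth_C1 I K] by simp

lemma matrix_inv_bounded:
  "eventually_bounded K (\<lambda>t q. matrix_inv (g t c (chart_inv c q)) $ i $ j)"
  using C1_time_bounded[OF matrix_inv_time_C1 I K] by simp

lemma matrix_inv_tendsto:
  "q \<in> K \<Longrightarrow> ((\<lambda>t. matrix_inv (g t c (chart_inv c q)) $ i $ j) \<longlongrightarrow> matrix_inv (g 0 c (chart_inv c q)) $ i $ j) (at 0)"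
  using eventually_bounded_quotient_tendsto[OF C1_time_quotient_bounded[OF matrix_inv_time_C1 I K, of i j, unfolded fst_conv snd_conv]]
  by blast

lemma vol_ratio_quotient_bounded:
  "eventually_bounded K (\<lambda>t q. (vol_ratio (g t) (g 0) c (chart_inv c q) - 1) / t)"
proof (rule eventually_bounded_cong)
  show "eventually_bounded K (\<lambda>t q. ((vol_density (g t) c (chart_inv c q) - vol_density (g 0) c (chart_inv c q)) / t)
      * inverse (vol_density (g 0) c (chart_inv c q)))"
  proof (rule eventually_bounded_mult)
    show "eventually_bounded K (\<lambda>t q. (vol_density (g t) c (chart_inv c q) - vol_density (g 0) c (chart_inv c q)) / t)"
      using C1_time_quotient_bounded[OF vol_density_time_C1 I K] by simp
    have "continuous_on (chart_image c) (\<lambda>q. inverse (vol_density (g 0) c (chart_inv c q)))"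
      using vol_density_pos[OF metric0 c] c
      by (intro continuous_on_inverse C1_on_imp_continuous_on vol_density_C1 metric0 ballI) (auto simp: less_le)
    then show "eventually_bounded K (\<lambda>t q. inverse (vol_density (g 0) c (chart_inv c q)))"
      using K by (intro eventually_bounded_continuous) (auto intro: continuous_on_subset)
  qed
  have "vol_density (g 0) c (chart_inv c q) \<noteq> 0" if "q \<in> K" for q
    using vol_density_pos[OF metric0 c chart_inv_in[OF c]] K(2) that by force
  then show "\<forall>\<^sub>F t in at 0. \<forall>q\<in>K. (vol_density (g t) c (chart_inv c q) - vol_density (g 0) c (chart_inv c q)) / t
      * inverse (vol_density (g 0) c (chart_inv c q)) = (vol_ratio (g t) (g 0) c (chart_inv c q) - 1) / t"
    by (intro always_eventually) (auto simp: vol_ratio_def divide_simps)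
qed

lemma vol_ratio_bounded: "eventually_bounded K (\<lambda>t q. vol_ratio (g t) (g 0) c (chart_inv c q))"
proof (rule eventually_bounded_from_quotient)
  have eq: "vol_ratio (g 0) (g 0) c (chart_inv c q) = 1" if "q \<in> K" for q
    using vol_ratio_0 chart_inv_in[OF c] K(2) that by blast
  show "eventually_bounded K (\<lambda>t q. (vol_ratio (g t) (g 0) c (chart_inv c q) - vol_ratio (g 0) (g 0) c (chart_inv c q)) / t)"
    by (rule eventually_bounded_cong[OF vol_ratio_quotient_bounded]) (simp add: eq)
  show "eventually_bounded K (\<lambda>t q. vol_ratio (g 0) (g 0) c (chart_inv c q))"
    by (rule eventually_bounded_fixed[of _ _ 1]) (simp add: eq)
qed

context
  fixes f :: "real \<Rightarrow> 'a \<Rightarrow> real" assumes f: "differentiable_curve A I f"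
begin

text \<open>Differentiability as a curve in the space of smooth functions provides uniform limits of
  the quotients: the empty list of directions for the values, a one-element list for the first
  partials. Since the limits are continuous on the compact set, uniform bounds result.\<close>

lemma curve_quotient_bounded:
  "eventually_bounded K (\<lambda>t q. (f t (chart_inv c q) - f 0 (chart_inv c q)) / t)"
  "eventually_bounded K (\<lambda>t q. (partial l (f t \<circ> chart_inv c) q - partial l (f 0 \<circ> chart_inv c) q) / t)"
proof -
  let ?Q = "\<lambda>s p. (f s p - f 0 p) / (s - 0)"
  have sm: "smooth_fun A (f t)" if "t \<in> I" for t using f that by (simp add: differentiable_curve_def)
  have "\<exists>f'. smooth_fun A f' \<and> smooth_limit A ?Q f' (at 0 within I)"
    using conjunct2[OF f[unfolded differentiable_curve_def]] I(2) by (rule bspec)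
  then obtain f' where f': "smooth_fun A f'" "smooth_limit A ?Q f' (at 0 within I)" by (elim exE conjE)
  have at0: "at 0 within I = at 0" by (rule at_within_open[OF I(2,1)])
  have ul: "uniform_limit K (\<lambda>s. iter_partial is (?Q s \<circ> chart_inv c)) (iter_partial is (f' \<circ> chart_inv c)) (at 0)" for "is"
    using f'(2) c K unfolding smooth_limit_def at0 by blast
  have f'C: "C1_on (chart_image c) (f' \<circ> chart_inv c)"
    using smooth_fun_C1[OF f'(1)] c by (simp add: C1_fun_def o_def)
  have "continuous_on K (f' \<circ> chart_inv c)"
    using C1_on_imp_continuous_on[OF f'C] K(2) by (rule continuous_on_subset)
  then have "eventually_bounded K (\<lambda>s. iter_partial [] (?Q s \<circ> chart_inv c))"
    by (intro uniform_limit_eventually_bounded[OF ul K(1)]) simp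
  then show "eventually_bounded K (\<lambda>t q. (f t (chart_inv c q) - f 0 (chart_inv c q)) / t)"
    by (simp add: o_def)
  have "eventually_bounded K (\<lambda>s. iter_partial [l] (?Q s \<circ> chart_inv c))"
    by (rule uniform_limit_eventually_bounded[OF ul K(1)])
       (use C1_on_partial_continuous[OF image_open[OF c] f'C] K(2) in \<open>auto intro: continuous_on_subset\<close>)
  then show "eventually_bounded K (\<lambda>t q. (partial l (f t \<circ> chart_inv c) q - partial l (f 0 \<circ> chart_inv c) q) / t)"
  proof (rule eventually_bounded_cong)
    show "\<forall>\<^sub>F s in at 0. \<forall>q\<in>K. iter_partial [l] (?Q s \<circ> chart_inv c) q =
      (partial l (f s \<circ> chart_inv c) q - partial l (f 0 \<circ> chart_inv c) q) / s"
      using eventually_I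
    proof eventually_elim
      case (elim s)
      show ?case
      proof
        fix q assume "q \<in> K"
        then have q: "q \<in> chart_image c" "q \<in> half_space" using K(2) image_subset[OF c] by auto
        have C: "C1_on (chart_image c) (f t \<circ> chart_inv c)" if "t \<in> I" for t
          using smooth_fun_C1[OF sm[OF that]] c by (simp add: C1_fun_def o_def)
        have "?Q s \<circ> chart_inv c = (\<lambda>q. (1 / s) * (f s \<circ> chart_inv c) q + (- 1 / s) * (f 0 \<circ> chart_inv c) q)"
          by (auto simp: fun_eq_iff diff_divide_distrib)
        then have "iter_partial [l] (?Q s \<circ> chart_inv c) q =
            partial l (\<lambda>q. (1 / s) * (f s \<circ> chart_inv c) q + (- 1 / s) * (f 0 \<circ> chart_inv c) q) q"
          by simp
        also have "\<dots> = (1 / s) * partial l (f s \<circ> chart_inv c) q + (- 1 / s) * partial l (f 0 \<circ> chart_inv c) q"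
          using partial_add[OF image_open[OF c] q(1) C1_on_mult[OF C1_on_const C[OF elim]] C1_on_mult[OF C1_on_const C[OF I(2)]], of l "1 / s" "- 1 / s"]
            partial_mult[OF image_open[OF c] q(1) C1_on_const C[OF elim], of l "1 / s"]
            partial_mult[OF image_open[OF c] q(1) C1_on_const C[OF I(2)], of l "- 1 / s"]
            partial_const[OF q(2)] by simp
        finally show "iter_partial [l] (?Q s \<circ> chart_inv c) q =
            (partial l (f s \<circ> chart_inv c) q - partial l (f 0 \<circ> chart_inv c) q) / s"
          by (simp add: diff_divide_distrib)
      qed
    qed
  qed
qed

lemma curve_bounded: "eventually_bounded K (\<lambda>t q. f t (chart_inv c q))"
proof (rule eventually_bounded_from_quotient[OF curve_quotient_bounded(1)])
  have "C1_fun A (f 0)" using f I(2) by (intro smooth_fun_C1) (simp add: differentiable_curve_def)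
  then have "continuous_on (chart_image c) (\<lambda>q. f 0 (chart_inv c q))"
    using c C1_on_imp_continuous_on by (auto simp: C1_fun_def)
  then show "eventually_bounded K (\<lambda>t q. f 0 (chart_inv c q))"
    using K by (intro eventually_bounded_continuous) (auto intro: continuous_on_subset)
qed

lemma curve_differential_bounded: "eventually_bounded K (\<lambda>t q. differential (f t) c (chart_inv c q) $ l)"
proof (rule eventually_bounded_cong)
  show "eventually_bounded K (\<lambda>t q. partial l (f t \<circ> chart_inv c) q)"
  proof (rule eventually_bounded_from_quotient[OF curve_quotient_bounded(2)])
    have "smooth_fun A (f 0)" using f I(2) by (simp add: differentiable_curve_def)
    from C1_on_imp_continuous_on[OF partial_u_C1[OF this c]]
    show "eventually_bounded K (\<lambda>t q. partial l (f 0 \<circ> chart_inv c) q)"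
      using K by (intro eventually_bounded_continuous) (auto intro: continuous_on_subset)
  qed
  show "\<forall>\<^sub>F t in at 0. \<forall>q\<in>K. partial l (f t \<circ> chart_inv c) q = differential (f t) c (chart_inv c q) $ l"
    using K(2) c by (intro always_eventually) (auto simp: differential_def)
qed

lemma curve_tendsto: "q \<in> K \<Longrightarrow> ((\<lambda>t. f t (chart_inv c q)) \<longlongrightarrow> f 0 (chart_inv c q)) (at 0)"
  by (rule eventually_bounded_quotient_tendsto[OF curve_quotient_bounded(1)])

lemma curve_differential_tendsto:
  assumes "q \<in> K"
  shows "((\<lambda>t. differential (f t) c (chart_inv c q) $ l) \<longlongrightarrow> differential (f 0) c (chart_inv c q) $ l) (at 0)"
  using eventually_bounded_quotient_tendsto[OF curve_quotient_bounded(2) assms] assms K(2) c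
  by (simp add: differential_def subset_iff)

lemma curve_gradient_bounded: "eventually_bounded K (\<lambda>t q. gradient (g t) (f t) c (chart_inv c q) $ l)"
  unfolding gradient_def matrix_vector_mult_def vec_lambda_beta
  by (intro eventually_bounded_sum eventually_bounded_mult matrix_inv_bounded curve_differential_bounded)

lemma curve_gradient_tendsto:
  assumes "q \<in> K"
  shows "((\<lambda>t. gradient (g t) (f t) c (chart_inv c q) $ l) \<longlongrightarrow> gradient (g 0) (f 0) c (chart_inv c q) $ l) (at 0)"
  unfolding gradient_def matrix_vector_mult_def vec_lambda_beta
  by (intro tendsto_sum tendsto_mult matrix_inv_tendsto curve_differential_tendsto assms)

end
end
end

end

section \<open>The variation of the eigenvalue\<close>

text \<open>\<open>u\<close> moves with the metric, whereas \<open>v\<close> is an eigenfunction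
  frozen at parameter 0. Keeping the two independent covers equal and different indices at
  once.\<close>

locale eigenfunction_variation = metric_variation M A \<epsilon> g
  for M :: "'a::t2_space set" and A :: "('a, 'n::finite) chart set" and \<epsilon> g +
  fixes u :: "real \<Rightarrow> 'a \<Rightarrow> real" and v :: "'a \<Rightarrow> real" and lam :: "real \<Rightarrow> real"
  assumes curve_u: "differentiable_curve A I u" and smooth_v: "smooth_fun A v"
    and lam_diff: "lam differentiable (at 0)"
    and eig_u: "\<And>t. t \<in> I \<Longrightarrow> \<forall>p\<in>M. - laplacian A (g t) (u t) p = lam t * u t p"
    and eig_v: "\<forall>p\<in>M. - laplacian A (g 0) v p = lam 0 * v p"
    and neu_u: "\<And>t. t \<in> I \<Longrightarrow> \<forall>p\<in>mfd_boundary A. normal_derivative A (g t) (u t) p = 0"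
    and neu_v: "\<forall>p\<in>mfd_boundary A. normal_derivative A (g 0) v p = 0"
begin

lemma smooth_u: "t \<in> I \<Longrightarrow> smooth_fun A (u t)"
  using curve_u by (simp add: differentiable_curve_def)

lemma C1_u: "t \<in> I \<Longrightarrow> C1_fun A (u t)" and C1_v: "C1_fun A v"
  using smooth_u smooth_v smooth_fun_C1 by blast+

text \<open>The difference quotient of the two sides of the weak equations for \<open>u t\<close> tested with \<open>v\<close> and
  for \<open>v\<close> tested with \<open>u t\<close>, as an integrand for the fixed measure.\<close>

definition defect :: "('a, 'n) chart \<Rightarrow> real \<Rightarrow> 'a \<Rightarrow> real" where
  "defect c t p = (vol_ratio (g t) (g 0) c p * pairing (g t) (u t) v c p - pairing (g 0) (u t) v c p) / t
     - ((lam t - lam 0) / t * (u t p * v p * vol_ratio (g t) (g 0) c p)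
        + lam 0 * (u t p * v p) * ((vol_ratio (g t) (g 0) c p - 1) / t))"

text \<open>\<open>T\<close> is the derivative of the volume ratio, and the double sum is H
  evaluated on the gradients of \<open>v\<close> and of \<open>u 0\<close>; its negative is the
  derivative of the inner product at fixed differentials.\<close>

definition defect_limit :: "('a, 'n) chart \<Rightarrow> 'a \<Rightarrow> real" where
  "defect_limit c p =
    (let T = trace (matrix_inv (g 0 c p) ** variation_tensor g c p) / 2 in
      T * pairing (g 0) (u 0) v c p
      - (\<Sum>i\<in>UNIV. \<Sum>j\<in>UNIV. gradient (g 0) v c p $ i * (variation_tensor g c p $ i $ j * gradient (g 0) (u 0) c p $ j))
      - (deriv lam 0 * (u 0 p * v p) + lam 0 * (u 0 p * v p) * T))"

lemma integral_defect:
  assumes t: "t \<in> I" "t \<noteq> 0"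
  shows "integrable (volume_measure M A (g 0)) (\<lambda>p. defect (chart_at A p) t p)"
    and "(\<integral>p. defect (chart_at A p) t p \<partial>volume_measure M A (g 0)) = 0"
proof -
  let ?\<mu> = "volume_measure M A (g 0)"
  let ?r = "\<lambda>p. vol_ratio (g t) (g 0) (chart_at A p) p"
  let ?P = "\<lambda>p. pairing (g t) (u t) v (chart_at A p) p"
  let ?Q = "\<lambda>p. pairing (g 0) (u t) v (chart_at A p) p"
  note m = metric[OF t(1)]
  have c: "continuous_on M ?r" "continuous_on M ?P" "continuous_on M ?Q" "continuous_on M (u t)" "continuous_on M v"
    using vol_ratio_continuous_M[OF m metric0] pairing_continuous_M[OF m C1_u[OF t(1)] C1_v]
      pairing_continuous_M[OF metric0 C1_u[OF t(1)] C1_v] C1_fun_continuous[OF C1_u[OF t(1)]] C1_fun_continuous[OF C1_v]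
    by auto
  have i: "integrable ?\<mu> (\<lambda>p. ?r p * ?P p)" "integrable ?\<mu> ?Q" "integrable ?\<mu> (\<lambda>p. ?r p * (u t p * v p))"
    "integrable ?\<mu> (\<lambda>p. u t p * v p)"
    by (intro integrable_vol_continuous[OF metric0] continuous_on_mult c)+
  have "(\<integral>p. ?r p * ?P p \<partial>?\<mu>) = lam t * (\<integral>p. ?r p * (u t p * v p) \<partial>?\<mu>)"
    using weak_form[OF m smooth_u[OF t(1)] neu_u[OF t(1)] eig_u[OF t(1)] C1_v]
      integral_volume_ratio[OF m metric0 c(2)] integral_volume_ratio[OF m metric0 continuous_on_mult[OF c(4,5)]] by simp
  moreover have "(\<integral>p. ?Q p \<partial>?\<mu>) = lam 0 * (\<integral>p. u t p * v p \<partial>?\<mu>)"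
  proof -
    have "(\<integral>p. ?Q p \<partial>?\<mu>) = (\<integral>p. pairing (g 0) v (u t) (chart_at A p) p \<partial>?\<mu>)"
      using pairing_commute[OF metric0 chart_atI] metric0 by (intro Bochner_Integration.integral_cong) auto
    then show ?thesis
      using weak_form[OF metric0 smooth_v neu_v eig_v C1_u[OF t(1)]] by (simp add: mult.commute)
  qed
  \<comment> \<open>The terms with \<open>lam 0\<close> times the volume ratio cancel. What remains
    is the difference of the two weak identities, divided by \<open>t\<close>.\<close>
  moreover have d: "defect (chart_at A p) t p =
      (1 / t) * (?r p * ?P p) - (1 / t) * ?Q p - ((lam t / t) * (?r p * (u t p * v p)) - (lam 0 / t) * (u t p * v p))" for p
    using t(2) by (simp add: defect_def field_simps)
  ultimately show "(\<integral>p. defect (chart_at A p) t p \<partial>?\<mu>) = 0"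
    unfolding d using i by simp
  show "integrable ?\<mu> (\<lambda>p. defect (chart_at A p) t p)"
    unfolding d by (intro Bochner_Integration.integrable_diff integrable_mult_right i)
qed

lemma defect_invariant:
  assumes "t \<in> I" "c \<in> A" "c' \<in> A" "p \<in> fst c \<inter> fst c'"
  shows "defect c t p = defect c' t p"
  using vol_ratio_inv[OF metric[OF assms(1)] metric0 assms(2-4)]
    pairing_inv[OF metric[OF assms(1)] C1_u[OF assms(1)] C1_v assms(2-4)]
    pairing_inv[OF metric0 C1_u[OF assms(1)] C1_v assms(2-4)]
  by (simp add: defect_def)

text \<open>The difference of inverse matrices is avoided by writing both pairings in terms of gradients.\<close>

lemma pairing_difference:
  assumes t: "t \<in> I" and c: "c \<in> A" "p \<in> fst c"
  shows "pairing (g t) (u t) v c p - pairing (g 0) (u t) v c p =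
    - (\<Sum>i\<in>UNIV. \<Sum>j\<in>UNIV. gradient (g 0) v c p $ i * ((g t c p $ i $ j - g 0 c p $ i $ j) * gradient (g t) (u t) c p $ j))"
proof -
  \<comment> \<open>The differential of \<open>v\<close> is \<open>g 0\<close> applied to
    \<open>?V\<close>, and that of \<open>u t\<close> is \<open>g t\<close> applied to
    \<open>?U\<close>. So the first pairing is the form \<open>g 0\<close>, and the second the form
    \<open>g t\<close>, on the same two vectors; this is where the minus sign comes from.\<close>
  let ?V = "gradient (g 0) v c p" and ?U = "gradient (g t) (u t) c p"
  have "pairing (g t) (u t) v c p = (g 0 c p *v ?V) \<bullet> ?U"
    by (simp add: pairing_def metric_gradient[OF metric0 c])
  also have "\<dots> = ?V \<bullet> (g 0 c p *v ?U)"
    using metricD(1)[OF metric0 c] by (metis dot_lmul_matrix transpose_matrix_vector)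
  finally have 1: "pairing (g t) (u t) v c p = ?V \<bullet> (g 0 c p *v ?U)" .
  have "pairing (g 0) (u t) v c p = differential (u t) c p \<bullet> ?V"
    using pairing_commute[OF metric0 c, of "u t" v] by (simp add: pairing_def)
  also have "\<dots> = ?V \<bullet> (g t c p *v ?U)"
    by (simp add: metric_gradient[OF metric[OF t] c] inner_commute)
  finally have 2: "pairing (g 0) (u t) v c p = ?V \<bullet> (g t c p *v ?U)" .
  show ?thesis unfolding 1 2
    by (simp add: inner_vec_def matrix_vector_mult_def sum_distrib_left sum_subtractf algebra_simps)
qed

text \<open>The defect rearranged so that each division by \<open>t\<close> falls on the volume
  ratio, the metric or the eigenvalue, with all other factors convergent and bounded by
  themselves.\<close>

definition defect_sum :: "('a, 'n) chart \<Rightarrow> real \<Rightarrow> 'a \<Rightarrow> real" where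
  "defect_sum c t p = (vol_ratio (g t) (g 0) c p - 1) / t *
       (\<Sum>i\<in>UNIV. differential v c p $ i * gradient (g t) (u t) c p $ i)
     - (\<Sum>i\<in>UNIV. \<Sum>j\<in>UNIV. gradient (g 0) v c p $ i *
         ((g t c p $ i $ j - g 0 c p $ i $ j) / t * gradient (g t) (u t) c p $ j))
     - ((lam t - lam 0) / t * (u t p * v p * vol_ratio (g t) (g 0) c p)
        + lam 0 * (u t p * v p) * ((vol_ratio (g t) (g 0) c p - 1) / t))"

lemma defect_expand:
  assumes t: "t \<in> I" "t \<noteq> 0" and c: "c \<in> A" "p \<in> fst c"
  shows "defect c t p = defect_sum c t p"
proof -
  let ?r = "vol_ratio (g t) (g 0) c p" and ?P = "pairing (g t) (u t) v c p" and ?Q = "pairing (g 0) (u t) v c p"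
  let ?S = "\<Sum>i\<in>UNIV. \<Sum>j\<in>UNIV. gradient (g 0) v c p $ i *
         ((g t c p $ i $ j - g 0 c p $ i $ j) * gradient (g t) (u t) c p $ j)"
  have split: "(?r * ?P - ?Q) / t = (?r - 1) / t * ?P + (?P - ?Q) / t"
    using t(2) by (simp add: field_simps)
  have P: "?P = (\<Sum>i\<in>UNIV. differential v c p $ i * gradient (g t) (u t) c p $ i)"
    by (simp add: pairing_def inner_vec_def)
  have S: "?S / t = (\<Sum>i\<in>UNIV. \<Sum>j\<in>UNIV. gradient (g 0) v c p $ i *
         ((g t c p $ i $ j - g 0 c p $ i $ j) / t * gradient (g t) (u t) c p $ j))"
    by (simp add: sum_divide_distrib)
  have D: "(?P - ?Q) / t = - (?S / t)"
    unfolding pairing_difference[OF t(1) c] by simp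
  show ?thesis unfolding defect_def defect_sum_def split D unfolding S P by simp
qed

lemma defect_tendsto:
  assumes c: "c \<in> A" "p \<in> fst c"
  shows "((\<lambda>t. defect c t p) \<longlongrightarrow> defect_limit c p) (at 0)"
proof -
  let ?q = "snd c p"
  \<comment> \<open>Singletons turn the statements about compact coordinate sets into pointwise
    limits.\<close>
  have K: "compact {?q}" "{?q} \<subseteq> chart_image c" using c by auto
  have p: "chart_inv c ?q = p" using c by simp
  have X: "((\<lambda>t. gradient (g t) (u t) c p $ l) \<longlongrightarrow> gradient (g 0) (u 0) c p $ l) (at 0)" for l
    using curve_gradient_tendsto[OF c(1) K curve_u, of ?q l] p by simp
  have U: "((\<lambda>t. u t p) \<longlongrightarrow> u 0 p) (at 0)"
    using curve_tendsto[OF c(1) K curve_u, of ?q] p by simp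
  have R: "((\<lambda>t. (vol_ratio (g t) (g 0) c p - 1) / t) \<longlongrightarrow>
      trace (matrix_inv (g 0 c p) ** variation_tensor g c p) / 2) (at 0)"
    using vol_ratio_deriv[OF c] vol_ratio_0[OF c] by (simp add: has_field_derivative_iff)
  have r: "((\<lambda>t. vol_ratio (g t) (g 0) c p) \<longlongrightarrow> 1) (at 0)"
    using DERIV_isCont[OF vol_ratio_deriv[OF c]] vol_ratio_0[OF c] by (simp add: isCont_def)
  have H: "((\<lambda>t. (g t c p $ i $ j - g 0 c p $ i $ j) / t) \<longlongrightarrow> variation_tensor g c p $ i $ j) (at 0)" for i j
    using variation_deriv[OF c, of i j] by (simp add: has_field_derivative_iff)
  have "(lam has_real_derivative deriv lam 0) (at 0)"
    using lam_diff by (simp add: DERIV_deriv_iff_real_differentiable)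
  then have L: "((\<lambda>t. (lam t - lam 0) / t) \<longlongrightarrow> deriv lam 0) (at 0)"
    by (simp add: has_field_derivative_iff)
  \<comment> \<open>The extra factor 1 is the limit of the volume ratio; with it the limit has the
    same shape as the term that converges to it.\<close>
  have one: "deriv lam 0 * (u 0 p * v p) = deriv lam 0 * (u 0 p * v p * 1)" by simp
  have "((\<lambda>t. defect_sum c t p) \<longlongrightarrow> defect_limit c p) (at 0)"
    unfolding defect_sum_def defect_limit_def Let_def pairing_def inner_vec_def inner_real_def
    by (subst one) (intro tendsto_diff tendsto_add tendsto_mult tendsto_sum tendsto_const X U R r H L)
  moreover have "\<forall>\<^sub>F t in at (0::real). t \<noteq> 0" by (simp add: eventually_at_filter)
  with eventually_I have "\<forall>\<^sub>F t in at 0. defect_sum c t p = defect c t p"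
    by eventually_elim (rule defect_expand[OF _ _ c, symmetric])
  ultimately show ?thesis by (rule Lim_transform_eventually)
qed

lemma defect_bounded_chart:
  assumes c: "c \<in> A" and K: "compact K" "K \<subseteq> chart_image c"
  shows "eventually_bounded K (\<lambda>t q. defect c t (chart_inv c q))"
proof (rule eventually_bounded_cong)
  have vc: "continuous_on K (\<lambda>q. v (chart_inv c q))"
    using C1_on_imp_continuous_on continuous_on_subset[OF _ K(2)] C1_v c by (auto simp: C1_fun_def)
  have dv: "eventually_bounded K (\<lambda>t q. differential v c (chart_inv c q) $ i)" for i
    by (rule eventually_bounded_continuous[OF K(1) continuous_on_subset[OF differential_continuous[OF C1_v c] K(2)]])
  have Xv: "eventually_bounded K (\<lambda>t q. gradient (g 0) v c (chart_inv c q) $ i)" for i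
    by (rule eventually_bounded_continuous[OF K(1) continuous_on_subset[OF gradient_continuous[OF metric0 C1_v c] K(2)]])
  have "(lam has_real_derivative deriv lam 0) (at 0)"
    using lam_diff by (simp add: DERIV_deriv_iff_real_differentiable)
  then have "((\<lambda>t. (lam t - lam 0) / t) \<longlongrightarrow> deriv lam 0) (at 0)"
    by (simp add: has_field_derivative_iff)
  then have "\<forall>\<^sub>F t in at 0. dist ((lam t - lam 0) / t) (deriv lam 0) < 1"
    by (rule tendstoD) simp
  then have "\<forall>\<^sub>F t in at 0. \<forall>q\<in>K. \<bar>(lam t - lam 0) / t\<bar> \<le> \<bar>deriv lam 0\<bar> + 1"
    by eventually_elim (auto simp: dist_real_def)
  then have L: "eventually_bounded K (\<lambda>t q. (lam t - lam 0) / t)"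
    unfolding eventually_bounded_def by blast
  show "eventually_bounded K (\<lambda>t q. defect_sum c t (chart_inv c q))"
    unfolding defect_sum_def
    by (intro eventually_bounded_diff eventually_bounded_add eventually_bounded_mult eventually_bounded_sum
        vol_ratio_quotient_bounded[OF c K] vol_ratio_bounded[OF c K] dv Xv L
        curve_gradient_bounded[OF c K curve_u] curve_bounded[OF c K curve_u] metric_quotient_bounded[OF c K]
        eventually_bounded_continuous[OF K(1) vc] eventually_bounded_continuous[OF K(1) continuous_on_const])
  have "\<forall>\<^sub>F t in at (0::real). t \<noteq> 0" by (simp add: eventually_at_filter)
  with eventually_I show "\<forall>\<^sub>F t in at 0. \<forall>q\<in>K. defect_sum c t (chart_inv c q) = defect c t (chart_inv c q)"
    by eventually_elim (use K(2) c in \<open>auto intro!: defect_expand[symmetric]\<close>)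
qed

text \<open>On each compact set of a bump cover the bound is found in one fixed chart and passed to
  the chosen charts by invariance, for parameters in \<open>I\<close>. There are finitely many sets,
  so the constants can be summed.\<close>

lemma defect_bounded: "eventually_bounded M (\<lambda>t p. defect (chart_at A p) t p)"
proof -
  obtain J \<psi> K where "bump_cover J \<psi> K" by (rule finite_bump_cover)
  note J = bump_coverD[OF this]
  have "\<forall>x\<in>J. \<exists>C. \<forall>\<^sub>F t in at 0. \<forall>p\<in>K x. \<bar>defect (chart_at A p) t p\<bar> \<le> C"
  proof
    fix x assume x: "x \<in> J"
    let ?c = "chart_at A x"
    have c: "?c \<in> A" using chart_atI J(2) x by blast
    have "snd ?c ` K x \<subseteq> chart_image ?c" using J(5) x by (auto simp: chart_image_def)
    from defect_bounded_chart[OF c _ this] J(9) x obtain C where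
      "\<forall>\<^sub>F t in at 0. \<forall>q\<in>snd ?c ` K x. \<bar>defect ?c t (chart_inv ?c q)\<bar> \<le> C"
      unfolding eventually_bounded_def by blast
    with eventually_I have "\<forall>\<^sub>F t in at 0. \<forall>p\<in>K x. \<bar>defect (chart_at A p) t p\<bar> \<le> C"
    proof eventually_elim
      case (elim t)
      show ?case
      proof
        fix p assume p: "p \<in> K x"
        then have pc: "p \<in> fst ?c" "p \<in> M" using J(5,7) x by auto
        have "defect (chart_at A p) t p = defect ?c t p"
          by (rule defect_invariant[OF elim(1) chart_atI(1)[OF pc(2)] c]) (use pc chart_atI in auto)
        moreover have "\<bar>defect ?c t (chart_inv ?c (snd ?c p))\<bar> \<le> C" using elim(2) p by blast
        ultimately show "\<bar>defect (chart_at A p) t p\<bar> \<le> C" using pc c by simp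
      qed
    qed
    then show "\<exists>C. \<forall>\<^sub>F t in at 0. \<forall>p\<in>K x. \<bar>defect (chart_at A p) t p\<bar> \<le> C" ..
  qed
  from bchoice[OF this] obtain C where
    C: "\<forall>x\<in>J. \<forall>\<^sub>F t in at 0. \<forall>p\<in>K x. \<bar>defect (chart_at A p) t p\<bar> \<le> C x" ..
  have "\<forall>\<^sub>F t in at 0. \<forall>x\<in>J. \<forall>p\<in>K x. \<bar>defect (chart_at A p) t p\<bar> \<le> C x"
    by (rule eventually_ball_finite[OF J(1) C])
  then have "\<forall>\<^sub>F t in at 0. \<forall>p\<in>M. \<bar>defect (chart_at A p) t p\<bar> \<le> (\<Sum>x\<in>J. \<bar>C x\<bar>)"
  proof eventually_elim
    case (elim t)
    show ?case
    proof
      fix p assume "p \<in> M"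
      then obtain x where x: "x \<in> J" "p \<in> K x" using J(7) by blast
      then have "\<bar>defect (chart_at A p) t p\<bar> \<le> \<bar>C x\<bar>" using elim by (meson abs_ge_self order_trans)
      also have "\<dots> \<le> (\<Sum>x\<in>J. \<bar>C x\<bar>)" by (rule member_le_sum[OF x(1) _ J(1)]) simp
      finally show "\<bar>defect (chart_at A p) t p\<bar> \<le> (\<Sum>x\<in>J. \<bar>C x\<bar>)" .
    qed
  qed
  then show ?thesis unfolding eventually_bounded_def by blast
qed

lemma integral_defect_limit:
  "integrable (volume_measure M A (g 0)) (\<lambda>p. defect_limit (chart_at A p) p)" (is ?A)
  "(\<integral>p. defect_limit (chart_at A p) p \<partial>volume_measure M A (g 0)) = 0" (is ?B)
proof -
  let ?\<mu> = "volume_measure M A (g 0)"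
  obtain C where C: "\<forall>\<^sub>F t in at 0. \<forall>p\<in>M. \<bar>defect (chart_at A p) t p\<bar> \<le> C"
    using defect_bounded unfolding eventually_bounded_def by blast
  have s0: "filterlim (\<lambda>n. 1 / real (Suc n)) (at 0) sequentially"
    unfolding filterlim_at
  proof
    show "(\<lambda>n. 1 / real (Suc n)) \<longlonglongrightarrow> 0"
      using LIMSEQ_inverse_real_of_nat by (simp add: inverse_eq_divide)
  qed simp
  have "\<forall>\<^sub>F t in at 0. t \<in> I \<and> (\<forall>p\<in>M. \<bar>defect (chart_at A p) t p\<bar> \<le> C)"
    using eventually_I C by eventually_elim simp
  from eventually_compose_filterlim[OF this s0]
  obtain N where N: "\<And>n. n \<ge> N \<Longrightarrow> 1 / real (Suc n) \<in> I \<and> (\<forall>p\<in>M. \<bar>defect (chart_at A p) (1 / real (Suc n)) p\<bar> \<le> C)"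
    unfolding eventually_sequentially by blast
  \<comment> \<open>Shifting by \<open>N\<close> places every member of the sequence, and not merely
    almost all, in the range where the bound holds, as dominated convergence asks for it at each
    index.\<close>
  define s where "s n = 1 / real (Suc (n + N))" for n
  have s: "s n \<in> I" "s n \<noteq> 0" "\<And>p. p \<in> M \<Longrightarrow> \<bar>defect (chart_at A p) (s n) p\<bar> \<le> C" for n
    using N[of "n + N"] by (auto simp: s_def)
  have slim: "filterlim s (at 0) sequentially"
    using filterlim_compose[OF s0 filterlim_add_const_nat_at_top[of N]] by (simp add: s_def[abs_def])
  have lim: "(\<lambda>n. defect (chart_at A p) (s n) p) \<longlonglongrightarrow> defect_limit (chart_at A p) p" if "p \<in> M" for p
    by (rule filterlim_compose[OF defect_tendsto[OF chart_atI[OF that]] slim])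
  have m: "(\<lambda>p. defect (chart_at A p) (s n) p) \<in> borel_measurable ?\<mu>" for n
    using integral_defect(1)[OF s(1,2)] by (rule borel_measurable_integrable)
  have ml: "(\<lambda>p. defect_limit (chart_at A p) p) \<in> borel_measurable ?\<mu>"
    by (rule borel_measurable_LIMSEQ_real[OF _ m]) (use lim metric0 in simp)
  interpret finite_measure ?\<mu> using finite_volume[OF metric0] .
  have int: "integrable ?\<mu> (\<lambda>p. C)" by simp
  have lim': "AE p in ?\<mu>. (\<lambda>n. defect (chart_at A p) (s n) p) \<longlonglongrightarrow> defect_limit (chart_at A p) p"
    using lim metric0 by (intro AE_I2) simp
  have bnd: "AE p in ?\<mu>. norm (defect (chart_at A p) (s n) p) \<le> C" for n
    using s(3) metric0 by (intro AE_I2) simp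
  show ?A by (rule integrable_dominated_convergence[OF ml m int lim' bnd])
  have "(\<lambda>n. \<integral>p. defect (chart_at A p) (s n) p \<partial>?\<mu>) \<longlonglongrightarrow> (\<integral>p. defect_limit (chart_at A p) p \<partial>?\<mu>)"
    by (rule integral_dominated_convergence[OF ml m int lim' bnd])
  then show ?B using integral_defect(2)[OF s(1,2)] by (simp add: LIMSEQ_const_iff)
qed

text \<open>Contracting the metric with H leaves the trace of H, and contracting the tensor product
  leaves H on the two gradients. The 1/4 matches the 1/2 from the volume ratio because the Laplacian
  of the product carries a factor 2. The eigenvalue derivative contained in
  \<open>defect_limit\<close> is added back.\<close>

lemma tensor_identity:
  assumes p: "p \<in> M"
  shows "tensor_inner A (g 0)
        (\<lambda>c q. (1/4 * laplacian A (g 0) (\<lambda>x. v x * u 0 x) q) *\<^sub>R g 0 c q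
               - (differential v \<otimes>\<^sub>T differential (u 0)) c q)
        (variation_tensor g) p =
     defect_limit (chart_at A p) p + deriv lam 0 * (u 0 p * v p)" (is "?T = _")
proof -
  let ?c = "chart_at A p"
  have c: "?c \<in> A" "p \<in> fst ?c" using chart_atI[OF p] by auto
  define B where "B = g 0 ?c p"
  define G where "G = matrix_inv B"
  define H where "H = variation_tensor g ?c p"
  define a where "a = differential v ?c p"
  define b where "b = differential (u 0) ?c p"
  define L where "L = laplacian A (g 0) (\<lambda>x. v x * u 0 x) p"
  have inv: "invertible B" unfolding B_def by (rule metric_invertible[OF metric0 c])
  have symB: "transpose B = B" unfolding B_def by (rule metricD(1)[OF metric0 c])
  have "transpose G = G" unfolding G_def by (rule transpose_matrix_inv[OF inv symB])
  then have symG: "G $ i $ j = G $ j $ i" for i j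
  proof -
    have "transpose G $ j $ i = G $ i $ j" by (simp add: transpose_def)
    then show ?thesis using \<open>transpose G = G\<close> by simp
  qed
  have GB: "(\<Sum>i\<in>UNIV. G $ k $ i * B $ i $ j) = (if k = j then 1 else 0)" for k j
    using arg_cong[OF matrix_inv_left[OF inv], of "\<lambda>X. X $ k $ j"]
    by (simp add: G_def matrix_matrix_mult_def mat_def)
  have t1: "(\<Sum>i\<in>UNIV. \<Sum>j\<in>UNIV. \<Sum>k\<in>UNIV. \<Sum>l\<in>UNIV. G $ i $ k * G $ j $ l * B $ i $ j * H $ k $ l) = trace (G ** H)"
  proof -
    have "(\<Sum>i\<in>UNIV. \<Sum>j\<in>UNIV. \<Sum>k\<in>UNIV. \<Sum>l\<in>UNIV. G $ i $ k * G $ j $ l * B $ i $ j * H $ k $ l) =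
        (\<Sum>j\<in>UNIV. \<Sum>i\<in>UNIV. \<Sum>k\<in>UNIV. \<Sum>l\<in>UNIV. G $ i $ k * G $ j $ l * B $ i $ j * H $ k $ l)"
      by (rule sum.swap)
    also have "\<dots> = (\<Sum>j\<in>UNIV. \<Sum>k\<in>UNIV. \<Sum>i\<in>UNIV. \<Sum>l\<in>UNIV. G $ i $ k * G $ j $ l * B $ i $ j * H $ k $ l)"
      by (intro sum.cong refl sum.swap)
    also have "\<dots> = (\<Sum>j\<in>UNIV. \<Sum>k\<in>UNIV. \<Sum>l\<in>UNIV. \<Sum>i\<in>UNIV. G $ i $ k * G $ j $ l * B $ i $ j * H $ k $ l)"
      by (intro sum.cong refl sum.swap)
    \<comment> \<open>With the sum over \<open>i\<close> innermost, and symmetry of the inverse to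
      line up the indices, inverse times metric appears and collapses to a Kronecker delta.\<close>
    also have "\<dots> = (\<Sum>j\<in>UNIV. \<Sum>k\<in>UNIV. \<Sum>l\<in>UNIV. (\<Sum>i\<in>UNIV. G $ k $ i * B $ i $ j) * (G $ j $ l * H $ k $ l))"
      unfolding sum_distrib_right by (intro sum.cong refl, subst symG) (simp add: mult_ac)
    also have "\<dots> = (\<Sum>j\<in>UNIV. \<Sum>k\<in>UNIV. if k = j then (\<Sum>l\<in>UNIV. G $ j $ l * H $ k $ l) else 0)"
      unfolding GB by (intro sum.cong refl) simp
    also have "\<dots> = (\<Sum>j\<in>UNIV. \<Sum>l\<in>UNIV. G $ j $ l * H $ j $ l)" by simp
    also have "\<dots> = (\<Sum>l\<in>UNIV. \<Sum>j\<in>UNIV. G $ l $ j * H $ j $ l)"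
      by (subst sum.swap) (simp add: symG)
    finally show ?thesis by (simp add: trace_def matrix_matrix_mult_def)
  qed
  have Gv: "(G *v x) $ k = (\<Sum>i\<in>UNIV. G $ i $ k * x $ i)" for x k
    unfolding matrix_vector_mult_def vec_lambda_beta by (intro sum.cong refl, subst symG) simp
  have t2: "(\<Sum>i\<in>UNIV. \<Sum>j\<in>UNIV. \<Sum>k\<in>UNIV. \<Sum>l\<in>UNIV. G $ i $ k * G $ j $ l * (a $ i * b $ j) * H $ k $ l) =
     (\<Sum>k\<in>UNIV. \<Sum>l\<in>UNIV. (G *v a) $ k * (H $ k $ l * (G *v b) $ l))"
  proof -
    have "(\<Sum>k\<in>UNIV. \<Sum>l\<in>UNIV. (G *v a) $ k * (H $ k $ l * (G *v b) $ l)) =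
       (\<Sum>k\<in>UNIV. \<Sum>l\<in>UNIV. \<Sum>i\<in>UNIV. \<Sum>j\<in>UNIV. G $ i $ k * G $ j $ l * (a $ i * b $ j) * H $ k $ l)"
    proof (intro sum.cong refl)
      fix k l
      show "(G *v a) $ k * (H $ k $ l * (G *v b) $ l) =
          (\<Sum>i\<in>UNIV. \<Sum>j\<in>UNIV. G $ i $ k * G $ j $ l * (a $ i * b $ j) * H $ k $ l)"
        unfolding Gv sum_distrib_left[of "H $ k $ l"] sum_product
        by (intro sum.cong refl) (simp add: mult_ac)
    qed
    also have "\<dots> = (\<Sum>k\<in>UNIV. \<Sum>i\<in>UNIV. \<Sum>l\<in>UNIV. \<Sum>j\<in>UNIV. G $ i $ k * G $ j $ l * (a $ i * b $ j) * H $ k $ l)"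
      by (intro sum.cong refl sum.swap)
    also have "\<dots> = (\<Sum>i\<in>UNIV. \<Sum>k\<in>UNIV. \<Sum>l\<in>UNIV. \<Sum>j\<in>UNIV. G $ i $ k * G $ j $ l * (a $ i * b $ j) * H $ k $ l)"
      by (rule sum.swap)
    also have "\<dots> = (\<Sum>i\<in>UNIV. \<Sum>k\<in>UNIV. \<Sum>j\<in>UNIV. \<Sum>l\<in>UNIV. G $ i $ k * G $ j $ l * (a $ i * b $ j) * H $ k $ l)"
      by (intro sum.cong refl sum.swap)
    also have "\<dots> = (\<Sum>i\<in>UNIV. \<Sum>j\<in>UNIV. \<Sum>k\<in>UNIV. \<Sum>l\<in>UNIV. G $ i $ k * G $ j $ l * (a $ i * b $ j) * H $ k $ l)"
      by (intro sum.cong refl sum.swap)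
    finally show ?thesis by simp
  qed
  have "L = v p * laplacian A (g 0) (u 0) p + u 0 p * laplacian A (g 0) v p + 2 * pairing (g 0) v (u 0) ?c p"
    unfolding L_def by (rule laplacian_mult[OF metric0 smooth_v smooth_u[OF I(2)] p])
  moreover have "laplacian A (g 0) (u 0) p = - (lam 0 * u 0 p)" "laplacian A (g 0) v p = - (lam 0 * v p)"
    using bspec[OF eig_u[OF I(2)] p] bspec[OF eig_v p] by linarith+
  moreover have "pairing (g 0) v (u 0) ?c p = pairing (g 0) (u 0) v ?c p"
    by (rule pairing_commute[OF metric0 c])
  ultimately have L: "L = 2 * pairing (g 0) (u 0) v ?c p - 2 * lam 0 * (u 0 p * v p)"
    by (simp add: algebra_simps)
  have "?T =
     (\<Sum>i\<in>UNIV. \<Sum>j\<in>UNIV. \<Sum>k\<in>UNIV. \<Sum>l\<in>UNIV.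
        L / 4 * (G $ i $ k * G $ j $ l * B $ i $ j * H $ k $ l) - G $ i $ k * G $ j $ l * (a $ i * b $ j) * H $ k $ l)"
    unfolding tensor_inner_def Let_def tensor_prod_def
    by (intro sum.cong refl) (simp add: G_def B_def H_def a_def b_def L_def algebra_simps)
  also have "\<dots> = L / 4 * trace (G ** H) - (\<Sum>k\<in>UNIV. \<Sum>l\<in>UNIV. (G *v a) $ k * (H $ k $ l * (G *v b) $ l))"
    unfolding t1[symmetric] t2[symmetric] by (simp add: sum_subtractf sum_distrib_left)
  also have "\<dots> = defect_limit ?c p + deriv lam 0 * (u 0 p * v p)"
    unfolding defect_limit_def Let_def gradient_def L
    by (simp add: G_def B_def H_def a_def b_def field_simps)
  finally show ?thesis .
qed

lemma integral_tensor:
  "(\<integral>p. tensor_inner A (g 0)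
        (\<lambda>c q. (1/4 * laplacian A (g 0) (\<lambda>x. v x * u 0 x) q) *\<^sub>R g 0 c q
               - (differential v \<otimes>\<^sub>T differential (u 0)) c q)
        (variation_tensor g) p \<partial>volume_measure M A (g 0)) =
     deriv lam 0 * (\<integral>p. u 0 p * v p \<partial>volume_measure M A (g 0))" (is "?L = _")
proof -
  let ?\<mu> = "volume_measure M A (g 0)"
  have i: "integrable ?\<mu> (\<lambda>p. u 0 p * v p)"
    by (intro integrable_vol_continuous[OF metric0] continuous_on_mult C1_fun_continuous C1_u[OF I(2)] C1_v)
  have "?L =
     (\<integral>p. defect_limit (chart_at A p) p + deriv lam 0 * (u 0 p * v p) \<partial>?\<mu>)"
    by (rule Bochner_Integration.integral_cong[OF refl tensor_identity]) (simp add: metric0)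
  also have "\<dots> = deriv lam 0 * (\<integral>p. u 0 p * v p \<partial>?\<mu>)"
    using integral_defect_limit i by simp
  finally show ?thesis .
qed

end

theorem lemma4:
  fixes M :: "'a::t2_space set"
    and A :: "('a, 'n::finite) chart set"
    and g :: "real \<Rightarrow> ('a, 'n) tensor2"
    and \<phi> :: "'i \<Rightarrow> real \<Rightarrow> 'a \<Rightarrow> real"
    and lam :: "real \<Rightarrow> real"
    and J :: "'i set" and \<epsilon> :: real and i j :: 'i
  assumes dim: "2 \<le> CARD('n)"
    and mfd: "compact_oriented_manifold M A"
    and eps: "0 < \<epsilon>"
    and metric: "smooth_variation A {-\<epsilon><..<\<epsilon>} g"
    and fin: "finite J"
    and phi_diff: "\<forall>k\<in>J. differentiable_curve A {-\<epsilon><..<\<epsilon>} (\<phi> k)"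
    and lam_diff: "lam differentiable_on {-\<epsilon><..<\<epsilon>}"
    and orthonormal: "\<forall>t\<in>{-\<epsilon><..<\<epsilon>}. \<forall>k\<in>J. \<forall>l\<in>J.
      L2_inner M A (g t) (\<phi> k t) (\<phi> l t) = (if k = l then 1 else 0)"
    and eigen: "\<forall>t\<in>{-\<epsilon><..<\<epsilon>}. \<forall>k\<in>J. \<forall>p\<in>M.
      - laplacian A (g t) (\<phi> k t) p = lam t * \<phi> k t p"
    and neumann: "\<forall>t\<in>{-\<epsilon><..<\<epsilon>}. \<forall>k\<in>J. \<forall>p\<in>mfd_boundary A.
      normal_derivative A (g t) (\<phi> k t) p = 0"
    and ij: "i \<in> J" "j \<in> J"
  shows "deriv lam 0 * (if i = j then 1 else 0) =
    (LINT p|volume_measure M A (g 0).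
      tensor_inner A (g 0)
        (\<lambda>c q. (1/4 * laplacian A (g 0) (\<lambda>x. \<phi> i 0 x * \<phi> j 0 x) q) *\<^sub>R g 0 c q
               - (differential (\<phi> i 0) \<otimes>\<^sub>T differential (\<phi> j 0)) c q)
        (variation_tensor g) p)"
proof -
  let ?I = "{-\<epsilon><..<\<epsilon>}"
  have 0: "0 \<in> ?I" using eps by simp
  have smooth: "smooth_fun A (\<phi> i 0)"
    using phi_diff ij(1) 0 by (auto simp: differentiable_curve_def)
  have "lam differentiable (at 0)"
    using lam_diff 0 by (metis at_within_open differentiable_on_def open_greaterThanLessThan)
  interpret eigenfunction_variation M A \<epsilon> g "\<phi> j" "\<phi> i 0" lam
    by unfold_locales (use assms smooth 0 \<open>lam differentiable (at 0)\<close> in auto)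
  have "(\<integral>p. \<phi> j 0 p * \<phi> i 0 p \<partial>volume_measure M A (g 0)) = (if i = j then 1 else 0)"
    using orthonormal 0 ij by (auto simp: L2_inner_def)
  then show ?thesis using integral_tensor by simp
qed

end
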